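(* Let $n\ge 1$. The maps $r_a,\bar r_a$ ($a=0,1,\dots,n-1$), defined on the generators of $\mathfrak{aw}(n)$ as in the context and extended multiplicatively and linearly, are well-defined algebra automorphisms of $\mathfrak{aw}(n)$, and they satisfy $$r_a\bar r_a=\bar r_a r_a=\mathrm{Id}\quad (a=0,1,\dots,n-1),$$ $$r_ar_{a+1}r_a=r_{a+1}r_ar_{a+1}\quad (a=0,1,\dots,n-2),$$ $$r_ar_b=r_br_a\quad (a,b\in\{0,1,\dots,n-1\},\ |a-b|>1),$$ which are the defining relations of the braid group on $n+1$ strands.
   Context: Base field $\mathbb{C}(q)$, $q$ an indeterminate. $[A,B]=AB-BA$, $[A,B]_q=\frac{1}{q-q^{-1}}(qAB-q^{-1}BA)$. For $I,J\subseteq\{1,\dots,n\}$, $I<J$ means every element of $I$ is strictly smaller than every element of $J$. A connected subset is a non-empty set of consecutive integers. Two disjoint connected subsets are adjacent if their union is connected. A sequence $(I_1,\dots,I_k)$ of connected subsets is monotonic if $I_1<\dots<I_k$ or $I_1>\dots>I_k$; it is a monotonic sequence of adjacent subsets if moreover $I_j,I_{j+1}$ are adjacent for all $j$. Elements: $C_I$ for $I\subseteq\{1,\dots,n\}$ connected; $C_\varnothing:=1$; $C_{j\dots k}:=C_{\{j,j+1,\dots,k\}}$. Adjacent sets in an index are merged: if $I_1,I_2$ are disjoint, connected and adjacent then $C_{I_1I_2}=C_{I_2I_1}:=C_{I_1\cup I_2}$ (similarly for more sets; e.g. $C_{I_1I_3I_4}$ with $I_3,I_4$ adjacent means $C_{I_1(I_3\cup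 I_4)}$); empty sets in an index are dropped. If $I_1,I_2$ are disjoint connected subsets and the hole $H$ between them (the set of integers strictly between $I_1$ and $I_2$) is non-empty, then $$C_{I_1I_2}:=-[C_{I_1H},C_{HI_2}]_q+C_{I_1}C_{I_2}+C_HC_{I_1HI_2}$$ (the order of the pair $(I_1,I_2)$ matters: in general $C_{I_1I_2}\ne C_{I_2I_1}$). The algebra $\mathfrak{aw}(n)$ is the unital associative algebra generated by the $C_I$, $I$ a connected subset of $\{1,\dots,n\}$, with relations: (i) $[C_I,C_J]=0$ for connected $I,J$ with $I\cap J=\varnothing$ or $I\subset J$; (ii) $C_{I_1I_2}=-[C_{I_2I_3},C_{I_1I_3}]_q+C_{I_1}C_{I_2}+C_{I_3}C_{I_1I_2I_3}$ for every monotonic sequence $(I_1,I_2,I_3)$ of adjacent connected subsets; (iii) $C_{I_1I_4}=-[C_{I_1I_3},C_{I_3I_4}]_q+C_{I_1}C_{I_4}+C_{I_3}C_{I_1I_3I_4}$ for every monotonic sequence $(I_1,I_2,I_3,I_4)$ of adjacent connected subsets. Maps on generators. For $i\in\{1,\dots,n-1\}$: $r_i(C_{i+1\dots k})=C_{\{i\}\{i+2,\dots,k\}}$ for $k\ge i+1$; $r_i(C_{j\dots i})=C_{\{i+1\}\{j,\dots,i-1\}}$ for $j\le i$; $r_i(C_{j\dots k})=C_{j\dots k}$ if $\{i,i+1\}\subset\{j,\dots,k\}$ or $\{i,i+1\}\cap\{j,\dots,k\}=\varnothing$. Moreover $r_0(C_{j\dots k})=C_{j\dots k}$ for $2\le j\le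 k\le n$, and $r_0(C_{1\dots k})=C_{\{k+1,\dots,n\}\{1\}}$ for $1\le k\le n$. The maps $\bar r_a$ are given by $\bar r_a(C_I)=(r_a(C_I))^{\mathrm{up}}$ for connected $I$, where ${}^{\mathrm{up}}$ is the algebra anti-automorphism of $\mathfrak{aw}(n)$ fixing every generator $C_I$; it satisfies $C_{I_1I_2}^{\mathrm{up}}=C_{I_2I_1}$, so $\bar r_a$ is given by the formulas for $r_a$ with the order of the pair of subsets on the right-hand side reversed. Products of maps denote composition. *)

theory Defs
  imports "HOL-Library.Cardinality" "HOL-Library.Poly_Mapping" "HOL-Computational_Algebra.Fraction_Field"
    "HOL-Computational_Algebra.Polynomial"
begin

section \<open>Algebras over the field of rational functions\<close>

type_synonym cq = "complex poly fract"

text \<open>Keeps transfer from unfolding scalars into pairs of coefficient sequences.\<close>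

lifting_forget fract.lifting
lifting_forget poly.lifting

definition qq :: cq where
  "qq = Fraction_Field.Fract [:0, 1:] 1"

class cq_algebra = ring_1 +
  fixes scale_cq :: "cq \<Rightarrow> 'a \<Rightarrow> 'a" (infixr "*\<^sub>q" 75)
  assumes scale_cq_add_right: "c *\<^sub>q (x + y) = c *\<^sub>q x + c *\<^sub>q y"
    and scale_cq_add_left: "(c + d) *\<^sub>q x = c *\<^sub>q x + d *\<^sub>q x"
    and scale_cq_scale_cq: "c *\<^sub>q (d *\<^sub>q x) = (c * d) *\<^sub>q x"
    and scale_cq_one: "1 *\<^sub>q x = x"
    and mult_scale_cq_left: "(c *\<^sub>q x) * y = c *\<^sub>q (x * y)"
    and mult_scale_cq_right: "x * (c *\<^sub>q y) = c *\<^sub>q (x * y)"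

definition alg_hom :: "('a::cq_algebra \<Rightarrow> 'b::cq_algebra) \<Rightarrow> bool" where
  "alg_hom f \<longleftrightarrow> f 1 = 1 \<and> (\<forall>x y. f (x + y) = f x + f y) \<and>
     (\<forall>c x. f (c *\<^sub>q x) = c *\<^sub>q f x) \<and> (\<forall>x y. f (x * y) = f x * f y)"

definition alg_antihom :: "('a::cq_algebra \<Rightarrow> 'b::cq_algebra) \<Rightarrow> bool" where
  "alg_antihom f \<longleftrightarrow> f 1 = 1 \<and> (\<forall>x y. f (x + y) = f x + f y) \<and>
     (\<forall>c x. f (c *\<^sub>q x) = c *\<^sub>q f x) \<and> (\<forall>x y. f (x * y) = f y * f x)"

definition alg_automorphism :: "('a::cq_algebra \<Rightarrow> 'a) \<Rightarrow> bool" where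
  "alg_automorphism f \<longleftrightarrow> alg_hom f \<and> bij f"

definition alg_antiautomorphism :: "('a::cq_algebra \<Rightarrow> 'a) \<Rightarrow> bool" where
  "alg_antiautomorphism f \<longleftrightarrow> alg_antihom f \<and> bij f"

definition qcomm :: "'a::cq_algebra \<Rightarrow> 'a \<Rightarrow> 'a" where
  "qcomm A B = (1 / (qq - inverse qq)) *\<^sub>q (qq *\<^sub>q (A * B) - inverse qq *\<^sub>q (B * A))"


section \<open>Connected subsets\<close>

definition conn :: "nat set \<Rightarrow> bool" where
  "conn I \<longleftrightarrow> (\<exists>j k. j \<le> k \<and> I = {j..k})"

definition set_less :: "nat set \<Rightarrow> nat set \<Rightarrow> bool" where
  "set_less I J \<longleftrightarrow> (\<forall>i\<in>I. \<forall>j\<in>J. i < j)"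

definition adjacent :: "nat set \<Rightarrow> nat set \<Rightarrow> bool" where
  "adjacent I J \<longleftrightarrow> I \<inter> J = {} \<and> conn (I \<union> J)"

definition monotonic :: "nat set list \<Rightarrow> bool" where
  "monotonic Is \<longleftrightarrow> (\<forall>I\<in>set Is. conn I) \<and>
     (sorted_wrt set_less Is \<or> sorted_wrt (\<lambda>I J. set_less J I) Is)"

definition monotonic_adjacent :: "nat set list \<Rightarrow> bool" where
  "monotonic_adjacent Is \<longleftrightarrow> monotonic Is \<and> successively adjacent Is"

definition hole :: "nat set \<Rightarrow> nat set \<Rightarrow> nat set" where
  "hole I J = {h. (\<forall>i\<in>I. \<forall>j\<in>J. i < h \<and> h < j) \<or> (\<forall>i\<in>I. \<forall>j\<in>J. j < h \<and> h < i)}"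

text \<open>
  The element with the two-set index \<open>I J\<close>, for disjoint sets each of which is connected or
  empty, where \<open>C\<close> sends connected sets to the generators and the empty set to \<open>1\<close>.
  The order of \<open>I\<close> and \<open>J\<close> matters when the hole is non-empty.
\<close>

definition pairC :: "(nat set \<Rightarrow> 'a::cq_algebra) \<Rightarrow> nat set \<Rightarrow> nat set \<Rightarrow> 'a" where
  "pairC C I J =
     (if I = {} \<or> J = {} \<or> adjacent I J then C (I \<union> J)
      else let H = hole I J in
        - qcomm (C (I \<union> H)) (C (H \<union> J)) + C I * C J + C H * C (I \<union> H \<union> J))"


section \<open>Free algebras\<close>

text \<open>Words, i.e. the free monoid; written additively because \<^typ>\<open>'a \<Rightarrow>\<^sub>0 'b\<close>
  carries the monoid algebra structure for additive monoids of exponents.\<close>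

datatype 'a fmonoid = Wrd "'a list"

instantiation fmonoid :: (type) monoid_add
begin
definition zero_fmonoid :: "'a fmonoid" where "0 = Wrd []"
fun plus_fmonoid :: "'a fmonoid \<Rightarrow> 'a fmonoid \<Rightarrow> 'a fmonoid" where
  "Wrd u + Wrd v = Wrd (u @ v)"
instance
proof
  fix a b c :: "'a fmonoid"
  show "a + b + c = a + (b + c)" by (cases a; cases b; cases c) simp
  show "0 + a = a" "a + 0 = a" by (cases a; simp add: zero_fmonoid_def)+
qed
end

typedef 'a freealg = "UNIV :: ('a fmonoid \<Rightarrow>\<^sub>0 cq) set" ..

setup_lifting type_definition_freealg

lemma update_eq_add_single:
  assumes "k \<notin> Poly_Mapping.keys f"
  shows "Poly_Mapping.update k v f = f + Poly_Mapping.single k v"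
  using assms
  by (intro poly_mapping_eqI)
     (auto simp: lookup_add lookup_update lookup_single when_def in_keys_iff)

lemma central_single:
  fixes p :: "'a fmonoid \<Rightarrow>\<^sub>0 cq"
  shows "p * Poly_Mapping.single 0 c = Poly_Mapping.single 0 c * p"
proof (induction p rule: update_induct)
  case const
  show ?case by simp
next
  case (update f k v)
  then show ?case
    by (simp add: update_eq_add_single distrib_left distrib_right mult_single mult.commute)
qed

lemma central_single_left:
  fixes p r :: "'a fmonoid \<Rightarrow>\<^sub>0 cq"
  shows "p * (Poly_Mapping.single 0 c * r) = Poly_Mapping.single 0 c * (p * r)"
  by (simp only: mult.assoc[symmetric] central_single)

instantiation freealg :: (type) cq_algebra
begin
lift_definition zero_freealg :: "'a freealg" is 0 .
lift_definition one_freealg :: "'a freealg" is 1 .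
lift_definition plus_freealg :: "'a freealg \<Rightarrow> 'a freealg \<Rightarrow> 'a freealg" is "(+)" .
lift_definition minus_freealg :: "'a freealg \<Rightarrow> 'a freealg \<Rightarrow> 'a freealg" is "(-)" .
lift_definition uminus_freealg :: "'a freealg \<Rightarrow> 'a freealg" is uminus .
lift_definition times_freealg :: "'a freealg \<Rightarrow> 'a freealg \<Rightarrow> 'a freealg" is "(*)" .
lift_definition scale_cq_freealg :: "cq \<Rightarrow> 'a freealg \<Rightarrow> 'a freealg"
  is "\<lambda>c p. Poly_Mapping.single 0 c * p" .
instance
proof
  fix a b c :: "'a freealg" and s t :: cq
  show "a + b + c = a + (b + c)" by transfer (simp add: add.assoc)
  show "a + b = b + a" by transfer (simp add: add.commute)
  show "0 + a = a" by transfer simp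
  show "- a + a = 0" by transfer simp
  show "a - b = a + - b" by transfer simp
  show "a * b * c = a * (b * c)" by transfer (simp add: mult.assoc)
  show "1 * a = a" by transfer simp
  show "a * 1 = a" by transfer simp
  show "(a + b) * c = a * c + b * c" by transfer (simp add: distrib_right)
  show "a * (b + c) = a * b + a * c" by transfer (simp add: distrib_left)
  show "(0::'a freealg) \<noteq> 1" by transfer simp
  show "s *\<^sub>q (a + b) = s *\<^sub>q a + s *\<^sub>q b" by transfer (simp add: distrib_left)
  show "(s + t) *\<^sub>q a = s *\<^sub>q a + t *\<^sub>q a" by transfer (simp add: single_add distrib_right)
  show "s *\<^sub>q (t *\<^sub>q a) = (s * t) *\<^sub>q a"
    by transfer (simp add: mult.assoc[symmetric] mult_single)
  show "1 *\<^sub>q a = a" by transfer simp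
  show "(s *\<^sub>q a) * b = s *\<^sub>q (a * b)" by transfer (simp add: mult.assoc)
  show "a * (s *\<^sub>q b) = s *\<^sub>q (a * b)"
    by transfer (rule central_single_left)
qed
end

lift_definition fgen :: "'a \<Rightarrow> 'a freealg" is "\<lambda>x. Poly_Mapping.single (Wrd [x]) 1" .

inductive_set ideal_gen :: "'a::ring_1 set \<Rightarrow> 'a set" for S where
  incl: "s \<in> S \<Longrightarrow> s \<in> ideal_gen S"
| zero: "0 \<in> ideal_gen S"
| add: "x \<in> ideal_gen S \<Longrightarrow> y \<in> ideal_gen S \<Longrightarrow> x + y \<in> ideal_gen S"
| mult_left: "x \<in> ideal_gen S \<Longrightarrow> a * x \<in> ideal_gen S"
| mult_right: "x \<in> ideal_gen S \<Longrightarrow> x * a \<in> ideal_gen S"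

lemma ideal_gen_uminus: "x \<in> ideal_gen S \<Longrightarrow> - x \<in> ideal_gen S"
  using ideal_gen.mult_left[of x S "- 1"] by simp

lemma ideal_gen_diff: "x \<in> ideal_gen S \<Longrightarrow> y \<in> ideal_gen S \<Longrightarrow> x - y \<in> ideal_gen S"
  using ideal_gen.add[of x S "- y"] ideal_gen_uminus[of y S] by simp


section \<open>The algebra aw(n)\<close>

text \<open>The number \<open>n\<close> is encoded as the cardinality of a finite type \<open>'n\<close>; the type
  \<open>'n conn\<close> is the set of generators.\<close>

typedef (overloaded) 'n conn = "{I. conn I \<and> I \<subseteq> {1..CARD('n::finite)}}"
proof -
  have "conn {1}" unfolding conn_def by (rule exI[of _ 1], rule exI[of _ 1]) auto
  moreover have "{1} \<subseteq> {1..CARD('n)}" by (simp add: Suc_le_eq)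
  ultimately show ?thesis by blast
qed

text \<open>Only meaningful for the empty set and for connected subsets of \<open>{1..CARD('n)}\<close>.\<close>

definition freeC :: "nat set \<Rightarrow> 'n::finite conn freealg" where
  "freeC I = (if I = {} then 1 else fgen (Abs_conn I))"

definition relators :: "'n::finite conn freealg set" where
  "relators =
     {freeC I * freeC J - freeC J * freeC I | I J.
        conn I \<and> conn J \<and> I \<union> J \<subseteq> {1..CARD('n)} \<and> (I \<inter> J = {} \<or> I \<subseteq> J)}
   \<union> {freeC (I1 \<union> I2) -
        (- qcomm (freeC (I2 \<union> I3)) (pairC freeC I1 I3)
         + freeC I1 * freeC I2 + freeC I3 * freeC (I1 \<union> I2 \<union> I3)) | I1 I2 I3.
        monotonic_adjacent [I1, I2, I3] \<and> I1 \<union> I2 \<union> I3 \<subseteq> {1..CARD('n)}}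
   \<union> {pairC freeC I1 I4 -
        (- qcomm (pairC freeC I1 I3) (freeC (I3 \<union> I4))
         + freeC I1 * freeC I4 + freeC I3 * pairC freeC I1 (I3 \<union> I4)) | I1 I2 I3 I4.
        monotonic_adjacent [I1, I2, I3, I4] \<and> I1 \<union> I2 \<union> I3 \<union> I4 \<subseteq> {1..CARD('n)}}"

text \<open>The constant term vanishes on all relators, so the quotient is not the zero ring
  (as required by \<^class>\<open>ring_1\<close>).\<close>

lift_definition const_term :: "'a freealg \<Rightarrow> cq" is "\<lambda>p. Poly_Mapping.lookup p 0" .

lemma fmonoid_add_eq_0: "(u + v :: 'a fmonoid) = 0 \<longleftrightarrow> u = 0 \<and> v = 0"
  by (cases u; cases v) (simp add: zero_fmonoid_def)

lemma lookup_mult_0: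
  fixes p r :: "'a fmonoid \<Rightarrow>\<^sub>0 cq"
  shows "Poly_Mapping.lookup (p * r) 0 = Poly_Mapping.lookup p 0 * Poly_Mapping.lookup r 0"
proof (induction p rule: update_induct)
  case const
  show ?case by simp
next
  case (update f k v)
  have "Poly_Mapping.lookup (Poly_Mapping.single k v * r) 0
      = Poly_Mapping.lookup (Poly_Mapping.single k v) 0 * Poly_Mapping.lookup r 0"
  proof (induction r rule: update_induct)
    case const
    show ?case by simp
  next
    case (update g l w)
    then show ?case
      by (auto simp: update_eq_add_single distrib_left mult_single lookup_add lookup_single
          when_def fmonoid_add_eq_0)
  qed
  with update show ?case
    by (simp add: update_eq_add_single distrib_right lookup_add)
qed

lemma const_term_simps:
  "const_term 0 = 0" "const_term 1 = 1"
  "const_term (x + y) = const_term x + const_term y"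
  "const_term (x - y) = const_term x - const_term y"
  "const_term (- x) = - const_term x"
  "const_term (x * y) = const_term x * const_term y"
  "const_term (c *\<^sub>q x) = c * const_term x"
  by (transfer; simp add: lookup_add lookup_minus lookup_mult_0 lookup_single lookup_one)+

lemma const_term_freeC: "I \<noteq> {} \<Longrightarrow> const_term (freeC I) = 0"
  unfolding freeC_def
  by (simp, transfer) (simp add: lookup_single zero_fmonoid_def when_def)

lemma const_term_qcomm: "const_term x = 0 \<Longrightarrow> const_term (qcomm x y) = 0"
  by (simp add: qcomm_def const_term_simps)

lemma const_term_pairC:
  "I \<noteq> {} \<Longrightarrow> J \<noteq> {} \<Longrightarrow> const_term (pairC freeC I J) = 0"
  by (simp add: pairC_def Let_def const_term_simps const_term_freeC const_term_qcomm)

lemma conn_nonempty: "conn I \<Longrightarrow> I \<noteq> {}"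
  by (auto simp: conn_def)

lemma const_term_relators: "x \<in> relators \<Longrightarrow> const_term x = 0"
  unfolding relators_def Un_iff mem_Collect_eq
  by (elim disjE exE conjE)
     (simp_all add: const_term_simps const_term_freeC const_term_qcomm const_term_pairC
      monotonic_adjacent_def monotonic_def conn_nonempty)

lemma const_term_ideal: "x \<in> ideal_gen relators \<Longrightarrow> const_term x = 0"
  by (induction rule: ideal_gen.induct) (simp_all add: const_term_simps const_term_relators)

definition aw_rel :: "'n::finite conn freealg \<Rightarrow> 'n conn freealg \<Rightarrow> bool" where
  "aw_rel x y \<longleftrightarrow> x - y \<in> ideal_gen relators"

quotient_type (overloaded) 'n aw = "'n::finite conn freealg" / aw_rel
proof (rule equivpI)
  show "reflp (aw_rel :: 'n conn freealg \<Rightarrow> _)"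
    by (rule reflpI) (simp add: aw_rel_def ideal_gen.zero)
  show "symp (aw_rel :: 'n conn freealg \<Rightarrow> _)"
    by (rule sympI) (metis aw_rel_def ideal_gen_uminus minus_diff_eq)
  show "transp (aw_rel :: 'n conn freealg \<Rightarrow> _)"
  proof (rule transpI)
    fix x y z :: "'n conn freealg"
    assume "aw_rel x y" "aw_rel y z"
    then have "(x - y) + (y - z) \<in> ideal_gen relators"
      unfolding aw_rel_def by (rule ideal_gen.add)
    then show "aw_rel x z" by (simp add: aw_rel_def)
  qed
qed

instantiation aw :: (finite) cq_algebra
begin
lift_definition zero_aw :: "'a aw" is 0 .
lift_definition one_aw :: "'a aw" is 1 .
lift_definition plus_aw :: "'a aw \<Rightarrow> 'a aw \<Rightarrow> 'a aw" is "(+)"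
proof -
  fix x x' y y' :: "'a conn freealg"
  assume "aw_rel x x'" "aw_rel y y'"
  then have "(x - x') + (y - y') \<in> ideal_gen relators"
    unfolding aw_rel_def by (rule ideal_gen.add)
  then show "aw_rel (x + y) (x' + y')"
    by (simp only: aw_rel_def add_diff_add)
qed
lift_definition minus_aw :: "'a aw \<Rightarrow> 'a aw \<Rightarrow> 'a aw" is "(-)"
proof -
  fix x x' y y' :: "'a conn freealg"
  assume "aw_rel x x'" "aw_rel y y'"
  then have "(x - x') - (y - y') \<in> ideal_gen relators"
    unfolding aw_rel_def by (rule ideal_gen_diff)
  moreover have "(x - x') - (y - y') = (x - y) - (x' - y')"
    by (simp add: algebra_simps)
  ultimately show "aw_rel (x - y) (x' - y')"
    by (simp only: aw_rel_def)
qed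
lift_definition uminus_aw :: "'a aw \<Rightarrow> 'a aw" is uminus
proof -
  fix x x' :: "'a conn freealg"
  assume "aw_rel x x'"
  then have "- (x - x') \<in> ideal_gen relators"
    unfolding aw_rel_def by (rule ideal_gen_uminus)
  moreover have "- (x - x') = - x - - x'" by simp
  ultimately show "aw_rel (- x) (- x')"
    by (simp only: aw_rel_def)
qed
lift_definition times_aw :: "'a aw \<Rightarrow> 'a aw \<Rightarrow> 'a aw" is "(*)"
proof -
  fix x x' y y' :: "'a conn freealg"
  assume "aw_rel x x'" "aw_rel y y'"
  then have "(x - x') * y + x' * (y - y') \<in> ideal_gen relators"
    unfolding aw_rel_def by (intro ideal_gen.add ideal_gen.mult_left ideal_gen.mult_right)
  moreover have "(x - x') * y + x' * (y - y') = x * y - x' * y'"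
    by (simp add: left_diff_distrib right_diff_distrib)
  ultimately show "aw_rel (x * y) (x' * y')"
    by (simp only: aw_rel_def)
qed
lift_definition scale_cq_aw :: "cq \<Rightarrow> 'a aw \<Rightarrow> 'a aw" is scale_cq
proof -
  fix c :: cq and x x' :: "'a conn freealg"
  assume "aw_rel x x'"
  then have "(c *\<^sub>q 1) * (x - x') \<in> ideal_gen relators"
    unfolding aw_rel_def by (rule ideal_gen.mult_left)
  moreover have "(c *\<^sub>q 1) * (x - x') = c *\<^sub>q x - c *\<^sub>q x'"
    by (simp only: right_diff_distrib mult_scale_cq_left mult_1_left)
  ultimately show "aw_rel (c *\<^sub>q x) (c *\<^sub>q x')"
    by (simp only: aw_rel_def)
qed
instance
proof
  fix a b c :: "'a aw" and s t :: cq
  have eq: "aw_rel x y" if "x = y" for x y :: "'a conn freealg"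
    using that by (simp add: aw_rel_def ideal_gen.zero)
  show "a + b + c = a + (b + c)" by transfer (rule eq, rule add.assoc)
  show "a + b = b + a" by transfer (rule eq, rule add.commute)
  show "0 + a = a" by transfer (rule eq, simp)
  show "- a + a = 0" by transfer (rule eq, simp)
  show "a - b = a + - b" by transfer (rule eq, simp)
  show "a * b * c = a * (b * c)" by transfer (rule eq, rule mult.assoc)
  show "1 * a = a" by transfer (rule eq, simp)
  show "a * 1 = a" by transfer (rule eq, simp)
  show "(a + b) * c = a * c + b * c" by transfer (rule eq, rule distrib_right)
  show "a * (b + c) = a * b + a * c" by transfer (rule eq, rule distrib_left)
  show "(0::'a aw) \<noteq> 1"
    by transfer (auto simp: aw_rel_def const_term_simps dest!: const_term_ideal)
  show "s *\<^sub>q (a + b) = s *\<^sub>q a + s *\<^sub>q b" by transfer (rule eq, rule scale_cq_add_right)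
  show "(s + t) *\<^sub>q a = s *\<^sub>q a + t *\<^sub>q a" by transfer (rule eq, rule scale_cq_add_left)
  show "s *\<^sub>q (t *\<^sub>q a) = (s * t) *\<^sub>q a" by transfer (rule eq, rule scale_cq_scale_cq)
  show "1 *\<^sub>q a = a" by transfer (rule eq, rule scale_cq_one)
  show "(s *\<^sub>q a) * b = s *\<^sub>q (a * b)" by transfer (rule eq, rule mult_scale_cq_left)
  show "a * (s *\<^sub>q b) = s *\<^sub>q (a * b)" by transfer (rule eq, rule mult_scale_cq_right)
qed
end

lift_definition awC :: "nat set \<Rightarrow> 'n::finite aw" is freeC .

lemma awC_empty: "awC {} = 1"
  by transfer (simp add: freeC_def aw_rel_def ideal_gen.zero)


section \<open>The maps on generators and their extensions\<close>

text \<open>A family \<open>\<phi> j k\<close> prescribes the images of the generators with index \<open>{j..k}\<close>.\<close>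

definition extends_gens :: "(nat \<Rightarrow> nat \<Rightarrow> 'n::finite aw) \<Rightarrow> ('n aw \<Rightarrow> 'n aw) \<Rightarrow> bool" where
  "extends_gens \<phi> f \<longleftrightarrow> alg_hom f \<and>
     (\<forall>j k. 1 \<le> j \<and> j \<le> k \<and> k \<le> CARD('n) \<longrightarrow> f (awC {j..k}) = \<phi> j k)"

definition well_defined_ext :: "(nat \<Rightarrow> nat \<Rightarrow> 'n::finite aw) \<Rightarrow> bool" where
  "well_defined_ext \<phi> \<longleftrightarrow> (\<exists>!f. extends_gens \<phi> f)"

definition gens_ext :: "(nat \<Rightarrow> nat \<Rightarrow> 'n::finite aw) \<Rightarrow> 'n aw \<Rightarrow> 'n aw" where
  "gens_ext \<phi> = (THE f. extends_gens \<phi> f)"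

text \<open>The anti-automorphism exists because the ideal of relators is stable under reversing
  words; it is unique because the \<open>awC I\<close> generate.\<close>

definition aw_up :: "'n::finite aw \<Rightarrow> 'n aw" where
  "aw_up = (THE f. alg_antiautomorphism f \<and>
     (\<forall>I. conn I \<and> I \<subseteq> {1..CARD('n)} \<longrightarrow> f (awC I) = awC I))"

text \<open>Some of the index sets below may be empty: \<open>{k+1..n}\<close> if \<open>k = n\<close>,
  \<open>{a+2..k}\<close> if \<open>k = a+1\<close>, and \<open>{j..a-1}\<close> if \<open>j = a\<close>.\<close>

definition r_gen :: "nat \<Rightarrow> nat \<Rightarrow> nat \<Rightarrow> 'n::finite aw" where
  "r_gen a j k =
     (if a = 0 then (if j = 1 then pairC awC {k+1..CARD('n)} {1} else awC {j..k})
      else if j = a + 1 then pairC awC {a} {a+2..k}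
      else if k = a then pairC awC {a+1} {j..a-1}
      else awC {j..k})"

definition rbar_gen :: "nat \<Rightarrow> nat \<Rightarrow> nat \<Rightarrow> 'n::finite aw" where
  "rbar_gen a j k = aw_up (r_gen a j k)"

definition r_map :: "nat \<Rightarrow> 'n::finite aw \<Rightarrow> 'n aw" where
  "r_map a = gens_ext (r_gen a)"

definition rbar_map :: "nat \<Rightarrow> 'n::finite aw \<Rightarrow> 'n aw" where
  "rbar_map a = gens_ext (rbar_gen a)"

end

theory Submission
  imports Defs
begin

text \<open>
  Number the cuts between consecutive integers by the vertices \<open>1, \<dots>, n + 1\<close> of a polygon and
  regard \<open>C\<close> with index \<open>{u..<v}\<close> as a symmetric function \<open>F u v\<close> of the chord joining \<open>u\<close> and
  \<open>v\<close>. The defining relations then become invariant under all rotations and reflections of the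
  polygon: non-crossing chords commute, every quadrilateral carries an Askey--Wilson relation, and
  every pentagon carries one further relation. For the pentagons this invariance has to be
  proved: writing a diagonal \<open>u2\<close> as a q-commutator with \<open>u1\<close> turns the relation for
  \<open>u1, u2, u3\<close> into the one for \<open>u2, u3, u4\<close>.

  Each \<open>r\<close> moves one vertex \<open>v\<close> with neighbours \<open>p\<close> and \<open>s\<close>: chords avoiding \<open>v\<close> are fixed and
  \<open>F v w\<close> is sent to \<open>- qcomm (F p s) (F v w) + F p v * F s w + F v s * F w p\<close>. Relations that are
  linear in the chords at \<open>v\<close> are preserved because \<open>F p s\<close> commutes with the other chords and the
  relations also hold, possibly in degenerate form, with \<open>p\<close> or \<open>s\<close> in place of \<open>v\<close>. What
  remains are relations quadratic in the chords at \<open>v\<close>: the images commute with each other by a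
  computation in one pentagon, and the Askey--Wilson relations follow, by means of the linear
  pentagon relations, from those for quadrilaterals containing \<open>p\<close>, which are again a computation
  in one pentagon. Conjugating with the anti-automorphism that fixes the generators gives the
  inverse, and the braid relation is an instance of the pentagon relation.
\<close>

text \<open>The defining relations refer to the linear order of 1, ..., n, whereas
  \<open>r_0\<close> moves vertex 1, one of whose neighbours is n + 1. Rotation invariance makes
  this vertex like any other, so one argument serves all the maps. It also leaves a choice of form:
  the pentagon relation is quadratic in the chords at its third vertex but linear in those at each
  other vertex, so a pentagon through the moved vertex can be turned until the relation is linear
  there. A quadrilateral offers no such choice: of its two relations one is linear and the other
  quadratic at the moved vertex, and the quadratic one is the main obstacle. The two coefficients of
  the q-commutator differ by 1. Commuting factors therefore give their plain product, and the chord
  from a vertex to itself, with value 1, acts as the identity. This is why polygons with coinciding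
  corners still satisfy the relations. The inverse has its origin in the Askey--Wilson relation with
  \<open>F p s\<close> doubled: it recovers \<open>F v w\<close> from its image by a reversed
  q-commutator.\<close>

subsection \<open>Calculus of q-commutators\<close>

lemma scale_cq_minus_right: "c *\<^sub>q (- x) = - (c *\<^sub>q x)" for x :: "'a::cq_algebra"
proof -
  have "c *\<^sub>q 0 = (0::'a)" using scale_cq_add_right[of c 0 "0::'a"] by simp
  then show ?thesis using scale_cq_add_right[of c x "- x"] by (simp add: eq_neg_iff_add_eq_0 add.commute)
qed

lemma scale_cq_zero_left [simp]: "0 *\<^sub>q x = (0::'a::cq_algebra)"
  using scale_cq_add_left[of 0 0 x] by simp

lemma scale_cq_minus_left: "(- c) *\<^sub>q x = - (c *\<^sub>q x)" for x :: "'a::cq_algebra"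
  using scale_cq_add_left[of c "- c" x] by (simp add: eq_neg_iff_add_eq_0 add.commute)

lemma scale_cq_diff_right: "c *\<^sub>q (x - y) = c *\<^sub>q x - c *\<^sub>q y" for x :: "'a::cq_algebra"
  using scale_cq_add_right[of c x "- y"] by (simp add: scale_cq_minus_right)

lemma scale_cq_diff_left: "(c - d) *\<^sub>q x = c *\<^sub>q x - d *\<^sub>q x" for x :: "'a::cq_algebra"
  using scale_cq_add_left[of c "- d" x] by (simp add: scale_cq_minus_left)

lemma scale_cq_left_commute: "c *\<^sub>q d *\<^sub>q x = d *\<^sub>q c *\<^sub>q x" for x :: "'a::cq_algebra"
  by (simp add: scale_cq_scale_cq mult.commute)

lemma scale_cq_cancel:
  fixes x y :: "'a::cq_algebra"
  assumes "c *\<^sub>q x = c *\<^sub>q y" "c \<noteq> 0" shows "x = y"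
proof -
  have "inverse c *\<^sub>q c *\<^sub>q x = inverse c *\<^sub>q c *\<^sub>q y" using assms by simp
  with assms(2) show ?thesis by (simp add: scale_cq_scale_cq scale_cq_one)
qed

text \<open>The value 1 would make the denominator of the q-commutator vanish; the value -1 would
  make \<open>qb + qa\<close> vanish, the scalar that is cancelled when moved chords are shown to
  commute.\<close>

lemma qq_power2_neq: "qq * qq \<noteq> 1" "qq * qq \<noteq> - 1"
  unfolding qq_def One_fract_def minus_fract
  by (simp_all add: eq_fract one_pCons)

lemma qq_neq_0: "qq \<noteq> 0"
  unfolding qq_def Zero_fract_def by (simp add: eq_fract)

lemma qq_diff_neq_0: "qq - inverse qq \<noteq> 0"
proof
  assume "qq - inverse qq = 0"
  then have "qq = inverse qq" by (rule right_minus_eq[THEN iffD1])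
  then have "qq * qq = qq * inverse qq" by (rule arg_cong)
  with qq_power2_neq(1) show False unfolding right_inverse[OF qq_neq_0] by contradiction
qed

lemma qq_sum_neq_0: "qq + inverse qq \<noteq> 0"
proof
  assume "qq + inverse qq = 0"
  then have "qq = - inverse qq" by (rule eq_neg_iff_add_eq_0[THEN iffD2])
  then have "qq * qq = qq * - inverse qq" by (rule arg_cong)
  with qq_power2_neq(2) show False
    unfolding mult_minus_right right_inverse[OF qq_neq_0] by contradiction
qed

definition qa :: cq where "qa = qq / (qq - inverse qq)"

definition qb :: cq where "qb = inverse qq / (qq - inverse qq)"

text \<open>This difference of 1 turns q-commutators of commuting elements into products without a
  scalar.\<close>

lemma qa_eq: "qa = qb + 1"
proof -
  have "qa - qb = (qq - inverse qq) / (qq - inverse qq)"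
    unfolding qa_def qb_def by (rule diff_divide_distrib[symmetric])
  also have "\<dots> = 1" by (rule divide_self[OF qq_diff_neq_0])
  finally show ?thesis by (simp add: algebra_simps)
qed

lemma qa_plus_qb_neq_0: "qb + qa \<noteq> 0"
proof -
  have "qb + qa = (qq + inverse qq) / (qq - inverse qq)"
    unfolding qa_def qb_def by (simp only: add_divide_distrib add.commute)
  then show ?thesis using qq_diff_neq_0 qq_sum_neq_0 by (simp only: divide_eq_0_iff simp_thms)
qed

lemma qcomm_eq: "qcomm A B = qa *\<^sub>q (A * B) - qb *\<^sub>q (B * A)"
  by (simp add: qcomm_def qa_def qb_def scale_cq_diff_right scale_cq_scale_cq divide_inverse mult.commute)

lemmas qexpand = qcomm_eq scale_cq_add_right scale_cq_diff_right scale_cq_minus_right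
  mult_scale_cq_left mult_scale_cq_right distrib_left distrib_right left_diff_distrib
  right_diff_distrib mult.assoc

definition commutes :: "'a::monoid_mult \<Rightarrow> 'a \<Rightarrow> bool"
  where "commutes x y \<longleftrightarrow> x * y = y * x"

lemma commutes_sym: "commutes x y \<Longrightarrow> commutes y x"
  by (simp add: commutes_def)

lemma commutes_refl [simp]: "commutes x x"
  by (simp add: commutes_def)

lemma commutes_1 [simp]: "commutes x 1" "commutes 1 x"
  by (simp_all add: commutes_def)

lemma commutesD: "commutes x y \<Longrightarrow> x * y = y * x"
  by (simp add: commutes_def)

lemma commutesD2: "commutes x y \<Longrightarrow> x * (y * z) = y * (x * z)"
  by (simp add: commutes_def mult.assoc[symmetric])

lemma commutes_add [simp]: "commutes x y \<Longrightarrow> commutes x z \<Longrightarrow> commutes x (y + z)"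
  for x :: "'a::ring_1"
  by (simp add: commutes_def distrib_left distrib_right left_diff_distrib right_diff_distrib)

lemma commutes_diff [simp]: "commutes x y \<Longrightarrow> commutes x z \<Longrightarrow> commutes x (y - z)"
  for x :: "'a::ring_1"
  by (simp add: commutes_def distrib_left distrib_right left_diff_distrib right_diff_distrib)

lemma commutes_minus [simp]: "commutes x y \<Longrightarrow> commutes x (- y)"
  for x :: "'a::ring_1"
  by (simp add: commutes_def)

lemma commutes_mult [simp]: "commutes x y \<Longrightarrow> commutes x z \<Longrightarrow> commutes x (y * z)"
  unfolding commutes_def by (simp only: mult.assoc[symmetric]) (simp only: mult.assoc)

lemma commutes_scale [simp]: "commutes x y \<Longrightarrow> commutes x (c *\<^sub>q y)"
  by (simp add: commutes_def mult_scale_cq_left mult_scale_cq_right)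

lemma commutes_qcomm [simp]: "commutes x y \<Longrightarrow> commutes x z \<Longrightarrow> commutes x (qcomm y z)"
  unfolding qcomm_eq by (intro commutes_diff commutes_scale commutes_mult)

lemma qcomm_commutes: "commutes A B \<Longrightarrow> qcomm A B = A * B"
proof -
  assume "commutes A B"
  then have "qcomm A B = (qa - qb) *\<^sub>q (A * B)"
    by (simp add: qcomm_eq commutes_def scale_cq_diff_left)
  then show ?thesis by (simp add: qa_eq scale_cq_one)
qed

lemma qcomm_add_left: "qcomm (A + B) D = qcomm A D + qcomm B D"
  by (simp add: qexpand)

lemma qcomm_add_right: "qcomm D (A + B) = qcomm D A + qcomm D B"
  by (simp add: qexpand)

lemma qcomm_diff_left: "qcomm (A - B) D = qcomm A D - qcomm B D"
  by (simp add: qexpand)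

lemma qcomm_diff_right: "qcomm D (A - B) = qcomm D A - qcomm D B"
  by (simp add: qexpand)

lemma qcomm_minus_left: "qcomm (- A) D = - qcomm A D"
  by (simp add: qexpand)

lemma qcomm_minus_right: "qcomm D (- A) = - qcomm D A"
  by (simp add: qexpand)

lemma qcomm_mult_left: "commutes s D \<Longrightarrow> qcomm (s * A) D = s * qcomm A D"
  using commutesD2[OF commutes_sym, of s D] by (simp add: qexpand)

lemma qcomm_mult_right: "commutes s D \<Longrightarrow> qcomm D (s * A) = s * qcomm D A"
  using commutesD2[OF commutes_sym, of s D] by (simp add: qexpand)

lemmas qcomm_linear = qcomm_add_left qcomm_add_right qcomm_diff_left qcomm_diff_right
  qcomm_minus_left qcomm_minus_right

text \<open>q-commuting with \<open>A\<close> from the left and with \<open>D\<close> from the right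
  are combinations of left and right multiplications, and these commute as operators once
  \<open>A\<close> and \<open>D\<close> commute. The two swap lemmas below are the same fact for two
  operators acting from one side.\<close>

lemma qcomm_assoc:
  assumes "commutes A D" shows "qcomm (qcomm A B) D = qcomm A (qcomm B D)"
  using commutesD[OF assms] commutesD2[OF assms]
  by (simp add: qexpand scale_cq_left_commute)

lemma qcomm_right_swap:
  assumes "commutes A B" shows "qcomm (qcomm W A) B = qcomm (qcomm W B) A"
  using commutesD[OF assms] commutesD2[OF assms]
  by (simp add: qexpand scale_cq_left_commute)

lemma qcomm_left_swap:
  assumes "commutes A B" shows "qcomm A (qcomm B W) = qcomm B (qcomm A W)"
  using commutesD[OF assms] commutesD2[OF assms]
  by (simp add: qexpand scale_cq_left_commute)

lemma qcomm_flip: "qcomm (qcomm A B) A = qcomm A (qcomm B A)"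
  by (rule qcomm_assoc) simp

text \<open>A mixed Jacobi identity: an ordinary commutator with \<open>A\<close> is traded for
  q-commutators of \<open>A\<close> with \<open>X\<close> and with \<open>S\<close>, which the
  polygon relations can evaluate.\<close>

lemma qcomm_jacobi:
  "A * qcomm X S - qcomm X S * A
    = (qcomm A X * S - S * qcomm A X) - (X * qcomm S A - qcomm S A * X)"
  by (simp add: qexpand)

text \<open>The mixed products cancel since \<open>A\<close> and \<open>D\<close> commute; what is
  left has the coefficient \<open>qa - qb = 1\<close>.\<close>

lemma qcomm_commutator_sum:
  assumes "commutes A D"
  shows "(A * qcomm D B - qcomm D B * A) + (qcomm A B * D - D * qcomm A B) = A * (B * D) - D * (B * A)"
  using commutesD[OF assms] commutesD2[OF assms]
  by (simp add: qexpand qa_eq scale_cq_add_left scale_cq_one)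

text \<open>Antisymmetrising a triple q-commutator in its outer entries removes the scalar, since
  \<open>qa\<^sup>2 - qb\<^sup>2 = qa + qb\<close>.\<close>

lemma qcomm_triple_antisym:
  assumes "commutes A D"
  shows "qcomm (qcomm A B) D - qcomm (qcomm D B) A = (qb + qa) *\<^sub>q (A * (B * D) - D * (B * A))"
proof -
  have "qcomm (qcomm A B) D - qcomm (qcomm D B) A = (qa * qa - qb * qb) *\<^sub>q (A * (B * D) - D * (B * A))"
    using commutesD[OF assms] commutesD2[OF assms]
    by (simp add: qexpand scale_cq_scale_cq scale_cq_diff_left mult.commute[of qb qa])
  moreover have "qa * qa - qb * qb = qb + qa"
    by (simp add: qa_eq algebra_simps)
  ultimately show ?thesis by simp
qed

lemma qcomm_antisym: "qcomm A B - qcomm B A = (qb + qa) *\<^sub>q (A * B - B * A)"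
  by (simp add: qexpand scale_cq_add_left)

lemma qcomm_commutes_compound:
  "commutes D (qcomm A B) \<Longrightarrow> qcomm (qcomm A B) D = D * qcomm A B"
  "commutes D (qcomm A B) \<Longrightarrow> qcomm D (qcomm A B) = D * qcomm A B"
  by (simp_all add: qcomm_commutes commutes_def)

lemma qcomm_mult_left':
  assumes "commutes s A" "commutes s D" shows "qcomm (A * s) D = s * qcomm A D"
  using qcomm_mult_left[OF assms(2), of A] assms(1) by (simp add: commutes_def)

lemma qcomm_mult_right':
  assumes "commutes s A" "commutes s D" shows "qcomm D (A * s) = s * qcomm D A"
  using qcomm_mult_right[OF assms(2), of A] assms(1) by (simp add: commutes_def)

lemma qcomm_mult_commute: "commutes D (qcomm A B) \<Longrightarrow> qcomm A B * D = D * qcomm A B"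
  by (simp add: commutes_def)

text \<open>For a pentagon a, b, c, d, e the parameters are the sides ab, bc, cd, de, ea and the
  diagonals ac, bd, ce, da, eb; thus \<open>u1\<close> crosses exactly \<open>u2\<close> and
  \<open>u5\<close>. The locale assumes commutation only. Further relations are premises of the
  single lemmas, which can then be applied while some relations are still to be proved.\<close>

locale pentagon =
  fixes s1 s2 s3 s4 s5 u1 u2 u3 u4 u5 :: "'a::cq_algebra"
  assumes side_side: "commutes s1 s2" "commutes s1 s3" "commutes s1 s4" "commutes s1 s5" "commutes s2 s3" "commutes s2 s4" "commutes s2 s5" "commutes s3 s4" "commutes s3 s5" "commutes s4 s5"
    and side_diagonal:
      "commutes s1 u1" "commutes s1 u2" "commutes s1 u3" "commutes s1 u4" "commutes s1 u5"
      "commutes s2 u1" "commutes s2 u2" "commutes s2 u3" "commutes s2 u4" "commutes s2 u5"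
      "commutes s3 u1" "commutes s3 u2" "commutes s3 u3" "commutes s3 u4" "commutes s3 u5"
      "commutes s4 u1" "commutes s4 u2" "commutes s4 u3" "commutes s4 u4" "commutes s4 u5"
      "commutes s5 u1" "commutes s5 u2" "commutes s5 u3" "commutes s5 u4" "commutes s5 u5"
    and diagonals: "commutes u1 u3" "commutes u1 u4" "commutes u2 u4" "commutes u2 u5" "commutes u3 u5"
begin

lemmas pentagon_comm = side_side side_side[THEN commutes_sym] side_diagonal
  side_diagonal[THEN commutes_sym] diagonals diagonals[THEN commutes_sym]

text \<open>Oriented so that sides precede diagonals and smaller indices precede larger ones; with
  \<open>norm\<close>, polynomial identities reduce to comparing sums.\<close>

lemmas sorted_products =
  side_side[THEN commutes_sym, THEN commutesD] side_side[THEN commutes_sym, THEN commutesD2]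
  side_diagonal[THEN commutes_sym, THEN commutesD] side_diagonal[THEN commutes_sym, THEN commutesD2]
  diagonals[THEN commutes_sym, THEN commutesD] diagonals[THEN commutes_sym, THEN commutesD2]

lemmas norm = qcomm_linear qcomm_mult_left qcomm_mult_right qcomm_mult_left' qcomm_mult_right' pentagon_comm
  sorted_products qcomm_commutes qcomm_commutes_compound distrib_left distrib_right left_diff_distrib
  right_diff_distrib mult.assoc

abbreviation quad' :: bool where
  "quad' \<equiv> qcomm u1 (qcomm u2 u1) = u2 + (s1 * s3 + s2 * u4) * u1 - s2 * s3 - s1 * u4"

abbreviation pent :: bool where
  "pent \<equiv> qcomm (qcomm u1 u2) u3
    = - qcomm u4 u5 + s5 * u2 + s2 * qcomm u4 u3 + s3 * qcomm u1 u5 - s2 * (s3 * s5)"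

lemma pent_rotate:
  assumes pent: pent
    and quad1: quad'
    and quad4: "qcomm u4 (qcomm u5 u4) = u5 + (s4 * s1 + s5 * u2) * u4 - s5 * s1 - s4 * u2"
    and quad5: "qcomm u1 (qcomm u5 u1) = u5 + (s5 * s2 + s1 * u3) * u1 - s5 * s1 - s2 * u3"
    and quad3: "qcomm u4 (qcomm u3 u4) = u3 + (s3 * s5 + s4 * u1) * u4 - s3 * s4 - s5 * u1"
  shows "qcomm (qcomm u2 u3) u4
    = - qcomm u5 u1 + s1 * u3 + s3 * qcomm u5 u4 + s4 * qcomm u2 u1 - s3 * (s4 * s1)"
proof -
  \<comment> \<open>As \<open>u1\<close> and \<open>u3\<close> commute, the q-commutator with
    \<open>u3\<close> can be moved inside, where the left side of \<open>pent\<close>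
    appears.\<close>
  have 1: "qcomm (qcomm u1 (qcomm u2 u1)) u3 = - qcomm (qcomm u4 u5) u1 + s5 * qcomm u2 u1
      + s2 * (u1 * qcomm u4 u3) + s3 * qcomm u1 (qcomm u5 u1) - s2 * (s3 * (s5 * u1))"
    unfolding qcomm_flip[symmetric] qcomm_right_swap[OF diagonals(1)] pent
    by (simp add: norm)
  have 2: "qcomm (qcomm (qcomm u4 u5) u1) u4 = qcomm (qcomm u4 (qcomm u5 u4)) u1"
    using qcomm_right_swap[OF diagonals(2)] by (simp add: qcomm_flip)
  \<comment> \<open>The relation \<open>quad1\<close> is solved for its isolated
    \<open>u2\<close>.\<close>
  have 3: "qcomm (qcomm u2 u3) u4 = qcomm (qcomm (qcomm u1 (qcomm u2 u1) - s1 * (s3 * u1) - s2 * (u4 * u1) + s2 * s3 + s1 * u4) u3) u4"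
    using quad1 by (simp add: norm)
  show ?thesis
    unfolding 3
    by (simp add: norm 1 2 quad3 quad4 quad5 qcomm_flip)
qed

text \<open>In the pentagon v, s, x, y, p these are the images of the chords vx and vy. The Jacobi
  identity reduces their commutator to the q-commutators of the first image with \<open>u5\<close>
  and \<open>u4\<close>; the cubic terms that remain are known from a pentagon relation and its
  mirror image.\<close>

lemma images_commute:
  assumes quad: "qcomm u5 (qcomm u1 u5) = u1 + (s5 * s2 + s1 * u3) * u5 - s1 * s2 - s5 * u3"
    and pent4: "qcomm (qcomm u4 u5) u1
      = - qcomm u2 u3 + s3 * u5 + s5 * qcomm u2 u1 + s1 * qcomm u4 u3 - s5 * (s1 * s3)"
    and pent5: "qcomm (qcomm u5 u1) u2
      = - qcomm u3 u4 + s4 * u1 + s1 * qcomm u3 u2 + s2 * qcomm u5 u4 - s1 * (s2 * s4)"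
    and pent5': "qcomm (qcomm u2 u1) u5
      = - qcomm u4 u3 + s4 * u1 + s1 * qcomm u2 u3 + s2 * qcomm u4 u5 - s1 * (s2 * s4)"
  shows "commutes (- qcomm u5 u1 + s5 * s2 + s1 * u3) (- qcomm u5 u4 + s5 * u2 + s1 * s4)"
proof -
  define P where "P = - qcomm u5 u1 + s5 * s2 + s1 * u3"
  have side: "commutes s1 P" "commutes s4 P" "commutes s5 P"
    unfolding P_def by (simp_all add: pentagon_comm)
  have P5: "qcomm P u5 = - u1 + s1 * s2 + s5 * u3"
    unfolding P_def by (simp add: norm quad qcomm_flip)
  have P4: "qcomm u4 P = qcomm u2 u3 - s3 * u5 - s5 * qcomm u2 u1 + s5 * (s1 * s3) + s5 * (s2 * u4)"
    using pent4 qcomm_assoc[OF diagonals(2)[THEN commutes_sym], of u5]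
    unfolding P_def by (simp add: norm)
  \<comment> \<open>In the difference of \<open>pent5\<close> and its mirror image
    \<open>pent5'\<close> the symmetric terms drop out, and both sides acquire the same
    scalar.\<close>
  have "(qb + qa) *\<^sub>q (u5 * (u1 * u2) - u2 * (u1 * u5))
      = (qb + qa) *\<^sub>q (- (u3 * u4 - u4 * u3) + s1 * (u3 * u2 - u2 * u3) + s2 * (u5 * u4 - u4 * u5))"
  proof -
    have "(qb + qa) *\<^sub>q (u5 * (u1 * u2) - u2 * (u1 * u5)) = qcomm (qcomm u5 u1) u2 - qcomm (qcomm u2 u1) u5"
      using qcomm_triple_antisym[OF diagonals(4)[THEN commutes_sym], of u1] by simp
    also have "\<dots> = - (qcomm u3 u4 - qcomm u4 u3) + s1 * (qcomm u3 u2 - qcomm u2 u3) + s2 * (qcomm u5 u4 - qcomm u4 u5)"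
      unfolding pent5 pent5' by (simp add: algebra_simps)
    also have "\<dots> = (qb + qa) *\<^sub>q (- (u3 * u4 - u4 * u3) + s1 * (u3 * u2 - u2 * u3) + s2 * (u5 * u4 - u4 * u5))"
      unfolding qcomm_antisym by (simp only: mult_scale_cq_right scale_cq_add_right scale_cq_minus_right)
    finally show ?thesis .
  qed
  from scale_cq_cancel[OF this qa_plus_qb_neq_0]
  have antisym: "u5 * (u1 * u2) - u2 * (u1 * u5)
    = - (u3 * u4 - u4 * u3) + s1 * (u3 * u2 - u2 * u3) + s2 * (u5 * u4 - u4 * u5)" .
  have sum: "(u5 * qcomm u2 u1 - qcomm u2 u1 * u5) + (qcomm u5 u1 * u2 - u2 * qcomm u5 u1)
      = u5 * (u1 * u2) - u2 * (u1 * u5)"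
    by (rule qcomm_commutator_sum) (rule diagonals(4)[THEN commutes_sym])
  have 23: "u5 * qcomm u2 u3 = qcomm u2 u3 * u5"
    by (rule commutesD) (simp add: pentagon_comm)
  have "P * qcomm u5 u4 - qcomm u5 u4 * P
      = (qcomm P u5 * u4 - u4 * qcomm P u5) - (u5 * qcomm u4 P - qcomm u4 P * u5)"
    by (rule qcomm_jacobi)
  also have "\<dots> = s5 * (u3 * u4 - u4 * u3) + s5 * (u5 * qcomm u2 u1 - qcomm u2 u1 * u5)
      - s5 * (s2 * (u5 * u4 - u4 * u5))"
    unfolding P4 P5 by (simp add: norm 23)
  also have "u5 * qcomm u2 u1 - qcomm u2 u1 * u5
      = u5 * (u1 * u2) - u2 * (u1 * u5) - (qcomm u5 u1 * u2 - u2 * qcomm u5 u1)"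
    using sum by (simp add: algebra_simps)
  also have "qcomm u5 u1 * u2 - u2 * qcomm u5 u1 = - (P * u2 - u2 * P) + s1 * (u3 * u2 - u2 * u3)"
    unfolding P_def by (simp add: norm)
  \<comment> \<open>The defect is the commutator of \<open>P\<close> with \<open>s5 * u2\<close>,
    which is the correction term in the second image.\<close>
  finally have "P * qcomm u5 u4 - qcomm u5 u4 * P = s5 * (P * u2 - u2 * P)"
    unfolding antisym by (simp add: algebra_simps)
  then have "P * (- qcomm u5 u4 + s5 * u2 + s1 * s4) = (- qcomm u5 u4 + s5 * u2 + s1 * s4) * P"
    using side[THEN commutes_sym, THEN commutesD] side[THEN commutes_sym, THEN commutesD2]
    by (simp add: algebra_simps)
  then show ?thesis unfolding commutes_def P_def .
qed

text \<open>In the pentagon v, s, a, b, p, with \<open>P\<close> and \<open>R\<close> the images of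
  va and vb, this yields the Askey--Wilson relation of the images on a, b, p, v. The left entry,
  built from images, collapses to an expression in the original chords on v, s, a, b, so that only
  its q-commutator with \<open>R\<close> has to be computed.\<close>

lemma quad_image:
  assumes quad23: "qcomm u2 (qcomm u3 u2) = u3 + (s2 * s4 + s3 * u5) * u2 - s3 * s4 - s2 * u5"
    and quad54: "qcomm u4 (qcomm u5 u4) = u5 + (s4 * s1 + s5 * u2) * u4 - s5 * s1 - s4 * u2"
    and pent2: "qcomm (qcomm u2 u3) u4
      = - qcomm u5 u1 + s1 * u3 + s3 * qcomm u5 u4 + s4 * qcomm u2 u1 - s3 * (s4 * s1)"
    and pent3: "qcomm (qcomm u5 u4) u3
      = - qcomm u2 u1 + s2 * u4 + s4 * qcomm u5 u1 + s5 * qcomm u2 u3 - s4 * (s5 * s2)"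
    and pent4: "qcomm (qcomm u1 u5) u4
      = - qcomm u3 u2 + s3 * u5 + s5 * qcomm u1 u2 + s1 * qcomm u3 u4 - s5 * (s1 * s3)"
    and P_def: "P = - qcomm u5 u1 + s5 * s2 + s1 * u3"
    and R_def: "R = - qcomm u5 u4 + s5 * u2 + s1 * s4"
  shows "qcomm (qcomm R u3 - P * s4 - s3 * s1) R = u3 - s3 * s4 - s1 * P"
proof -
  have z: "qcomm R u3 - P * s4 - s3 * s1 = qcomm u2 u1 - s2 * u4 - s1 * s3"
    unfolding R_def P_def by (simp add: norm pent3 qcomm_mult_commute[of s4])
  have side: "commutes s1 R" "commutes s2 R" "commutes s3 R"
    unfolding R_def by (simp_all add: pentagon_comm)
  have R1: "qcomm u1 R = qcomm u3 u2 - s3 * u5 - s1 * qcomm u3 u4 + s5 * (s1 * s3) + s1 * (s4 * u1)"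
    using pent4 qcomm_assoc[OF diagonals(2), of u5] unfolding R_def by (simp add: norm)
  have R4: "qcomm u4 R = - u5 + s5 * s1 + s4 * u2"
    unfolding R_def by (simp add: norm quad54)
  have R2: "commutes u2 R"
    unfolding R_def by (simp add: pentagon_comm)
  \<comment> \<open>Since \<open>u2\<close> commutes with \<open>R\<close>, the q-commutator with
    \<open>R\<close> reaches \<open>u1\<close>, where \<open>R1\<close> evaluates it.\<close>
  have "qcomm (qcomm u2 u1) R = qcomm u2 (qcomm u1 R)"
    by (rule qcomm_assoc) (rule R2)
  also have "\<dots> = u3 - s3 * s4 + s2 * (s4 * u2) - s2 * u5 - s1 * P + s1 * (s2 * s5) + s1 * (s3 * R)"
    using pent2 qcomm_assoc[OF diagonals(3), of u3]
    unfolding R1 unfolding P_def R_def by (simp add: norm quad23)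
  finally show ?thesis
    unfolding z by (simp add: qcomm_linear qcomm_mult_left side R4 distrib_left right_diff_distrib
        pentagon_comm mult.assoc sorted_products qcomm_commutes)
qed

text \<open>All quadrilaterals in the premises have e as a corner, the one in the conclusion does
  not. In this way relations known for quadrilaterals through the neighbour \<open>p\<close> spread
  to the others at the moved vertex. Both pentagon premises are linear in the chords at a.\<close>

lemma quad_transfer:
  assumes pent1: pent
    and pent2: "qcomm (qcomm u2 u3) u4
      = - qcomm u5 u1 + s1 * u3 + s3 * qcomm u5 u4 + s4 * qcomm u2 u1 - s3 * (s4 * s1)"
    and quad23: "qcomm u3 (qcomm u2 u3) = u2 + (s2 * s4 + s3 * u5) * u3 - s2 * s3 - s4 * u5"
    and quad43: "qcomm u3 (qcomm u4 u3) = u4 + (s3 * s5 + s4 * u1) * u3 - s4 * s5 - s3 * u1"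
    and quad34: "qcomm u4 (qcomm u3 u4) = u3 + (s3 * s5 + s4 * u1) * u4 - s3 * s4 - s5 * u1"
    and quad54: "qcomm u4 (qcomm u5 u4) = u5 + (s4 * s1 + s5 * u2) * u4 - s5 * s1 - s4 * u2"
    and quad51: "qcomm u1 (qcomm u5 u1) = u5 + (s5 * s2 + s1 * u3) * u1 - s5 * s1 - s2 * u3"
  shows quad'
proof -
  \<comment> \<open>One nested q-commutator, evaluated by \<open>quad23\<close> on the left and by
    \<open>pent1\<close> on the right; comparison yields a new expression for
    \<open>qcomm u1 u2\<close>.\<close>
  have "qcomm u1 (qcomm u3 (qcomm u2 u3)) = qcomm u3 (qcomm (qcomm u1 u2) u3)"
    using qcomm_left_swap[OF diagonals(1)] qcomm_assoc[OF diagonals(1)] by simp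
  then have 12: "qcomm u1 u2
      = - qcomm u3 (qcomm u4 u5) + s5 * qcomm u3 u2 + s2 * u4 - s2 * (s4 * s5) + s4 * qcomm u1 u5"
    unfolding quad23 pent1 by (simp add: norm quad43 algebra_simps)
  \<comment> \<open>The same device with \<open>pent2\<close> and \<open>quad34\<close>, now giving
    \<open>qcomm u4 (qcomm u5 u1)\<close>.\<close>
  have "qcomm u4 (qcomm (qcomm u2 u3) u4) = qcomm u2 (qcomm u4 (qcomm u3 u4))"
    using qcomm_left_swap[OF diagonals(3)] qcomm_assoc[OF diagonals(3)] by simp
  then have 451: "qcomm u4 (qcomm u5 u1)
      = - qcomm u2 u3 + s5 * qcomm u2 u1 + s1 * qcomm u4 u3 + s3 * u5 - s1 * (s3 * s5)"
    unfolding quad34 pent2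
    by (simp add: norm quad54 algebra_simps)
  have 1: "qcomm (qcomm u3 (qcomm u4 u5)) u1 = qcomm u3 (qcomm u4 (qcomm u5 u1))"
    by (simp add: qcomm_assoc pentagon_comm)
  have 2: "qcomm (qcomm u3 u2) u1 = qcomm u3 (qcomm u2 u1)"
    by (simp add: qcomm_assoc pentagon_comm)
  have "qcomm (qcomm u1 u2) u1 = u2 + (s1 * s3 + s2 * u4) * u1 - s2 * s3 - s1 * u4"
    unfolding 12 by (simp add: norm 1 2 451 quad23 quad43 quad51 qcomm_flip)
  then show ?thesis by (simp add: qcomm_flip)
qed

end

subsection \<open>Families of elements indexed by the chords of a polygon\<close>

definition cyc3 :: "nat \<Rightarrow> nat \<Rightarrow> nat \<Rightarrow> bool" where
  "cyc3 a b c \<longleftrightarrow> a < b \<and> b < c \<or> b < c \<and> c < a \<or> c < a \<and> a < b"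

definition cyc4 :: "nat \<Rightarrow> nat \<Rightarrow> nat \<Rightarrow> nat \<Rightarrow> bool" where
  "cyc4 a b c d \<longleftrightarrow> cyc3 a b c \<and> cyc3 a c d"

definition cyc5 :: "nat \<Rightarrow> nat \<Rightarrow> nat \<Rightarrow> nat \<Rightarrow> nat \<Rightarrow> bool" where
  "cyc5 a b c d e \<longleftrightarrow> cyc3 a b c \<and> cyc3 a c d \<and> cyc3 a d e"

text \<open>Cyclic order up to reversal; equivalently, the chords ac and bd cross, the only case in
  which chords need not commute.\<close>

definition dih4 :: "nat \<Rightarrow> nat \<Rightarrow> nat \<Rightarrow> nat \<Rightarrow> bool" where
  "dih4 a b c d \<longleftrightarrow> cyc4 a b c d \<or> cyc4 d c b a"

definition dih5 :: "nat \<Rightarrow> nat \<Rightarrow> nat \<Rightarrow> nat \<Rightarrow> nat \<Rightarrow> bool" where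
  "dih5 a b c d e \<longleftrightarrow> cyc5 a b c d e \<or> cyc5 e d c b a"

lemmas order_defs = dih4_def dih5_def cyc4_def cyc5_def cyc3_def

lemma dih4_distinct: "dih4 a b c d \<Longrightarrow> distinct [a, b, c, d]"
  unfolding order_defs by auto

lemma dih5_distinct: "dih5 a b c d e \<Longrightarrow> distinct [a, b, c, d, e]"
  unfolding order_defs by auto

lemma not_dih4_eq [simp]:
  "\<not> dih4 a a c d" "\<not> dih4 a b a d" "\<not> dih4 a b c a" "\<not> dih4 a b b d" "\<not> dih4 a b c b" "\<not> dih4 a b c c"
  using dih4_distinct by fastforce+

lemma dih4_rotate: "dih4 a b c d \<Longrightarrow> dih4 b c d a"
  unfolding order_defs by (elim disjE conjE; simp)

lemma dih4_reflect: "dih4 a b c d \<Longrightarrow> dih4 a d c b"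
  unfolding order_defs by (elim disjE conjE; simp)

lemma dih4_not: "dih4 a b c d \<Longrightarrow> \<not> dih4 a c b d" "dih4 a b c d \<Longrightarrow> \<not> dih4 a b d c"
  unfolding order_defs by (elim disjE conjE; simp)+

lemma dih5_rotate: "dih5 a b c d e \<Longrightarrow> dih5 b c d e a"
  unfolding order_defs by (elim disjE conjE; simp)

lemma dih5_reverse: "dih5 a b c d e \<Longrightarrow> dih5 e d c b a"
  unfolding dih5_def by blast

lemma dih5_dih4:
  assumes "dih5 a b c d e"
  shows "dih4 a b c d" "dih4 b c d e" "dih4 c d e a" "dih4 d e a b" "dih4 e a b c"
proof -
  have *: "dih4 a b c d" if "dih5 a b c d e" for a b c d e
    using that unfolding order_defs by (elim disjE conjE; simp)
  note rot = assms assms[THEN dih5_rotate] assms[THEN dih5_rotate, THEN dih5_rotate]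
    assms[THEN dih5_rotate, THEN dih5_rotate, THEN dih5_rotate]
    assms[THEN dih5_rotate, THEN dih5_rotate, THEN dih5_rotate, THEN dih5_rotate]
  show "dih4 a b c d" "dih4 b c d e" "dih4 c d e a" "dih4 d e a b" "dih4 e a b c"
    using rot[THEN *] .
qed

lemma dih4_cases:
  "dih4 a b c d \<Longrightarrow>
    a < b \<and> b < c \<and> c < d \<or> b < c \<and> c < d \<and> d < a \<or> c < d \<and> d < a \<and> a < b \<or> d < a \<and> a < b \<and> b < c \<or>
    d < c \<and> c < b \<and> b < a \<or> c < b \<and> b < a \<and> a < d \<or> b < a \<and> a < d \<and> d < c \<or> a < d \<and> d < c \<and> c < b"
  unfolding order_defs by (elim disjE conjE; simp)

lemma dih5_cases:
  "dih5 a b c d e \<Longrightarrow>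
    a < b \<and> b < c \<and> c < d \<and> d < e \<or> b < c \<and> c < d \<and> d < e \<and> e < a \<or> c < d \<and> d < e \<and> e < a \<and> a < b \<or>
    d < e \<and> e < a \<and> a < b \<and> b < c \<or> e < a \<and> a < b \<and> b < c \<and> c < d \<or>
    e < d \<and> d < c \<and> c < b \<and> b < a \<or> d < c \<and> c < b \<and> b < a \<and> a < e \<or> c < b \<and> b < a \<and> a < e \<and> e < d \<or>
    b < a \<and> a < e \<and> e < d \<and> d < c \<or> a < e \<and> e < d \<and> d < c \<and> c < b"
  unfolding order_defs by (elim disjE conjE; simp)

text \<open>Up to commuting products, \<open>quad_at\<close> and \<open>pent_at\<close> are the relations (ii) and (iii) with
  the elements of the form \<open>pairC\<close> expanded.\<close>

definition quad_at :: "(nat \<Rightarrow> nat \<Rightarrow> 'a::cq_algebra) \<Rightarrow> nat \<Rightarrow> nat \<Rightarrow> nat \<Rightarrow> nat \<Rightarrow> bool" where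
  "quad_at F a b c d \<longleftrightarrow> qcomm (F b d) (qcomm (F a c) (F b d))
     = F a c + (F a b * F c d + F b c * F d a) * F b d - F a b * F b c - F c d * F d a"

definition pent_at :: "(nat \<Rightarrow> nat \<Rightarrow> 'a::cq_algebra) \<Rightarrow> nat \<Rightarrow> nat \<Rightarrow> nat \<Rightarrow> nat \<Rightarrow> nat \<Rightarrow> bool" where
  "pent_at F a b c d e \<longleftrightarrow> qcomm (qcomm (F a c) (F b d)) (F c e)
     = - qcomm (F d a) (F e b) + F e a * F b d + F b c * qcomm (F d a) (F c e)
       + F c d * qcomm (F a c) (F e b) - F b c * (F c d * F e a)"

text \<open>The chord from a vertex to itself stands for the empty index set, whence the value 1.
  Chords with a common end fall under \<open>comm\<close>, since \<open>dih4\<close> forces distinct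
  arguments.\<close>

locale commuting_chords =
  fixes V :: "nat set" and F :: "nat \<Rightarrow> nat \<Rightarrow> 'a::cq_algebra"
  assumes sym: "F x y = F y x"
    and diag [simp]: "F x x = 1"
    and comm: "{x, y, z, w} \<subseteq> V \<Longrightarrow> \<not> dih4 x z y w \<Longrightarrow> commutes (F x y) (F z w)"
begin

lemma commute_disjoint:
  assumes "{a, b, c, d} \<subseteq> V" "dih4 a b c d"
  shows "F c d * F a b = F a b * F c d" "F d a * F b c = F b c * F d a"
proof -
  have "\<not> dih4 c a d b" "\<not> dih4 d b a c"
    using dih4_not(1)[OF dih4_rotate[OF dih4_rotate[OF assms(2)]]]
      dih4_not(1)[OF dih4_rotate[OF dih4_rotate[OF dih4_rotate[OF assms(2)]]]] by blast+
  then show "F c d * F a b = F a b * F c d" "F d a * F b c = F b c * F d a"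
    using assms(1) by (auto intro!: commutesD comm)
qed

lemma commute_adjacent:
  assumes "{a, b, c} \<subseteq> V" shows "F a b * F b c = F b c * F a b"
  using assms by (auto intro!: commutesD comm)

lemma quad_at_rotate2:
  assumes "{a, b, c, d} \<subseteq> V" "dih4 a b c d" "quad_at F a b c d" shows "quad_at F c d a b"
  using assms(3) unfolding quad_at_def sym[of d b] sym[of c a] commute_disjoint[OF assms(1,2)]
  by (simp add: algebra_simps)

lemma quad_at_reflect:
  assumes "{a, b, c, d} \<subseteq> V" "dih4 a b c d" "quad_at F a b c d" shows "quad_at F a d c b"
proof -
  have "F a d * F c b = F b c * F d a" "F d c * F b a = F a b * F c d"
    "F a d * F d c = F c d * F d a" "F c b * F b a = F a b * F b c"
    using commute_disjoint[OF assms(1,2)] commute_adjacent[of a b c] commute_adjacent[of c d a] assms(1)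
    by (simp_all add: sym[of a d] sym[of c b] sym[of d c] sym[of b a])
  with assms(3) show ?thesis
    unfolding quad_at_def sym[of d b] by (simp add: algebra_simps)
qed

text \<open>These symmetries preserve the doubled diagonal bd; the remaining symmetries of the
  quadrilateral interchange its two relations.\<close>

lemma quad_at_dihedral:
  assumes "{a, b, c, d} \<subseteq> V" "dih4 a b c d" "quad_at F a b c d"
  shows "quad_at F c d a b" "quad_at F a d c b" "quad_at F c b a d"
proof -
  show *: "quad_at F c d a b" using assms by (rule quad_at_rotate2)
  show "quad_at F a d c b" using assms by (rule quad_at_reflect)
  show "quad_at F c b a d"
    using quad_at_reflect[OF _ dih4_rotate[OF dih4_rotate[OF assms(2)]] *] assms(1) by auto
qed

lemma pentagon:
  assumes "dih5 a b c d e" "{a, b, c, d, e} \<subseteq> V"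
  shows "pentagon (F a b) (F b c) (F c d) (F d e) (F e a) (F a c) (F b d) (F c e) (F d a) (F e b)"
proof -
  have V: "a \<in> V" "b \<in> V" "c \<in> V" "d \<in> V" "e \<in> V"
    using assms(2) by simp_all
  note 4 = dih5_dih4[OF assms(1)]
  note 8 = 4 4[THEN dih4_rotate] 4[THEN dih4_rotate, THEN dih4_rotate]
    4[THEN dih4_rotate, THEN dih4_rotate, THEN dih4_rotate]
  note 16 = 8 8[THEN dih4_reflect]
  note non = 16[THEN dih4_not(1)] 16[THEN dih4_not(2)]
  show ?thesis
    by unfold_locales (rule comm; simp add: V non)+
qed

lemma quad_at_if_dihedral:
  assumes "{a, b, c, d} \<subseteq> V" "dih4 a b c d"
    and "quad_at F a b c d \<or> quad_at F c d a b \<or> quad_at F a d c b \<or> quad_at F c b a d"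
  shows "quad_at F a b c d"
proof -
  have V: "{c, d, a, b} \<subseteq> V" "{a, d, c, b} \<subseteq> V" "{c, b, a, d} \<subseteq> V" using assms(1) by auto
  have 1: "dih4 c d a b" by (rule dih4_rotate[OF dih4_rotate[OF assms(2)]])
  have 2: "dih4 a d c b" using assms(2) by (rule dih4_reflect)
  have 3: "dih4 c b a d" using 1 by (rule dih4_reflect)
  show ?thesis
    using assms(3) quad_at_dihedral(1)[OF V(1) 1] quad_at_dihedral(2)[OF V(2) 2]
      quad_at_dihedral(3)[OF V(3) 3] by blast
qed

end

locale quadrilateral_chords = commuting_chords +
  assumes quad: "{a, b, c, d} \<subseteq> V \<Longrightarrow> dih4 a b c d \<Longrightarrow> quad_at F a b c d"
begin

lemma quads:
  assumes "{a, b, c, d} \<subseteq> V" "dih4 a b c d"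
  shows "qcomm (F b d) (qcomm (F a c) (F b d))
      = F a c + (F a b * F c d + F b c * F d a) * F b d - F a b * F b c - F c d * F d a"
    and "qcomm (F a c) (qcomm (F b d) (F a c))
      = F b d + (F a b * F c d + F b c * F d a) * F a c - F b c * F c d - F a b * F d a"
proof -
  show "qcomm (F b d) (qcomm (F a c) (F b d))
      = F a c + (F a b * F c d + F b c * F d a) * F b d - F a b * F b c - F c d * F d a"
    using quad[OF assms] unfolding quad_at_def .
  have "quad_at F b c d a"
    using assms(1) by (intro quad dih4_rotate[OF assms(2)]) auto
  then show "qcomm (F a c) (qcomm (F b d) (F a c))
      = F b d + (F a b * F c d + F b c * F d a) * F a c - F b c * F c d - F a b * F d a"
    unfolding quad_at_def sym[of c a] commute_disjoint[OF assms]
    using commute_adjacent[of d a b] assms(1) by (simp add: add.commute)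
qed

lemma pent_at_rotate:
  assumes "dih5 a b c d e" "{a, b, c, d, e} \<subseteq> V" "pent_at F a b c d e"
  shows "pent_at F b c d e a"
proof -
  note 4 = dih5_dih4[OF assms(1)]
  have V: "{a, b, c, d} \<subseteq> V" "{d, e, a, b} \<subseteq> V" "{e, a, b, c} \<subseteq> V" "{c, d, e, a} \<subseteq> V"
    using assms(2) by simp_all
  show ?thesis
    using pentagon.pent_rotate[OF pentagon[OF assms(1,2)] assms(3)[unfolded pent_at_def]
          quads(2)[OF V(1) 4(1)] quads(2)[OF V(2) 4(4)] quads(1)[OF V(3) 4(5)] quads(1)[OF V(4) 4(3)]]
    unfolding pent_at_def .
qed

lemma pent_at_rotations:
  assumes "dih5 a b c d e" "{a, b, c, d, e} \<subseteq> V"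
    and "pent_at F a b c d e \<or> pent_at F b c d e a \<or> pent_at F c d e a b
      \<or> pent_at F d e a b c \<or> pent_at F e a b c d"
  shows "pent_at F a b c d e"
proof -
  note 1 = assms(1) and 2 = assms(1)[THEN dih5_rotate]
  note 3 = 2[THEN dih5_rotate] note 4 = 3[THEN dih5_rotate] note 5 = 4[THEN dih5_rotate]
  have V: "{b, c, d, e, a} \<subseteq> V" "{c, d, e, a, b} \<subseteq> V" "{d, e, a, b, c} \<subseteq> V" "{e, a, b, c, d} \<subseteq> V"
    using assms(2) by auto
  show ?thesis
    using assms(3) pent_at_rotate[OF 2 V(1)] pent_at_rotate[OF 3 V(2)]
      pent_at_rotate[OF 4 V(3)] pent_at_rotate[OF 5 V(4)] by blast
qed

end

locale chord_family = quadrilateral_chords +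
  assumes pent: "{a, b, c, d, e} \<subseteq> V \<Longrightarrow> dih5 a b c d e \<Longrightarrow> pent_at F a b c d e"

text \<open>Up to symmetry, a quadrilateral is increasing with one of its two diagonals doubled, and
  a pentagon is a rotation of an increasing or a decreasing one.\<close>

lemma (in commuting_chords) chord_familyI:
  assumes quad1: "\<And>a b c d. {a, b, c, d} \<subseteq> V \<Longrightarrow> a < b \<Longrightarrow> b < c \<Longrightarrow> c < d \<Longrightarrow> quad_at F a b c d"
    and quad2: "\<And>a b c d. {a, b, c, d} \<subseteq> V \<Longrightarrow> a < b \<Longrightarrow> b < c \<Longrightarrow> c < d \<Longrightarrow> quad_at F b c d a"
    and pent1: "\<And>a b c d e. {a, b, c, d, e} \<subseteq> V \<Longrightarrow> a < b \<Longrightarrow> b < c \<Longrightarrow> c < d \<Longrightarrow> d < e \<Longrightarrow> pent_at F a b c d e"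
    and pent2: "\<And>a b c d e. {a, b, c, d, e} \<subseteq> V \<Longrightarrow> a < b \<Longrightarrow> b < c \<Longrightarrow> c < d \<Longrightarrow> d < e \<Longrightarrow> pent_at F e d c b a"
  shows "chord_family V F"
proof -
  have quad: "quad_at F a b c d" if V: "{a, b, c, d} \<subseteq> V" and d: "dih4 a b c d" for a b c d
    by (rule quad_at_if_dihedral[OF V d], insert V dih4_cases[OF d], elim disjE conjE)
      (simp_all add: quad1 quad2)
  \<comment> \<open>Pentagon relations can be rotated only after the quadrilateral relations are in
    place.\<close>
  interpret quadrilateral_chords V F by unfold_locales (rule quad)
  have pent1': "pent_at F a b c d e" and pent2': "pent_at F e d c b a"
    if "a \<in> V" "b \<in> V" "c \<in> V" "d \<in> V" "e \<in> V" "a < b" "b < c" "c < d" "d < e" for a b c d e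
    using that by (simp_all add: pent1 pent2)
  show ?thesis
  proof
    fix a b c d e assume V: "{a, b, c, d, e} \<subseteq> V" and d: "dih5 a b c d e"
    then have mem: "a \<in> V" "b \<in> V" "c \<in> V" "d \<in> V" "e \<in> V" by simp_all
    show "pent_at F a b c d e"
      by (rule pent_at_rotations[OF d V], insert mem dih5_cases[OF d], elim disjE conjE)
        (blast intro: pent1' pent2')+
  qed
qed

subsection \<open>The braid move at a vertex\<close>

text \<open>If \<open>s\<close> is the successor and \<open>p\<close> the predecessor of \<open>v\<close> in the cyclic order, then
  \<open>cyc3 v s b\<close> and \<open>cyc3 p v b\<close> hold for all other vertices \<open>b\<close>.\<close>

lemma successor_not_crossed:
  "cyc3 v s y \<Longrightarrow> cyc3 v s z \<Longrightarrow> \<not> dih4 v y s z"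
  "cyc3 p v y \<Longrightarrow> cyc3 p v z \<Longrightarrow> \<not> dih4 v y p z"
  unfolding order_defs by (elim disjE conjE; simp)+

lemma dih4_iff: "dih4 a b c d \<longleftrightarrow> cyc3 a b c \<and> cyc3 a c d \<or> cyc3 a d c \<and> cyc3 a c b"
proof -
  have "cyc3 d c b \<Longrightarrow> cyc3 d b a \<Longrightarrow> cyc3 a d c \<and> cyc3 a c b"
    unfolding cyc3_def by (elim disjE conjE; simp)
  moreover have "cyc3 a d c \<Longrightarrow> cyc3 a c b \<Longrightarrow> cyc3 d c b \<and> cyc3 d b a"
    unfolding cyc3_def by (elim disjE conjE; simp)
  ultimately show ?thesis unfolding dih4_def cyc4_def by blast
qed

lemma successor_cyc3:
  "cyc3 v s b \<Longrightarrow> cyc3 v s c \<Longrightarrow> cyc3 s b c \<longleftrightarrow> cyc3 v b c"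
  "cyc3 p v b \<Longrightarrow> cyc3 p v c \<Longrightarrow> cyc3 p b c \<longleftrightarrow> cyc3 v b c"
  unfolding cyc3_def by (rule iffI; elim disjE conjE; simp)+

lemma successor_dih4:
  assumes "cyc3 v s b" "cyc3 v s c" "cyc3 v s d" shows "dih4 s b c d \<longleftrightarrow> dih4 v b c d"
  unfolding dih4_iff successor_cyc3(1)[OF assms(1,2)] successor_cyc3(1)[OF assms(2,3)]
    successor_cyc3(1)[OF assms(3,2)] successor_cyc3(1)[OF assms(2,1)] ..

lemma predecessor_dih4:
  assumes "cyc3 p v b" "cyc3 p v c" "cyc3 p v d" shows "dih4 p b c d \<longleftrightarrow> dih4 v b c d"
  unfolding dih4_iff successor_cyc3(2)[OF assms(1,2)] successor_cyc3(2)[OF assms(2,3)]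
    successor_cyc3(2)[OF assms(3,2)] successor_cyc3(2)[OF assms(2,1)] ..

lemma dih5_iff: "dih5 a b c d e \<longleftrightarrow> dih4 a b c d \<and> dih4 a c d e"
proof -
  have "cyc3 e d c \<Longrightarrow> cyc3 e c b \<Longrightarrow> cyc3 e b a \<Longrightarrow> cyc3 a e d \<and> cyc3 a d c \<and> cyc3 a c b"
    unfolding cyc3_def by (elim disjE conjE; simp)
  moreover have "cyc3 a e d \<Longrightarrow> cyc3 a d c \<Longrightarrow> cyc3 a c b \<Longrightarrow> cyc3 e d c \<and> cyc3 e c b \<and> cyc3 e b a"
    unfolding cyc3_def by (elim disjE conjE; simp)
  moreover have "\<not> (cyc3 a c d \<and> cyc3 a d c)"
    unfolding cyc3_def by auto
  ultimately show ?thesis unfolding dih5_def cyc5_def dih4_iff by blast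
qed

lemma neighbours_not_crossed:
  assumes "cyc3 v s y" "cyc3 v s z" "cyc3 p v y" "cyc3 p v z" shows "\<not> dih4 p y s z"
proof -
  have "\<not> cyc3 p y s" if "cyc3 v s y" "cyc3 p v y" for y
    using that unfolding cyc3_def by auto
  then show ?thesis using assms unfolding dih4_iff by blast
qed

lemma cyc3_total: "a \<noteq> b \<Longrightarrow> b \<noteq> c \<Longrightarrow> a \<noteq> c \<Longrightarrow> cyc3 a b c \<or> cyc3 a c b"
  unfolding cyc3_def
  by (cases a b rule: linorder_cases; cases b c rule: linorder_cases; cases a c rule: linorder_cases; simp)

lemma dih4_swap: "dih4 a b c d \<longleftrightarrow> dih4 c b a d" "dih4 a b c d \<longleftrightarrow> dih4 b a d c"
  using dih4_rotate dih4_reflect by blast+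

lemma neighbours_cyc5:
  assumes "cyc3 v s y" "cyc3 p v z" "cyc3 v y z" shows "cyc5 v s y z p"
proof -
  have "cyc3 v z p" using assms(2) unfolding cyc3_def by blast
  then show ?thesis using assms unfolding cyc5_def by blast
qed

text \<open>The braid move replaces \<open>y = F v w\<close> by \<open>- qcomm X y + A * F s w + B * F w p\<close>, where \<open>X\<close>
  commutes with all chords that avoid \<open>v\<close>. Relations linear in \<open>y\<close> are therefore preserved as
  soon as they also hold with \<open>v\<close> replaced by its neighbours.\<close>

lemma qcomm_pull_out:
  assumes "commutes X K"
  shows "qcomm (qcomm X y) K = qcomm X (qcomm y K)" "qcomm K (qcomm X y) = qcomm X (qcomm K y)"
    "qcomm X y * K = qcomm X (y * K)" "K * qcomm X y = qcomm X (K * y)"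
  using qcomm_assoc[OF assms] qcomm_left_swap[OF assms, symmetric]
  by (simp_all add: qexpand commutesD[OF assms] commutesD2[OF assms])

lemma central_pull_out:
  assumes "commutes A K"
  shows "qcomm (A * y) K = A * qcomm y K" "qcomm K (A * y) = A * qcomm K y" "K * (A * y) = A * (K * y)"
  using assms by (simp_all add: qcomm_mult_left qcomm_mult_right commutesD2[OF commutes_sym])

lemma quad_linear:
  fixes X K a b A B :: "'a::cq_algebra"
  assumes X: "commutes X K" "commutes X a" "commutes X b"
    and A: "commutes A K" "commutes A a" "commutes A b"
    and B: "commutes B K" "commutes B a" "commutes B b"
    and v: "qcomm K (qcomm vc K) = vc + (vb * b + a * vd) * K - vb * a - b * vd"
    and p: "qcomm K (qcomm pc K) = pc + (pb * b + a * pd) * K - pb * a - b * pd"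
    and s: "qcomm K (qcomm sc K) = sc + (sb * b + a * sd) * K - sb * a - b * sd"
    and h: "kb = - qcomm X vb + A * sb + B * pb" "kc = - qcomm X vc + A * sc + B * pc"
      "kd = - qcomm X vd + A * sd + B * pd"
  shows "qcomm K (qcomm kc K) = kc + (kb * b + a * kd) * K - kb * a - b * kd"
  unfolding h
  by (simp add: qcomm_linear qcomm_pull_out[OF X(1)] qcomm_pull_out[OF X(2)] qcomm_pull_out[OF X(3)]
      central_pull_out[OF A(1)] central_pull_out[OF A(2)] central_pull_out[OF A(3)]
      central_pull_out[OF B(1)] central_pull_out[OF B(2)] central_pull_out[OF B(3)]
      v p s distrib_left distrib_right left_diff_distrib right_diff_distrib mult.assoc)

lemma pent_linear:
  fixes X K L M a b A B :: "'a::cq_algebra"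
  assumes X: "commutes X K" "commutes X L" "commutes X M" "commutes X a" "commutes X b"
    and A: "commutes A K" "commutes A L" "commutes A M" "commutes A a" "commutes A b"
    and B: "commutes B K" "commutes B L" "commutes B M" "commutes B a" "commutes B b"
    and v: "qcomm (qcomm vc K) L = - qcomm vd M + ve * K + a * qcomm vd L + b * qcomm vc M - a * (b * ve)"
    and p: "qcomm (qcomm pc K) L = - qcomm pd M + pe * K + a * qcomm pd L + b * qcomm pc M - a * (b * pe)"
    and s: "qcomm (qcomm sc K) L = - qcomm sd M + se * K + a * qcomm sd L + b * qcomm sc M - a * (b * se)"
    and h: "kc = - qcomm X vc + A * sc + B * pc" "kd = - qcomm X vd + A * sd + B * pd"
      "ke = - qcomm X ve + A * se + B * pe"
  shows "qcomm (qcomm kc K) L = - qcomm kd M + ke * K + a * qcomm kd L + b * qcomm kc M - a * (b * ke)"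
  unfolding h
  by (simp add: qcomm_linear X[THEN qcomm_pull_out(1)] X[THEN qcomm_pull_out(2)] X[THEN qcomm_pull_out(3)] X[THEN qcomm_pull_out(4)]
      A[THEN central_pull_out(1)] A[THEN central_pull_out(2)] A[THEN central_pull_out(3)]
      B[THEN central_pull_out(1)] B[THEN central_pull_out(2)] B[THEN central_pull_out(3)]
      v p s distrib_left distrib_right left_diff_distrib right_diff_distrib mult.assoc)

text \<open>The moved vertex now comes last, so \<open>qcomm K L\<close> consists of fixed chords
  and is treated as one entry. Both positions are needed for \<open>quad_transfer\<close>.\<close>

lemma pent_linear':
  fixes X K L M a b A B :: "'a::cq_algebra"
  assumes X: "commutes X K" "commutes X L" "commutes X M" "commutes X a" "commutes X b" "commutes X (qcomm K L)"
    and A: "commutes A K" "commutes A L" "commutes A M" "commutes A a" "commutes A b" "commutes A (qcomm K L)"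
    and B: "commutes B K" "commutes B L" "commutes B M" "commutes B a" "commutes B b" "commutes B (qcomm K L)"
    and v: "qcomm (qcomm K L) vd = - qcomm M vc + vb * L + a * qcomm M vd + b * qcomm K vc - a * (b * vb)"
    and p: "qcomm (qcomm K L) pd = - qcomm M pc + pb * L + a * qcomm M pd + b * qcomm K pc - a * (b * pb)"
    and s: "qcomm (qcomm K L) sd = - qcomm M sc + sb * L + a * qcomm M sd + b * qcomm K sc - a * (b * sb)"
    and h: "kb = - qcomm X vb + A * sb + B * pb" "kc = - qcomm X vc + A * sc + B * pc"
      "kd = - qcomm X vd + A * sd + B * pd"
  shows "qcomm (qcomm K L) kd = - qcomm M kc + kb * L + a * qcomm M kd + b * qcomm K kc - a * (b * kb)"
  unfolding h
  by (simp add: qcomm_linear X[THEN qcomm_pull_out(1)] X[THEN qcomm_pull_out(2)] X[THEN qcomm_pull_out(3)] X[THEN qcomm_pull_out(4)]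
      A[THEN central_pull_out(1)] A[THEN central_pull_out(2)] A[THEN central_pull_out(3)]
      B[THEN central_pull_out(1)] B[THEN central_pull_out(2)] B[THEN central_pull_out(3)]
      v p s distrib_left distrib_right left_diff_distrib right_diff_distrib mult.assoc)

context chord_family
begin

text \<open>The fifth corner coincides with an adjacent one. Because of \<open>F x x = 1\<close> the
  relation becomes either a commutation identity or the quadrilateral relation of b, c, d,
  e.\<close>

lemma pent_degenerate:
  assumes V: "{b, c, d, e} \<subseteq> V" and dih: "dih4 b c d e" and x: "x = b \<or> x = e"
  shows "pent_at F x b c d e" "pent_at F b c d e x"
proof -
  have "commutes (F b c) (F b d)" "commutes (F b c) (F c e)" "commutes (F b c) (F c d)"
    "commutes (F b c) (F d e)" "commutes (F b c) (F e b)"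
    "commutes (F c d) (F b d)" "commutes (F c d) (F c e)"
    "commutes (F c d) (F d e)" "commutes (F c d) (F e b)"
    "commutes (F d e) (F b d)" "commutes (F d e) (F c e)" "commutes (F d e) (F e b)"
    "commutes (F e b) (F b d)" "commutes (F e b) (F c e)"
    using V dih4_not[OF dih] dih4_not[OF dih4_rotate[OF dih]] by (auto intro!: comm)
  note cs = this this[THEN commutes_sym]
  note simps = cs cs(1-14)[THEN commutes_sym, THEN commutesD] cs(1-14)[THEN commutes_sym, THEN commutesD2]
    qcomm_mult_left qcomm_mult_right qcomm_commutes qcomm_commutes_compound qcomm_flip mult.assoc distrib_right
    sym[of c b] sym[of d b] sym[of b e] sym[of e c] sym[of e d]
  have "pent_at F b b c d e \<and> pent_at F b c d e b"
    unfolding pent_at_def by (simp add: simps quads[OF V dih])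
  moreover have "pent_at F e b c d e \<and> pent_at F b c d e e"
    unfolding pent_at_def by (simp add: simps quads[OF V dih])
  ultimately show "pent_at F x b c d e" "pent_at F b c d e x"
    using x by auto
qed

text \<open>Reflecting the pentagon but keeping its labels reverses the order in each
  q-commutator.\<close>

lemma pent_reversed:
  assumes "dih5 a b c d e" "{a, b, c, d, e} \<subseteq> V"
  shows "qcomm (qcomm (F c e) (F b d)) (F a c)
    = - qcomm (F e b) (F d a) + F e a * F b d + F b c * qcomm (F c e) (F d a)
      + F c d * qcomm (F e b) (F a c) - F b c * (F c d * F e a)"
proof -
  have "pent_at F e d c b a" using assms(2) by (intro pent dih5_reverse[OF assms(1)]) auto
  then have "qcomm (qcomm (F c e) (F b d)) (F a c)
    = - qcomm (F e b) (F d a) + F e a * F b d + F c d * qcomm (F e b) (F a c)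
      + F b c * qcomm (F c e) (F d a) - F c d * (F b c * F e a)"
    unfolding pent_at_def sym[of e c] sym[of d b] sym[of c a] sym[of b e] sym[of a d] sym[of a e]
      sym[of d c] sym[of c b] .
  also have "F c d * (F b c * F e a) = F b c * (F c d * F e a)"
    using commute_adjacent[of b c d] assms(2) by (simp add: mult.assoc[symmetric])
  finally show ?thesis by (simp add: algebra_simps)
qed

lemma quad_degenerate:
  assumes V: "{b, c, d} \<subseteq> V" and x: "x = b \<or> x = d"
  shows "quad_at F x b c d"
proof -
  have "commutes (F b c) (F b d)" "commutes (F b c) (F c d)" "commutes (F c d) (F b d)"
    using V by (auto intro!: comm)
  note cs = this this[THEN commutes_sym]
  show ?thesis
    unfolding quad_at_def using x
    by (auto simp: cs cs(4-6)[THEN commutesD] cs(4-6)[THEN commutesD2]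
      qcomm_mult_left qcomm_mult_right qcomm_commutes mult.assoc distrib_right sym[of c b] sym[of d b] sym[of d c])
qed

end

section \<open>Moved chords and their commutation\<close>

locale vertex_move = chord_family +
  fixes v p s :: nat
  assumes vertices: "v \<in> V" "p \<in> V" "s \<in> V" "p \<noteq> v" "s \<noteq> v"
    and succ: "y \<in> V \<Longrightarrow> y \<noteq> v \<Longrightarrow> y \<noteq> s \<Longrightarrow> cyc3 v s y"
    and pred: "y \<in> V \<Longrightarrow> y \<noteq> v \<Longrightarrow> y \<noteq> p \<Longrightarrow> cyc3 p v y"
begin

text \<open>The chord form of a two-set element, taken for p, v, s, w. The vertices \<open>p\<close>
  and \<open>s\<close> may coincide, as they do for n = 1, where the polygon has two
  vertices.\<close>

definition h :: "nat \<Rightarrow> 'a" where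
  "h w = - qcomm (F p s) (F v w) + F p v * F s w + F v s * F w p"

definition G :: "nat \<Rightarrow> nat \<Rightarrow> 'a" where
  "G x y = (if x = y then 1 else if x = v then h y else if y = v then h x else F x y)"

lemma not_between:
  assumes "y \<in> V" "z \<in> V"
  shows "\<not> dih4 v y s z" "\<not> dih4 v y p z"
proof -
  show "\<not> dih4 v y s z"
    using succ[OF assms(1)] succ[OF assms(2)] dih4_distinct[of v y s z] successor_not_crossed(1) by auto
  show "\<not> dih4 v y p z"
    using pred[OF assms(1)] pred[OF assms(2)] dih4_distinct[of v y p z] successor_not_crossed(2) by auto
qed

lemma vertex_replacement:
  assumes "{b, c, d} \<subseteq> V - {v, x}" "x = p \<or> x = s"
  shows "dih4 x b c d \<longleftrightarrow> dih4 v b c d"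
proof (cases "x = p")
  case True
  then have "cyc3 p v b" "cyc3 p v c" "cyc3 p v d" using assms by (auto intro: pred)
  then show ?thesis
    unfolding True by (rule predecessor_dih4)
next
  case False
  then have x: "x = s" using assms(2) by simp
  then have "cyc3 v s b" "cyc3 v s c" "cyc3 v s d" using assms by (auto intro: succ)
  then show ?thesis
    unfolding x by (rule successor_dih4)
qed

lemma replace_dih4:
  assumes "dih4 v b c d" "{b, c, d} \<subseteq> V" "x = p \<or> x = s"
  shows "x = b \<or> x = d \<or> dih4 x b c d"
proof -
  have "x \<noteq> c" using not_between[of b d] assms by blast
  moreover have "v \<noteq> b" "v \<noteq> c" "v \<noteq> d" using dih4_distinct[OF assms(1)] by auto
  ultimately show ?thesis
    using vertex_replacement[of b c d x] assms by blast
qed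

lemma replace_not_dih4:
  assumes "\<not> dih4 v b c d" "{b, c, d} \<subseteq> V - {v}" "x = p \<or> x = s"
  shows "\<not> dih4 x b c d"
proof
  assume *: "dih4 x b c d"
  then have "x \<noteq> b" "x \<noteq> c" "x \<noteq> d" using dih4_distinct[OF *] by auto
  with * assms vertex_replacement[of b c d x] show False by blast
qed

lemma replace_dih5:
  assumes "dih5 v b c d e" "{b, c, d, e} \<subseteq> V" "x = p \<or> x = s"
  shows "x = b \<or> x = e \<or> dih5 x b c d e"
proof -
  have 1: "dih4 v b c d" "dih4 v c d e" using assms(1) by (simp_all add: dih5_iff)
  have 2: "dih4 v b d e" "dih4 v b c e"
    using dih5_dih4(4,5)[OF assms(1)] dih4_rotate by blast+
  have V: "{b, c, d} \<subseteq> V" "{c, d, e} \<subseteq> V" "{b, d, e} \<subseteq> V" "{b, c, e} \<subseteq> V" using assms(2) by auto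
  have "b \<noteq> c" "b \<noteq> d" "c \<noteq> d" "c \<noteq> e" "d \<noteq> e" using dih5_distinct[OF assms(1)] by auto
  then show ?thesis
    using replace_dih4[OF 1(1) V(1) assms(3)] replace_dih4[OF 1(2) V(2) assms(3)]
      replace_dih4[OF 2(1) V(3) assms(3)] replace_dih4[OF 2(2) V(4) assms(3)]
    unfolding dih5_iff by auto
qed

lemma edge_central:
  assumes "x \<in> V" "y \<in> V"
  shows "commutes (F v s) (F x y)" "commutes (F p v) (F x y)"
  using not_between[OF assms] vertices assms unfolding sym[of p v] by (auto intro!: comm)

text \<open>The chord ps cuts off the single vertex \<open>v\<close>, so every chord crossing it
  ends in \<open>v\<close>.\<close>

lemma inner_commutes:
  assumes "x \<in> V - {v}" "y \<in> V - {v}"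
  shows "commutes (F p s) (F x y)"
proof (rule comm)
  show "\<not> dih4 p x s y"
  proof
    assume *: "dih4 p x s y"
    then have "x \<noteq> p" "y \<noteq> p" "x \<noteq> s" "y \<noteq> s" using dih4_distinct[OF *] by auto
    then show False using * assms neighbours_not_crossed[of v s x y p] succ pred by auto
  qed
qed (use assms vertices in auto)

text \<open>The q-commutator is a plain product here and cancels one summand; the move interchanges
  the two sides at \<open>v\<close>.\<close>

lemma h_neighbour: "h p = F v s" "h s = F p v"
proof -
  have "commutes (F p s) (F v p)" "commutes (F p s) (F v s)"
    using edge_central[of p s, THEN commutes_sym] vertices unfolding sym[of p v] by auto
  then show "h p = F v s" "h s = F p v"
    by (simp_all add: h_def qcomm_commutes commutes_def sym[of s p] sym[of v p])
qed

lemma sym_G: "G x y = G y x"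
  using sym by (simp add: G_def)

lemma G_simps:
  "G x x = 1" "w \<noteq> v \<Longrightarrow> G v w = h w" "w \<noteq> v \<Longrightarrow> G w v = h w"
  "x \<noteq> v \<Longrightarrow> y \<noteq> v \<Longrightarrow> G x y = F x y"
  by (simp_all add: G_def)

lemma edge_central_h:
  assumes "w \<in> V" shows "commutes (F v s) (h w)" "commutes (F p v) (h w)"
  using assms vertices unfolding h_def by (simp_all add: edge_central)

text \<open>A chord zw that avoids \<open>v\<close> and does not cross vy crosses neither py nor sy,
  hence commutes with each summand of \<open>h y\<close>.\<close>

lemma F_commutes_h:
  assumes "z \<in> V - {v}" "y \<in> V - {v}" "w \<in> V - {v}" "\<not> dih4 v z y w"
  shows "commutes (F z w) (h y)"
proof -
  have "commutes (F z w) (F p s)" using inner_commutes[of z w] assms by (blast intro: commutes_sym)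
  moreover have "commutes (F z w) (F v y)"
    using assms vertices by (intro commutes_sym[OF comm]) auto
  moreover have "commutes (F z w) (F p v)" "commutes (F z w) (F v s)"
    using assms edge_central[of z w] by (auto intro: commutes_sym)
  moreover have "commutes (F z w) (F p y)" "commutes (F z w) (F s y)"
    using assms vertices replace_not_dih4[OF assms(4)] by (auto intro!: commutes_sym[OF comm])
  ultimately show ?thesis unfolding h_def sym[of y p] by simp
qed

lemma h_commutes:
  assumes "x \<in> V - {v}" "y \<in> V - {v}"
  shows "commutes (h x) (h y)"
proof -
  have *: "commutes (h x) (h y)" if "cyc5 v s x y p" "x \<in> V" "y \<in> V" for x y
  proof -
    have d: "dih5 v s x y p" using that(1) by (simp add: dih5_def)
    have V: "{v, s, x, y, p} \<subseteq> V" using that vertices by simp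
    note 4 = dih5_dih4[OF d]
    have V': "{p, v, s, x} \<subseteq> V" "{p, v, s, x, y} \<subseteq> V" "{y, p, v, s, x} \<subseteq> V" using V by auto
    have d5: "dih5 p v s x y" using dih5_rotate[OF dih5_rotate[OF dih5_rotate[OF dih5_rotate[OF d]]]] .
    have d4: "dih5 y p v s x" using dih5_rotate[OF dih5_rotate[OF dih5_rotate[OF d]]] .
    show ?thesis
      using pentagon.images_commute[OF pentagon[OF d V] quads(2)[OF V'(1) 4(5)]
          pent[OF V'(3) d4, unfolded pent_at_def] pent[OF V'(2) d5, unfolded pent_at_def]
          pent_reversed[OF d5 V'(2)]]
      unfolding h_def sym[of y v] .
  qed
  \<comment> \<open>The image of a chord to a neighbour is a side, hence central. Otherwise v, s, p
    and the two ends form a pentagon in one of two orders.\<close>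
  show ?thesis
  proof (cases "x = y \<or> x \<in> {p, s} \<or> y \<in> {p, s}")
    case True
    then show ?thesis using assms h_neighbour edge_central_h by (auto intro: commutes_sym)
  next
    case False
    then have c: "cyc3 v s x" "cyc3 v s y" "cyc3 p v x" "cyc3 p v y" using assms succ pred by auto
    have "cyc3 v x y \<or> cyc3 v y x" using False assms by (intro cyc3_total) auto
    then show ?thesis
      using *[of x y] *[of y x] neighbours_cyc5[OF c(1,4)] neighbours_cyc5[OF c(2,3)] assms
      by (auto intro: commutes_sym)
  qed
qed

lemma G_commutes_h:
  assumes "z \<in> V - {v}" "y \<in> V - {v}" "w \<in> V - {v}" "\<not> dih4 v z y w"
  shows "commutes (G z w) (h y)"
  using F_commutes_h[OF assms] assms by (cases "z = w") (auto simp: G_simps)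

sublocale G: commuting_chords V G
proof
  show "G x y = G y x" "G x x = 1" for x y by (simp_all add: sym_G G_simps)
  have one: "commutes (G v y) (G z w)" if V: "{y, z, w} \<subseteq> V" "y \<noteq> v" and n: "\<not> dih4 v z y w" for y z w
  proof (cases "z = v \<or> w = v")
    case True
    then show ?thesis using V h_commutes by (cases "z = w") (auto simp: G_simps)
  next
    case False
    then show ?thesis using G_commutes_h[of z y w] V n by (auto simp: G_simps intro: commutes_sym)
  qed
  fix x y z w assume V: "{x, y, z, w} \<subseteq> V" and n: "\<not> dih4 x z y w"
  consider "x = y" | "z = w" | "x \<noteq> y" "x = v" | "x \<noteq> y" "y = v" | "z \<noteq> w" "z = v" | "z \<noteq> w" "w = v"
    | "x \<noteq> y" "z \<noteq> w" "v \<notin> {x, y, z, w}" by auto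
  then show "commutes (G x y) (G z w)"
  proof cases
    case 3
    then show ?thesis using V n one[of y z w] by simp
  next
    case 4
    then show ?thesis using V n one[of x z w] dih4_swap(1)[of x z y w] sym_G[of x v] by simp
  next
    case 5
    then show ?thesis using V n one[of w x y] dih4_swap(2)[of x z y w] by (auto intro: commutes_sym)
  next
    case 6
    then show ?thesis
      using V n one[of z x y] dih4_swap(2)[of x z y w] dih4_swap(1)[of z x w y] sym_G[of z v]
      by (auto intro: commutes_sym)
  next
    case 7
    then show ?thesis using comm[OF V n] by (simp add: G_simps)
  qed (simp_all add: G_simps)
qed

end

text \<open>For p, v, s, b with \<open>X\<close> = ps and \<open>y\<close> = vb, the image
  \<open>k\<close> of \<open>y\<close> satisfies the relation of \<open>y\<close> with the sides
  \<open>A\<close> and \<open>B\<close> exchanged. Up to sign and products of sides, q-commuting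
  \<open>k\<close> with \<open>X\<close> gives back \<open>y\<close>, and q-commuting
  \<open>y\<close> with \<open>k\<close> gives back \<open>X\<close>.\<close>

lemma quad_exchange:
  fixes X y A B a b :: "'a::cq_algebra"
  assumes A: "commutes A X" "commutes A y" "commutes A B" "commutes A a" "commutes A b"
    and B: "commutes B X" "commutes B y" "commutes B a" "commutes B b"
    and ab: "commutes a X" "commutes a y" "commutes a b" "commutes b X" "commutes b y"
    and X: "qcomm X (qcomm y X) = y + (A * a + B * b) * X - B * a - A * b"
    and y: "qcomm y (qcomm X y) = X + (A * a + B * b) * y - A * B - a * b"
    and k: "k = - qcomm X y + A * a + B * b"
  shows "qcomm k (qcomm X k) = X + (a * B + b * A) * k - a * b - B * A"
proof -
  note cs = A B ab A[THEN commutes_sym] B[THEN commutes_sym] ab[THEN commutes_sym]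
  note ws = A[THEN commutes_sym, THEN commutesD] B[THEN commutes_sym, THEN commutesD] ab[THEN commutes_sym, THEN commutesD]
    A[THEN commutes_sym, THEN commutesD2] B[THEN commutes_sym, THEN commutesD2] ab[THEN commutes_sym, THEN commutesD2]
  have k': "commutes A k" "commutes B k" "commutes a k" "commutes b k"
    unfolding k by (simp_all add: cs)
  have 1: "qcomm k X = - y + B * a + A * b"
    unfolding k by (simp add: qcomm_linear qcomm_flip qcomm_mult_left X cs ws qcomm_commutes
        distrib_right mult.assoc)
  have 2: "qcomm y k = - X + A * B + a * b"
    unfolding k by (simp add: qcomm_linear qcomm_mult_right y cs ws qcomm_commutes
        distrib_right mult.assoc)
  have "qcomm k (qcomm X k) = qcomm (qcomm k X) k"
    by (simp add: qcomm_flip)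
  also have "\<dots> = X + (a * B + b * A) * k - a * b - B * A"
    unfolding 1 by (simp add: qcomm_linear qcomm_mult_left 2 k' ws qcomm_commutes distrib_right mult.assoc)
  finally show ?thesis .
qed

section \<open>Polygon relations for the moved chords\<close>

context vertex_move
begin

lemma pent_replaced:
  assumes "dih5 v b c d e" "{b, c, d, e} \<subseteq> V" "x = p \<or> x = s"
  shows "pent_at F x b c d e" "pent_at F b c d e x"
proof -
  have V: "{x, b, c, d, e} \<subseteq> V" "{b, c, d, e, x} \<subseteq> V" using assms(2,3) vertices by auto
  show "pent_at F x b c d e" "pent_at F b c d e x"
    using replace_dih5[OF assms] pent_degenerate[OF assms(2) dih5_dih4(2)[OF assms(1)]]
      pent[OF V(1)] pent[OF V(2) dih5_rotate] by blast+
qed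

lemma quad_replaced:
  assumes "dih4 v b c d" "{b, c, d} \<subseteq> V" "x = p \<or> x = s"
  shows "quad_at F x b c d"
proof -
  have V: "{x, b, c, d} \<subseteq> V" using assms(2,3) vertices by auto
  show ?thesis
    using replace_dih4[OF assms] quad_degenerate[OF assms(2)] quad[OF V] by blast
qed

lemma quad_G_linear:
  assumes dih: "dih4 v b c d" and V: "{b, c, d} \<subseteq> V"
  shows "quad_at G v b c d"
proof -
  have ne: "b \<noteq> v" "c \<noteq> v" "d \<noteq> v" using dih4_distinct[OF dih] by auto
  have mem: "b \<in> V" "c \<in> V" "d \<in> V" using V by auto
  have V': "{v, b, c, d} \<subseteq> V" using V vertices by auto
  have h': "h d = - qcomm (F p s) (F d v) + F p v * F d s + F v s * F d p" for d
    by (simp add: h_def sym[of d v] sym[of d s])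
  have h'': "h d = - qcomm (F p s) (F v d) + F p v * F s d + F v s * F p d" for d
    by (simp add: h_def sym[of d p])
  show ?thesis
    unfolding quad_at_def G_simps(2)[OF ne(1)] G_simps(2)[OF ne(2)] G_simps(3)[OF ne(3)]
      G_simps(4)[OF ne(1,3)] G_simps(4)[OF ne(1,2)] G_simps(4)[OF ne(2,3)]
    by (rule quad_linear[OF inner_commutes inner_commutes inner_commutes edge_central(2) edge_central(2) edge_central(2)
          edge_central(1) edge_central(1) edge_central(1)
          quad[OF V' dih, unfolded quad_at_def]
          quad_replaced[OF dih V disjI1[OF refl], unfolded quad_at_def]
          quad_replaced[OF dih V disjI2[OF refl], unfolded quad_at_def]
          h'' h'' h'])
      (use ne mem in simp_all)
qed

lemma pent_G:
  assumes dih: "dih5 v b c d e" and V: "{b, c, d, e} \<subseteq> V"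
  shows "pent_at G v b c d e" "pent_at G b c d e v"
proof -
  have ne: "b \<noteq> v" "c \<noteq> v" "d \<noteq> v" "e \<noteq> v" using dih5_distinct[OF dih] by auto
  have mem: "b \<in> V" "c \<in> V" "d \<in> V" "e \<in> V" using V by auto
  have V': "{v, b, c, d, e} \<subseteq> V" "{b, c, d, e, v} \<subseteq> V" using V vertices by auto
  have h': "h d = - qcomm (F p s) (F d v) + F p v * F d s + F v s * F d p" for d
    by (simp add: h_def sym[of d v] sym[of d s])
  have h'': "h d = - qcomm (F p s) (F v d) + F p v * F s d + F v s * F p d" for d
    by (simp add: h_def sym[of d p])
  note G = G_simps(2)[OF ne(1)] G_simps(2)[OF ne(2)] G_simps(3)[OF ne(3)] G_simps(3)[OF ne(4)]
      G_simps(4)[OF ne(1,2)] G_simps(4)[OF ne(1,3)] G_simps(4)[OF ne(2,3)] G_simps(4)[OF ne(2,4)]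
      G_simps(4)[OF ne(3,4)] G_simps(4)[OF ne(4,1)]
  note X = inner_commutes[of b d] inner_commutes[of c e] inner_commutes[of e b]
      inner_commutes[of b c] inner_commutes[of c d] inner_commutes[of d e]
  note A = edge_central(2)[of b d] edge_central(2)[of c e] edge_central(2)[of e b]
      edge_central(2)[of b c] edge_central(2)[of c d] edge_central(2)[of d e]
  note B = edge_central(1)[of b d] edge_central(1)[of c e] edge_central(1)[of e b]
      edge_central(1)[of b c] edge_central(1)[of c d] edge_central(1)[of d e]
  note VV = mem ne
  show "pent_at G v b c d e"
    unfolding pent_at_def G
    by (rule pent_linear[OF X(1,2,3,4,5) A(1,2,3,4,5) B(1,2,3,4,5)
          pent[OF V'(1) dih, unfolded pent_at_def]
          pent_replaced(1)[OF dih V disjI1[OF refl], unfolded pent_at_def]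
          pent_replaced(1)[OF dih V disjI2[OF refl], unfolded pent_at_def]
          h'' h' h'])
      (use VV in simp_all)
  show "pent_at G b c d e v"
    unfolding pent_at_def G
    by (rule pent_linear'[OF X(1,2,3,5,6) _ A(1,2,3,5,6) _ B(1,2,3,5,6) _
          pent[OF V'(2) dih5_rotate[OF dih], unfolded pent_at_def]
          pent_replaced(2)[OF dih V disjI1[OF refl], unfolded pent_at_def]
          pent_replaced(2)[OF dih V disjI2[OF refl], unfolded pent_at_def]
          h'' h'' h'])
      (use VV X A B in simp_all)
qed

text \<open>Both neighbours of \<open>v\<close> are corners, so the sides at \<open>v\<close> are
  exchanged exactly as in \<open>quad_exchange\<close>.\<close>

lemma quad_G_base:
  assumes c: "cyc4 v s b p" and b: "b \<in> V"
  shows "quad_at G s b p v"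
proof -
  have d: "dih4 v s b p" using c by (simp add: dih4_def)
  note d' = dih4_rotate[OF dih4_rotate[OF dih4_rotate[OF d]]]
  have V: "{p, v, s, b} \<subseteq> V" using b vertices by auto
  have ne: "b \<noteq> v" "b \<noteq> s" "b \<noteq> p" "s \<noteq> p" using dih4_distinct[OF d] by auto
  have y: "commutes (F s b) (F v b)" "commutes (F b p) (F v b)" "commutes (F s b) (F p s)"
    "commutes (F b p) (F p s)" "commutes (F s b) (F b p)"
    using V by (auto intro!: comm)
  have "qcomm (h b) (qcomm (F p s) (h b)) = F p s + (F s b * F v s + F b p * F p v) * h b - F s b * F b p - F v s * F p v"
    by (rule quad_exchange[of "F p v" "F p s" "F v b" "F v s" "F s b" "F b p", OF _ _ _ _ _ _ _ _ _ y(3,1,5,4,2)])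
      (use b vertices edge_central quads[OF V d'] in \<open>simp_all add: h_def\<close>)
  then show ?thesis
    unfolding quad_at_def using ne vertices h_neighbour by (simp add: G_simps sym[of s p])
qed

text \<open>Adding \<open>s\<close> to the quadrilateral a, b, p, v gives the pentagon in which
  \<open>quad_image\<close> computes.\<close>

lemma quad_G_last:
  assumes c: "cyc5 v s a b p" and V: "a \<in> V" "b \<in> V"
  shows "quad_at G a b p v"
proof -
  have d: "dih5 v s a b p" using c by (simp add: dih5_def)
  have V5: "{v, s, a, b, p} \<subseteq> V" using V vertices by auto
  note d1 = dih5_rotate[OF d] note d2 = dih5_rotate[OF d1] note d3 = dih5_rotate[OF d2]
  note 4 = dih5_dih4[OF d]
  have ne: "a \<noteq> v" "a \<noteq> s" "a \<noteq> p" "b \<noteq> v" "b \<noteq> s" "b \<noteq> p" "a \<noteq> b" using dih5_distinct[OF d] by auto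
  have sub: "{s, a, b, p} \<subseteq> V" "{b, p, v, s} \<subseteq> V" "{s, a, b, p, v} \<subseteq> V" "{a, b, p, v, s} \<subseteq> V" "{b, p, v, s, a} \<subseteq> V"
    using V5 by auto
  have hb: "h b = - qcomm (F p s) (F b v) + F p v * F s b + F v s * F b p"
    by (simp add: h_def sym[of b v])
  have ha: "h a = - qcomm (F p s) (F v a) + F p v * F s a + F v s * F a p"
    by (simp add: h_def)
  have comm_ab: "commutes (h a) (h b)" using ne V by (intro h_commutes) auto
  have dih4_v: "dih4 v a b p" using dih4_rotate[OF dih4_rotate[OF dih4_rotate[OF 4(3)]]] .
  have bp: "commutes (F b p) (h b)" "commutes (F b p) (h a)" "commutes (F a b) (h b)" "commutes (F a b) (h a)"
    using ne V vertices dih4_not(1)[of v a b p] d[unfolded dih5_iff[of v s a b p]] dih4_v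
    by (auto intro!: F_commutes_h)
  have "qcomm (qcomm (h b) (F a p) - h a * F b p - F a b * F v s) (h b) = F a p - F a b * F b p - F v s * h a"
    by (rule pentagon.quad_image[OF pentagon[OF d V5] quads(2)[OF sub(1) 4(2)]
          quads(2)[OF sub(2) 4(4)] pent[OF sub(3) d1, unfolded pent_at_def]
          pent_reversed[OF d2 sub(4)] pent_reversed[OF d3 sub(5)] ha hb])
  then have "qcomm (h b) (qcomm (F a p) (h b)) = F a p + (F a b * F v s + F b p * h a) * h b - F a b * F b p - F v s * h a" (is ?eq)
  proof -
    assume eq: "qcomm (qcomm (h b) (F a p) - h a * F b p - F a b * F v s) (h b) = F a p - F a b * F b p - F v s * h a"
    have "qcomm (h a * F b p) (h b) = h a * F b p * h b"
      by (rule qcomm_commutes) (intro commutes_sym[OF commutes_mult] comm_ab[THEN commutes_sym] bp(1)[THEN commutes_sym])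
    then have "qcomm (h a * F b p) (h b) = F b p * h a * h b"
      using commutesD[OF bp(2)] by simp
    moreover have "qcomm (F a b * F v s) (h b) = F a b * F v s * h b"
      using bp(3) edge_central_h(1)[OF V(2)] by (simp add: qcomm_mult_left qcomm_commutes mult.assoc)
    ultimately show ?eq
      using eq by (simp add: qcomm_linear qcomm_flip algebra_simps)
  qed
  then show ?thesis
    unfolding quad_at_def using ne vertices h_neighbour by (simp add: G_simps)
qed

text \<open>A quadrilateral without \<open>p\<close> is completed by \<open>p\<close> to a pentagon,
  whose other quadrilaterals all contain \<open>p\<close>.\<close>

lemma quad_G:
  assumes c: "cyc4 v a b c" and V: "a \<in> V" "b \<in> V" "c \<in> V"
  shows "quad_at G a b c v"
proof -
  have last: "quad_at G a b p v" if c: "cyc4 v a b p" and V: "a \<in> V" "b \<in> V" for a b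
  proof (cases "a = s")
    case True
    then show ?thesis using quad_G_base[of b] c V by simp
  next
    case False
    have "a \<noteq> v" using c unfolding cyc4_def cyc3_def by auto
    then have "cyc3 v s a" using succ V False by blast
    then have "cyc5 v s a b p" using c unfolding cyc5_def cyc4_def by blast
    then show ?thesis using V by (rule quad_G_last)
  qed
  show ?thesis
  proof (cases "c = p")
    case True
    then show ?thesis using last c V by simp
  next
    case False
    have ne: "a \<noteq> v" "b \<noteq> v" "c \<noteq> v" "a \<noteq> b" "b \<noteq> c" "a \<noteq> c"
      using c unfolding cyc4_def cyc3_def by auto
    have "cyc3 p v c" using pred V(3) ne False by blast
    then have cp: "cyc3 v c p" unfolding cyc3_def by blast
    have c3: "cyc3 v a b" "cyc3 v b c" using c by (simp_all add: cyc4_def)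
    have vac: "cyc3 v a c" using c3 unfolding cyc3_def by auto
    have c5: "cyc5 v a b c p" using c cp by (simp add: cyc5_def cyc4_def)
    have vbp: "cyc3 v b p" using c3(2) cp unfolding cyc3_def by auto
    have cs: "cyc4 v a b p" "cyc4 v b c p" "cyc4 v a c p"
      using c3 cp vac vbp by (simp_all add: cyc4_def)
    have d: "dih5 v a b c p" using c5 by (simp add: dih5_def)
    have V5: "{v, a, b, c, p} \<subseteq> V" "{a, b, c, p} \<subseteq> V" "{b, c, p} \<subseteq> V" using V vertices by auto
    note 4 = dih5_dih4[OF d]
    have nep: "a \<noteq> p" "b \<noteq> p" "c \<noteq> p" using dih5_distinct[OF d] by auto
    note pg = G.pentagon[OF d V5(1)]
    note cp = pentagon.sorted_products[OF pg]
    \<comment> \<open>Of the five quadrilateral premises of \<open>quad_transfer\<close>, three come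
      from \<open>last\<close>, \<open>Q4\<close> is linear in the chords at \<open>v\<close>, and
      \<open>Q5\<close> avoids \<open>v\<close>.\<close>
    note Q1 = last[OF cs(1) V(1,2), unfolded quad_at_def]
    note Q2 = last[OF cs(2) V(2,3), unfolded quad_at_def]
    note Q3 = last[OF cs(3) V(1,3), unfolded quad_at_def]
    have v_bcp: "dih4 v b c p" using cs(2) by (simp add: dih4_def)
    have "quad_at G v b c p" using v_bcp V5(3) by (rule quad_G_linear)
    then have Q4: "qcomm (G b p) (qcomm (G c v) (G b p)) = G c v + (G b c * G p v + G c p * G v b) * G b p - G c p * G p v - G b c * G v b"
      unfolding quad_at_def by (simp add: G.sym[of c v] cp algebra_simps)
    have Q3: "qcomm (G c v) (qcomm (G p a) (G c v)) = G p a + (G c p * G v a + G p v * G a c) * G c v - G p v * G v a - G c p * G a c"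
      using Q3 by (simp add: G.sym[of a p] cp algebra_simps)
    have Q1: "qcomm (G v b) (qcomm (G p a) (G v b)) = G p a + (G p v * G a b + G v a * G b p) * G v b - G p v * G v a - G a b * G b p"
      using Q1 by (simp add: G.sym[of a p] G.sym[of b v] cp algebra_simps)
    have Q5: "qcomm (G b p) (qcomm (G a c) (G b p)) = G a c + (G a b * G c p + G b c * G p a) * G b p - G a b * G b c - G c p * G p a"
      using quads(1)[OF V5(2) 4(2)] ne nep vertices by (simp add: G_simps)
    have "qcomm (G v b) (qcomm (G a c) (G v b)) = G a c + (G v a * G b c + G a b * G c v) * G v b - G a b * G b c - G v a * G c v"
      by (rule pentagon.quad_transfer[OF pg pent_G(1)[OF d V5(2), unfolded pent_at_def]
          pent_G(2)[OF d V5(2), unfolded pent_at_def] Q5 Q4 Q2 Q3 Q1])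
    then show ?thesis
      unfolding quad_at_def by (simp add: G.sym[of b v] cp algebra_simps)
  qed
qed

sublocale G: quadrilateral_chords V G
proof
  have at_v: "quad_at G v b c d" if "dih4 v b c d" "{b, c, d} \<subseteq> V" for b c d
    using that by (rule quad_G_linear)
  have opposite: "quad_at G b c d v" if dih: "dih4 v b c d" and V: "{b, c, d} \<subseteq> V" for b c d
  proof (cases "cyc4 v b c d")
    case True
    then show ?thesis using quad_G V by simp
  next
    case False
    then have "cyc4 v d c b"
      using dih unfolding dih4_iff cyc4_def by blast
    then have "quad_at G d c b v" using quad_G V by simp
    moreover have "dih4 d c b v" using dih by (auto simp: dih4_swap(2)[of v] dest: dih4_rotate dih4_reflect)
    moreover have "{d, c, b, v} \<subseteq> V" using V vertices by auto
    ultimately show ?thesis using G.quad_at_dihedral(3) by blast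
  qed
  fix a b c d assume V: "{a, b, c, d} \<subseteq> V" and dih: "dih4 a b c d"
  note r1 = dih4_rotate[OF dih] note r2 = dih4_rotate[OF r1] note r3 = dih4_rotate[OF r2]
  consider "v = a" | "v = b" | "v = c" | "v = d" | "v \<notin> {a, b, c, d}" by blast
  then show "quad_at G a b c d"
  proof cases
    case 1
    then show ?thesis using at_v dih V by simp
  next
    case 2
    then have "quad_at G c d a b" using opposite r1 V by simp
    then show ?thesis using G.quad_at_if_dihedral[OF V dih] by blast
  next
    case 3
    then have "quad_at G c d a b" using at_v r2 V by simp
    then show ?thesis using G.quad_at_if_dihedral[OF V dih] by blast
  next
    case 4
    then show ?thesis using opposite r3 V by simp
  next
    case 5
    then have "a \<noteq> v" "b \<noteq> v" "c \<noteq> v" "d \<noteq> v" by auto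
    then show ?thesis using quad[OF V dih] unfolding quad_at_def by (simp add: G_simps)
  qed
qed

sublocale G: chord_family V G
proof
  have at_v: "pent_at G v b c d e" if "dih5 v b c d e" "{b, c, d, e} \<subseteq> V" for b c d e
    using that by (rule pent_G)
  fix a b c d e assume V: "{a, b, c, d, e} \<subseteq> V" and dih: "dih5 a b c d e"
  note r1 = dih5_rotate[OF dih] note r2 = dih5_rotate[OF r1]
  note r3 = dih5_rotate[OF r2] note r4 = dih5_rotate[OF r3]
  show "pent_at G a b c d e"
  proof (cases "v \<in> {a, b, c, d, e}")
    case True
    then have "pent_at G a b c d e \<or> pent_at G b c d e a \<or> pent_at G c d e a b
        \<or> pent_at G d e a b c \<or> pent_at G e a b c d"
      using at_v[of b c d e] at_v[of c d e a] at_v[of d e a b] at_v[of e a b c] at_v[of a b c d]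
        dih r1 r2 r3 r4 V by auto
    then show ?thesis by (rule G.pent_at_rotations[OF dih V])
  next
    case False
    then have "a \<noteq> v" "b \<noteq> v" "c \<noteq> v" "d \<noteq> v" "e \<noteq> v" by auto
    then show ?thesis using pent[OF V dih] unfolding pent_at_def by (simp add: G_simps)
  qed
qed

end

subsection \<open>The universal property of the algebra\<close>

fun word_eval :: "('a \<Rightarrow> 'b::cq_algebra) \<Rightarrow> 'a fmonoid \<Rightarrow> 'b" where
  "word_eval g (Wrd w) = prod_list (map g w)"

definition eval_poly :: "('a \<Rightarrow> 'b::cq_algebra) \<Rightarrow> ('a fmonoid \<Rightarrow>\<^sub>0 cq) \<Rightarrow> 'b" where
  "eval_poly g p = (\<Sum>k\<in>Poly_Mapping.keys p. Poly_Mapping.lookup p k *\<^sub>q word_eval g k)"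

lemma word_eval_add: "word_eval g (k + l) = word_eval g k * word_eval g l"
  by (cases k; cases l) simp

lemma eval_poly_superset:
  assumes "finite S" "Poly_Mapping.keys p \<subseteq> S"
  shows "eval_poly g p = (\<Sum>k\<in>S. Poly_Mapping.lookup p k *\<^sub>q word_eval g k)"
  unfolding eval_poly_def using assms
  by (intro sum.mono_neutral_left) (auto simp: in_keys_iff)

lemma eval_poly_add: "eval_poly g (p + r) = eval_poly g p + eval_poly g r"
proof -
  let ?S = "Poly_Mapping.keys p \<union> Poly_Mapping.keys r"
  have "Poly_Mapping.keys (p + r) \<subseteq> ?S" by (rule Poly_Mapping.keys_add)
  then show ?thesis
    by (simp add: eval_poly_superset[of ?S] lookup_add scale_cq_add_left sum.distrib)
qed

lemma eval_poly_single: "eval_poly g (Poly_Mapping.single k c) = c *\<^sub>q word_eval g k"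
  by (simp add: eval_poly_superset[of "{k}"])

lemma eval_poly_zero: "eval_poly g 0 = 0"
  by (simp add: eval_poly_def)

lemma eval_poly_mult: "eval_poly g (p * r) = eval_poly g p * eval_poly g r"
proof (induction p rule: update_induct)
  case const
  show ?case by (simp add: eval_poly_zero)
next
  case (update f k v)
  have "eval_poly g (Poly_Mapping.single k v * r) = eval_poly g (Poly_Mapping.single k v) * eval_poly g r"
  proof (induction r rule: update_induct)
    case const
    show ?case by (simp add: eval_poly_zero)
  next
    case (update h l w)
    then show ?case
      by (simp add: update_eq_add_single distrib_left mult_single eval_poly_add eval_poly_single
          word_eval_add mult_scale_cq_left mult_scale_cq_right scale_cq_scale_cq mult.commute[of w v])
  qed
  with update show ?case
    by (simp add: update_eq_add_single distrib_right eval_poly_add)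
qed

lift_definition free_eval :: "('a \<Rightarrow> 'b::cq_algebra) \<Rightarrow> 'a freealg \<Rightarrow> 'b" is eval_poly .

lemma free_eval_hom: "alg_hom (free_eval g)"
  unfolding alg_hom_def
  by (intro conjI allI; transfer)
    (simp_all add: eval_poly_add eval_poly_mult eval_poly_single scale_cq_one mult_scale_cq_left
      single_one[symmetric] zero_fmonoid_def del: single_one)

lemma free_eval_fgen: "free_eval g (fgen a) = g a"
  by transfer (simp add: eval_poly_single scale_cq_one)

text \<open>Left multiplication by generators builds the words; scalars and sums build everything
  else.\<close>

lemma freealg_induct [case_names one add scale fgen]:
  fixes x :: "'a freealg"
  assumes one: "P 1" and add: "\<And>x y. P x \<Longrightarrow> P y \<Longrightarrow> P (x + y)"
    and scale: "\<And>c x. P x \<Longrightarrow> P (c *\<^sub>q x)" and fgen: "\<And>a x. P x \<Longrightarrow> P (fgen a * x)"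
  shows "P x"
proof -
  have word: "P (Abs_freealg (Poly_Mapping.single (Wrd w) 1))" for w
  proof (induction w)
    case Nil
    have "Abs_freealg (Poly_Mapping.single (Wrd []) 1) = (1 :: 'a freealg)"
      by (simp add: one_freealg_def zero_fmonoid_def[symmetric])
    then show ?case using one by simp
  next
    case (Cons a w)
    have "Abs_freealg (Poly_Mapping.single (Wrd (a # w)) 1) = fgen a * Abs_freealg (Poly_Mapping.single (Wrd w) 1)"
      by (simp add: fgen_def times_freealg.abs_eq mult_single)
    then show ?case using fgen[OF Cons] by simp
  qed
  have "P (Abs_freealg p)" for p
  proof (induction p rule: update_induct)
    case const
    have "(0 :: 'a freealg) = 0 *\<^sub>q 1" by simp
    then have "P 0" using scale[OF one] by metis
    then show ?case by (simp add: zero_freealg_def)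
  next
    case (update f k v)
    obtain w where k: "k = Wrd w" by (cases k)
    have "Abs_freealg (Poly_Mapping.single k v) = v *\<^sub>q Abs_freealg (Poly_Mapping.single (Wrd w) 1)"
      by (simp add: k scale_cq_freealg.abs_eq mult_single)
    moreover have "Abs_freealg (Poly_Mapping.update k v f) = Abs_freealg f + Abs_freealg (Poly_Mapping.single k v)"
      using update by (simp add: update_eq_add_single plus_freealg.abs_eq)
    ultimately show ?case using add[OF update(3) scale[OF word]] by simp
  qed
  then show ?thesis by (cases x) auto
qed

lemma alg_homD:
  assumes "alg_hom f"
  shows "f 1 = 1" "f (x + y) = f x + f y" "f (c *\<^sub>q x) = c *\<^sub>q f x" "f (x * y) = f x * f y"
    "f 0 = 0" "f (- x) = - f x" "f (x - y) = f x - f y" "f (qcomm x y) = qcomm (f x) (f y)"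
proof -
  show *: "f 1 = 1" "f (x + y) = f x + f y" "f (c *\<^sub>q x) = c *\<^sub>q f x" "f (x * y) = f x * f y" for x y c
    using assms by (auto simp: alg_hom_def)
  show 0: "f 0 = 0" using *(2)[of 0 0] by simp
  show minus: "f (- x) = - f x" for x using *(2)[of x "- x"] 0 by (simp add: eq_neg_iff_add_eq_0 add.commute)
  show diff: "f (x - y) = f x - f y" for x y using *(2)[of x "- y"] minus by simp
  show "f (qcomm x y) = qcomm (f x) (f y)"
    by (simp add: qcomm_eq diff *)
qed

lemma alg_hom_comp: "alg_hom f \<Longrightarrow> alg_hom g \<Longrightarrow> alg_hom (f \<circ> g)"
  by (simp add: alg_hom_def)

lemma alg_hom_id: "alg_hom id"
  by (simp add: alg_hom_def)

lemma alg_hom_pairC: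
  assumes "alg_hom f" shows "f (pairC C I J) = pairC (\<lambda>I. f (C I)) I J"
  by (simp add: pairC_def Let_def alg_homD[OF assms])

lemma abs_aw_hom: "alg_hom abs_aw"
  by (simp add: alg_hom_def one_aw.abs_eq plus_aw.abs_eq scale_cq_aw.abs_eq times_aw.abs_eq)

lemma abs_aw_freeC: "abs_aw (freeC I) = awC I"
  by (simp add: awC.abs_eq)

lemma conn_cases:
  fixes a :: "'n::finite conn"
  obtains j k where "1 \<le> j" "j \<le> k" "k \<le> CARD('n)" "fgen a = freeC {j..k}"
proof -
  have "conn (Rep_conn a)" "Rep_conn a \<subseteq> {1..CARD('n)}" using Rep_conn[of a] by auto
  then obtain j k where jk: "j \<le> k" "Rep_conn a = {j..k}" unfolding conn_def by auto
  have "Rep_conn a \<noteq> {}" using jk by auto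
  then have "fgen a = freeC (Rep_conn a)" by (simp add: freeC_def Rep_conn_inverse)
  then have "fgen a = freeC {j..k}" by (simp only: jk(2))
  moreover have "1 \<le> j" "k \<le> CARD('n)" using \<open>Rep_conn a \<subseteq> _\<close> jk by auto
  ultimately show ?thesis using that jk by blast
qed

lemma alg_hom_aw_eqI:
  fixes f g :: "'n::finite aw \<Rightarrow> 'b::cq_algebra"
  assumes f: "alg_hom f" and g: "alg_hom g"
    and eq: "\<And>j k. 1 \<le> j \<Longrightarrow> j \<le> k \<Longrightarrow> k \<le> CARD('n) \<Longrightarrow> f (awC {j..k}) = g (awC {j..k})"
  shows "f = g"
proof
  have "f (abs_aw p) = g (abs_aw p)" for p
  proof (induction p rule: freealg_induct)
    case (fgen a x)
    obtain j k where "1 \<le> j" "j \<le> k" "k \<le> CARD('n)" "fgen a = freeC {j..k}" by (rule conn_cases)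
    with fgen eq[of j k] show ?case
      by (simp add: alg_homD[OF abs_aw_hom] alg_homD[OF f] alg_homD[OF g] abs_aw_freeC)
  qed (simp_all add: alg_homD[OF abs_aw_hom] alg_homD[OF f] alg_homD[OF g])
  then show "f x = g x" for x by (induction x rule: aw.abs_induct)
qed

text \<open>The relators as equations for a family in an arbitrary algebra: one formulation for the
  generators and for prospective images, including the convention for the empty index.\<close>

definition aw_relations :: "nat \<Rightarrow> (nat set \<Rightarrow> 'a::cq_algebra) \<Rightarrow> bool" where
  "aw_relations n C \<longleftrightarrow> C {} = 1
   \<and> (\<forall>I J. conn I \<and> conn J \<and> I \<union> J \<subseteq> {1..n} \<and> (I \<inter> J = {} \<or> I \<subseteq> J) \<longrightarrow> C I * C J = C J * C I)
   \<and> (\<forall>I1 I2 I3. monotonic_adjacent [I1, I2, I3] \<and> I1 \<union> I2 \<union> I3 \<subseteq> {1..n} \<longrightarrow>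
        C (I1 \<union> I2) = - qcomm (C (I2 \<union> I3)) (pairC C I1 I3) + C I1 * C I2 + C I3 * C (I1 \<union> I2 \<union> I3))
   \<and> (\<forall>I1 I2 I3 I4. monotonic_adjacent [I1, I2, I3, I4] \<and> I1 \<union> I2 \<union> I3 \<union> I4 \<subseteq> {1..n} \<longrightarrow>
        pairC C I1 I4 = - qcomm (pairC C I1 I3) (C (I3 \<union> I4)) + C I1 * C I4 + C I3 * pairC C I1 (I3 \<union> I4))"

lemma aw_relations_awC: "aw_relations CARD('n) (awC :: nat set \<Rightarrow> 'n::finite aw)"
proof -
  have rel: "abs_aw r = 0" if "r \<in> relators" for r :: "'n conn freealg"
  proof -
    have "aw_rel r 0" using that by (simp add: aw_rel_def ideal_gen.incl)
    then have "abs_aw r = abs_aw 0" by (simp add: aw.abs_eq_iff)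
    then show ?thesis by (simp add: alg_homD[OF abs_aw_hom])
  qed
  note simps = alg_homD[OF abs_aw_hom] alg_hom_pairC[OF abs_aw_hom] abs_aw_freeC
  have comm: "awC I * awC J = (awC J * awC I :: 'n aw)"
    if "conn I \<and> conn J \<and> I \<union> J \<subseteq> {1..CARD('n)} \<and> (I \<inter> J = {} \<or> I \<subseteq> J)" for I J
  proof -
    have "(freeC I * freeC J - freeC J * freeC I :: 'n conn freealg) \<in> relators"
      unfolding relators_def using that by blast
    from rel[OF this] show ?thesis by (simp add: simps)
  qed
  have two: "awC (I1 \<union> I2) = (- qcomm (awC (I2 \<union> I3)) (pairC awC I1 I3) + awC I1 * awC I2 + awC I3 * awC (I1 \<union> I2 \<union> I3) :: 'n aw)"
    if "monotonic_adjacent [I1, I2, I3] \<and> I1 \<union> I2 \<union> I3 \<subseteq> {1..CARD('n)}" for I1 I2 I3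
  proof -
    have "(freeC (I1 \<union> I2) - (- qcomm (freeC (I2 \<union> I3)) (pairC freeC I1 I3)
         + freeC I1 * freeC I2 + freeC I3 * freeC (I1 \<union> I2 \<union> I3)) :: 'n conn freealg) \<in> relators"
      unfolding relators_def using that by blast
    from rel[OF this] show ?thesis by (simp add: simps)
  qed
  have three: "pairC awC I1 I4 = (- qcomm (pairC awC I1 I3) (awC (I3 \<union> I4)) + awC I1 * awC I4 + awC I3 * pairC awC I1 (I3 \<union> I4) :: 'n aw)"
    if "monotonic_adjacent [I1, I2, I3, I4] \<and> I1 \<union> I2 \<union> I3 \<union> I4 \<subseteq> {1..CARD('n)}" for I1 I2 I3 I4
  proof -
    have "(pairC freeC I1 I4 - (- qcomm (pairC freeC I1 I3) (freeC (I3 \<union> I4))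
         + freeC I1 * freeC I4 + freeC I3 * pairC freeC I1 (I3 \<union> I4)) :: 'n conn freealg) \<in> relators"
      unfolding relators_def using that by blast
    from rel[OF this] show ?thesis by (simp add: simps)
  qed
  show ?thesis
    unfolding aw_relations_def using comm two three awC_empty by blast
qed

lemma relators_vanish:
  fixes f :: "'n::finite conn freealg \<Rightarrow> 'b::cq_algebra"
  assumes f: "alg_hom f" and rel: "aw_relations CARD('n) (\<lambda>I. f (freeC I))" and r: "r \<in> relators"
  shows "f r = 0"
proof -
  note simps = alg_homD[OF f] alg_hom_pairC[OF f]
  from r show ?thesis
    unfolding relators_def Un_iff mem_Collect_eq
  proof (elim disjE exE conjE)
    fix I J assume r: "r = freeC I * freeC J - freeC J * freeC I"
      and IJ: "conn I" "conn J" "I \<union> J \<subseteq> {1..CARD('n)}" "I \<inter> J = {}"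
    have "f (freeC I) * f (freeC J) = f (freeC J) * f (freeC I)"
      using rel IJ unfolding aw_relations_def by blast
    then show ?thesis unfolding r by (simp add: simps)
  next
    fix I J assume r: "r = freeC I * freeC J - freeC J * freeC I"
      and IJ: "conn I" "conn J" "I \<union> J \<subseteq> {1..CARD('n)}" "I \<subseteq> J"
    have "f (freeC I) * f (freeC J) = f (freeC J) * f (freeC I)"
      using rel IJ unfolding aw_relations_def by blast
    then show ?thesis unfolding r by (simp add: simps)
  next
    fix I1 I2 I3 assume r: "r = freeC (I1 \<union> I2) - (- qcomm (freeC (I2 \<union> I3)) (pairC freeC I1 I3)
         + freeC I1 * freeC I2 + freeC I3 * freeC (I1 \<union> I2 \<union> I3))"
      and m: "monotonic_adjacent [I1, I2, I3]" "I1 \<union> I2 \<union> I3 \<subseteq> {1..CARD('n)}"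
    have "f (freeC (I1 \<union> I2)) = - qcomm (f (freeC (I2 \<union> I3))) (pairC (\<lambda>I. f (freeC I)) I1 I3)
         + f (freeC I1) * f (freeC I2) + f (freeC I3) * f (freeC (I1 \<union> I2 \<union> I3))"
      using rel m unfolding aw_relations_def by blast
    then show ?thesis unfolding r by (simp add: simps)
  next
    fix I1 I2 I3 I4 assume r: "r = pairC freeC I1 I4 - (- qcomm (pairC freeC I1 I3) (freeC (I3 \<union> I4))
         + freeC I1 * freeC I4 + freeC I3 * pairC freeC I1 (I3 \<union> I4))"
      and m: "monotonic_adjacent [I1, I2, I3, I4]" "I1 \<union> I2 \<union> I3 \<union> I4 \<subseteq> {1..CARD('n)}"
    have "pairC (\<lambda>I. f (freeC I)) I1 I4 = - qcomm (pairC (\<lambda>I. f (freeC I)) I1 I3) (f (freeC (I3 \<union> I4)))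
         + f (freeC I1) * f (freeC I4) + f (freeC I3) * pairC (\<lambda>I. f (freeC I)) I1 (I3 \<union> I4)"
      using rel m unfolding aw_relations_def by blast
    then show ?thesis unfolding r by (simp add: simps)
  qed
qed

lemma aw_lift:
  fixes f :: "'n::finite conn freealg \<Rightarrow> 'b::cq_algebra"
  assumes f: "alg_hom f" and rel: "aw_relations CARD('n) (\<lambda>I. f (freeC I))"
  obtains g :: "'n aw \<Rightarrow> 'b" where "alg_hom g" "\<And>I. g (awC I) = f (freeC I)"
proof
  have ideal: "f r = 0" if "r \<in> ideal_gen relators" for r
    using that
    by (induction rule: ideal_gen.induct) (simp_all add: alg_homD[OF f] relators_vanish[OF f rel])
  have respects: "f x = f y" if "abs_aw x = abs_aw y" for x y
    using that ideal[of "x - y"] by (simp add: aw.abs_eq_iff aw_rel_def alg_homD[OF f])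
  \<comment> \<open>Any representative will do, since \<open>f\<close> is constant on
    classes.\<close>
  define g where "g x = f (SOME y. abs_aw y = x)" for x
  have g: "g (abs_aw y) = f y" for y
    unfolding g_def by (rule respects) (rule someI, rule refl)
  show "alg_hom g"
    unfolding alg_hom_def
  proof (intro conjI allI)
    show "g 1 = 1" using g[of 1] by (simp add: alg_homD[OF f] alg_homD[OF abs_aw_hom])
    fix x y :: "'n aw"
    obtain x' where x: "x = abs_aw x'" by (induction x rule: aw.abs_induct) blast
    obtain y' where y: "y = abs_aw y'" by (induction y rule: aw.abs_induct) blast
    show "g (x + y) = g x + g y"
      using g[of "x' + y'"] by (simp add: x y g alg_homD[OF f] alg_homD[OF abs_aw_hom])
    show "g (x * y) = g x * g y"
      using g[of "x' * y'"] by (simp add: x y g alg_homD[OF f] alg_homD[OF abs_aw_hom])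
    show "g (c *\<^sub>q x) = c *\<^sub>q g x" for c
      using g[of "c *\<^sub>q x'"] by (simp add: x g alg_homD[OF f] alg_homD[OF abs_aw_hom])
  qed
  show "g (awC I) = f (freeC I)" for I
    using g[of "freeC I"] by (simp add: abs_aw_freeC)
qed


subsection \<open>Relations in terms of chords\<close>

context commuting_chords
begin

text \<open>The element with the two-set index \<open>{a..<b}\<close>, \<open>{c..<d}\<close> in
  terms of chords; reading the corners backwards reverses the pair. The image
  \<open>vertex_move.h\<close> of a chord vw is \<open>Z p v s w\<close>.\<close>

definition Z :: "nat \<Rightarrow> nat \<Rightarrow> nat \<Rightarrow> nat \<Rightarrow> 'a" where
  "Z a b c d = - qcomm (F a c) (F b d) + F a b * F c d + F b c * F a d"

lemma quad_at_iff:
  assumes V: "{a, b, c, d} \<subseteq> V"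
  shows "F a c = - qcomm (F b d) (Z a b c d) + F a b * F b c + F c d * F a d \<longleftrightarrow> quad_at F a b c d"
proof -
  have cs: "commutes (F a b) (F b d)" "commutes (F c d) (F b d)" "commutes (F b c) (F b d)" "commutes (F a d) (F b d)"
    using V by (auto intro!: comm)
  then have eq: "qcomm (F b d) (Z a b c d) = - qcomm (F b d) (qcomm (F a c) (F b d)) + (F a b * F c d + F b c * F d a) * F b d"
    by (simp add: Z_def qcomm_linear qcomm_commutes cs[THEN commutes_sym] cs[THEN commutesD]
        cs[THEN commutesD2] distrib_left distrib_right mult.assoc sym[of d a])
  then show ?thesis
    unfolding quad_at_def eq unfolding sym[of d a] by (auto simp: algebra_simps)
qed

text \<open>After expanding the three two-set elements, all terms containing the side ab
  cancel.\<close>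

lemma pent_at_iff:
  assumes V: "{a, b, c, d, e} \<subseteq> V" and dih: "dih5 a b c d e"
  shows "Z a b d e = - qcomm (Z a b c d) (F c e) + F a b * F d e + F c d * Z a b c e \<longleftrightarrow> pent_at F a b c d e"
proof -
  interpret P: pentagon "F a b" "F b c" "F c d" "F d e" "F e a" "F a c" "F b d" "F c e" "F d a" "F e b"
    using dih V by (rule pentagon)
  note simps = P.norm sym[of b e] sym[of a d] sym[of a e]
  have 1: "qcomm (Z a b c d) (F c e) = - qcomm (qcomm (F a c) (F b d)) (F c e) + F a b * (F c d * F c e) + F b c * qcomm (F d a) (F c e)"
    unfolding Z_def by (simp add: simps)
  have 2: "F c d * Z a b c e = - F c d * qcomm (F a c) (F e b) + F a b * (F c d * F c e) + F b c * (F c d * F e a)"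
    unfolding Z_def by (simp add: simps)
  have 3: "Z a b d e = - qcomm (F d a) (F e b) + F a b * F d e + F e a * F b d"
    unfolding Z_def by (simp add: simps)
  show ?thesis
    unfolding 1 2 3 pent_at_def by (auto simp: algebra_simps)
qed

end

section \<open>Connected sets as half-open intervals\<close>

lemma conn_interval: "a < b \<Longrightarrow> conn {a..<b}"
  unfolding conn_def by (rule exI[of _ a], rule exI[of _ "b - 1"]) auto

lemma conn_intervalE:
  assumes "conn I" obtains a b where "a < b" "I = {a..<b}"
proof -
  from assms obtain j k where "j \<le> k" "I = {j..k}" unfolding conn_def by blast
  then show ?thesis using that[of j "Suc k"] by (simp add: atLeastLessThanSuc_atLeastAtMost)
qed

lemma adjacent_intervals: "a < b \<Longrightarrow> b < c \<Longrightarrow> adjacent {a..<b} {b..<c}" "a < b \<Longrightarrow> b < c \<Longrightarrow> adjacent {b..<c} {a..<b}"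
proof -
  assume *: "a < b" "b < c"
  have "{a..<b} \<union> {b..<c} = {a..<c}" "{b..<c} \<union> {a..<b} = {a..<c}" using * by auto
  then show "adjacent {a..<b} {b..<c}" "adjacent {b..<c} {a..<b}"
    using * by (auto simp: adjacent_def intro: conn_interval)
qed

lemma adjacent_lessD:
  assumes I: "I = {a..<b}" "a < b" and J: "conn J" and less: "set_less I J" and adj: "adjacent I J \<or> adjacent J I"
  obtains c where "b < c" "J = {b..<c}"
proof -
  obtain l c where lc: "l < c" "J = {l..<c}" using J by (rule conn_intervalE)
  have "b - 1 \<in> I" "l \<in> J" using I lc by auto
  then have bl: "b \<le> l" using less I unfolding set_less_def by fastforce
  have "conn (I \<union> J)" using adj unfolding adjacent_def by (auto simp: Un_commute)
  then obtain x y where xy: "I \<union> J = {x..<y}" by (metis conn_intervalE)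
  have "b - 1 \<in> {x..<y}" "l \<in> {x..<y}" using \<open>b - 1 \<in> I\<close> \<open>l \<in> J\<close> xy by blast+
  \<comment> \<open>The union is an interval containing \<open>b - 1\<close> and \<open>l\<close>,
    so there is no gap at \<open>b\<close>.\<close>
  then have "b \<in> {x..<y}" using bl \<open>a < b\<close> by auto
  then have "b \<in> J" using I xy by auto
  then have "l = b" using lc bl by auto
  with lc show ?thesis using that by blast
qed

lemma monotonic_adjacent3E:
  assumes "monotonic_adjacent [I1, I2, I3]"
  obtains a b c d where "a < b" "b < c" "c < d" "I1 = {a..<b}" "I2 = {b..<c}" "I3 = {c..<d}"
    | a b c d where "a < b" "b < c" "c < d" "I3 = {a..<b}" "I2 = {b..<c}" "I1 = {c..<d}"
proof -
  have conn: "conn I1" "conn I2" "conn I3" and adj: "adjacent I1 I2" "adjacent I2 I3"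
    and less: "set_less I1 I2 \<and> set_less I2 I3 \<or> set_less I2 I1 \<and> set_less I3 I2"
    using assms unfolding monotonic_adjacent_def monotonic_def by auto
  from less show ?thesis
  proof (elim disjE conjE)
    assume l: "set_less I1 I2" "set_less I2 I3"
    obtain a b where 1: "a < b" "I1 = {a..<b}" using conn(1) by (rule conn_intervalE)
    obtain c where 2: "b < c" "I2 = {b..<c}" using adjacent_lessD[OF 1(2,1) conn(2) l(1)] adj by blast
    obtain d where "c < d" "I3 = {c..<d}" using adjacent_lessD[OF 2(2,1) conn(3) l(2)] adj by blast
    then show ?thesis using that(1) 1 2 by blast
  next
    assume l: "set_less I2 I1" "set_less I3 I2"
    obtain a b where 1: "a < b" "I3 = {a..<b}" using conn(3) by (rule conn_intervalE)
    obtain c where 2: "b < c" "I2 = {b..<c}" using adjacent_lessD[OF 1(2,1) conn(2) l(2)] adj by blast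
    obtain d where "c < d" "I1 = {c..<d}" using adjacent_lessD[OF 2(2,1) conn(1) l(1)] adj by blast
    then show ?thesis using that(2) 1 2 by blast
  qed
qed

lemma monotonic_adjacent4E:
  assumes "monotonic_adjacent [I1, I2, I3, I4]"
  obtains a b c d e where "a < b" "b < c" "c < d" "d < e" "I1 = {a..<b}" "I2 = {b..<c}" "I3 = {c..<d}" "I4 = {d..<e}"
    | a b c d e where "a < b" "b < c" "c < d" "d < e" "I4 = {a..<b}" "I3 = {b..<c}" "I2 = {c..<d}" "I1 = {d..<e}"
proof -
  have conn: "conn I1" "conn I2" "conn I3" "conn I4" and adj: "adjacent I1 I2" "adjacent I2 I3" "adjacent I3 I4"
    and less: "set_less I1 I2 \<and> set_less I2 I3 \<and> set_less I3 I4 \<or> set_less I2 I1 \<and> set_less I3 I2 \<and> set_less I4 I3"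
    using assms unfolding monotonic_adjacent_def monotonic_def by auto
  from less show ?thesis
  proof (elim disjE conjE)
    assume l: "set_less I1 I2" "set_less I2 I3" "set_less I3 I4"
    obtain a b where 1: "a < b" "I1 = {a..<b}" using conn(1) by (rule conn_intervalE)
    obtain c where 2: "b < c" "I2 = {b..<c}" using adjacent_lessD[OF 1(2,1) conn(2) l(1)] adj by blast
    obtain d where 3: "c < d" "I3 = {c..<d}" using adjacent_lessD[OF 2(2,1) conn(3) l(2)] adj by blast
    obtain e where "d < e" "I4 = {d..<e}" using adjacent_lessD[OF 3(2,1) conn(4) l(3)] adj by blast
    then show ?thesis using that(1) 1 2 3 by blast
  next
    assume l: "set_less I2 I1" "set_less I3 I2" "set_less I4 I3"
    obtain a b where 1: "a < b" "I4 = {a..<b}" using conn(4) by (rule conn_intervalE)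
    obtain c where 2: "b < c" "I3 = {b..<c}" using adjacent_lessD[OF 1(2,1) conn(3) l(3)] adj by blast
    obtain d where 3: "c < d" "I2 = {c..<d}" using adjacent_lessD[OF 2(2,1) conn(2) l(2)] adj by blast
    obtain e where "d < e" "I1 = {d..<e}" using adjacent_lessD[OF 3(2,1) conn(1) l(1)] adj by blast
    then show ?thesis using that(2) 1 2 3 by blast
  qed
qed

lemma monotonic_adjacent3I:
  assumes "a < b" "b < c" "c < d"
  shows "monotonic_adjacent [{a..<b}, {b..<c}, {c..<d}]" "monotonic_adjacent [{c..<d}, {b..<c}, {a..<b}]"
  using assms adjacent_intervals[of a b c] adjacent_intervals[of b c d]
  unfolding monotonic_adjacent_def monotonic_def by (simp_all add: conn_interval set_less_def)

lemma monotonic_adjacent4I: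
  assumes "a < b" "b < c" "c < d" "d < e"
  shows "monotonic_adjacent [{a..<b}, {b..<c}, {c..<d}, {d..<e}]" "monotonic_adjacent [{d..<e}, {c..<d}, {b..<c}, {a..<b}]"
  using assms adjacent_intervals[of a b c] adjacent_intervals[of b c d] adjacent_intervals[of c d e]
  unfolding monotonic_adjacent_def monotonic_def by (simp_all add: conn_interval set_less_def)

lemma pairC_intervals:
  assumes "a < b" "b < c" "c < d"
  shows "pairC C {a..<b} {c..<d} = - qcomm (C {a..<c}) (C {b..<d}) + C {a..<b} * C {c..<d} + C {b..<c} * C {a..<d}"
    and "pairC C {c..<d} {a..<b} = - qcomm (C {b..<d}) (C {a..<c}) + C {c..<d} * C {a..<b} + C {b..<c} * C {a..<d}"
proof -
  have "\<not> conn ({a..<b} \<union> {c..<d})"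
  proof
    assume "conn ({a..<b} \<union> {c..<d})"
    then obtain x y where xy: "{a..<b} \<union> {c..<d} = {x..<y}" by (metis conn_intervalE)
    have "a \<in> {x..<y}" "c \<in> {x..<y}" using assms unfolding xy[symmetric] by auto
    then have "b \<in> {x..<y}" using assms by auto
    then show False using assms unfolding xy[symmetric] by auto
  qed
  then have na: "\<not> adjacent {a..<b} {c..<d}" "\<not> adjacent {c..<d} {a..<b}"
    by (simp_all add: adjacent_def Un_commute)
  have hole: "hole {a..<b} {c..<d} = {b..<c}" "hole {c..<d} {a..<b} = {b..<c}"
  proof -
    have mem: "a \<in> {a..<b}" "b - 1 \<in> {a..<b}" "c \<in> {c..<d}" using assms by auto
    have "b \<le> h \<and> h < c" if "\<forall>i\<in>{a..<b}. \<forall>j\<in>{c..<d}. i < h \<and> h < j" for h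
      using bspec[OF bspec[OF that mem(2)] mem(3)] by auto
    moreover have False if "\<forall>i\<in>{a..<b}. \<forall>j\<in>{c..<d}. j < h \<and> h < i" for h
      using bspec[OF bspec[OF that mem(1)] mem(3)] assms by auto
    moreover have "\<forall>i\<in>{a..<b}. \<forall>j\<in>{c..<d}. i < h \<and> h < j" if "b \<le> h \<and> h < c" for h
      using that by fastforce
    ultimately have "h \<in> hole {a..<b} {c..<d} \<longleftrightarrow> b \<le> h \<and> h < c" for h
      unfolding hole_def mem_Collect_eq by iprover
    then show "hole {a..<b} {c..<d} = {b..<c}" by (simp add: set_eq_iff)
    moreover have "hole J I = hole I J" for I J :: "nat set"
      unfolding hole_def by (rule Collect_cong) blast
    ultimately show "hole {c..<d} {a..<b} = {b..<c}" by simp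
  qed
  have un: "{a..<b} \<union> {b..<c} = {a..<c}" "{b..<c} \<union> {c..<d} = {b..<d}" "{a..<c} \<union> {c..<d} = {a..<d}"
    "{c..<d} \<union> {b..<c} = {b..<d}" "{b..<c} \<union> {a..<b} = {a..<c}" "{b..<d} \<union> {a..<b} = {a..<d}"
    using assms by auto
  show "pairC C {a..<b} {c..<d} = - qcomm (C {a..<c}) (C {b..<d}) + C {a..<b} * C {c..<d} + C {b..<c} * C {a..<d}"
    "pairC C {c..<d} {a..<b} = - qcomm (C {b..<d}) (C {a..<c}) + C {c..<d} * C {a..<b} + C {b..<c} * C {a..<d}"
    using assms na by (simp_all add: pairC_def Let_def hole un)
qed

lemma dih4_increasing: "a < b \<Longrightarrow> b < c \<Longrightarrow> c < d \<Longrightarrow> dih4 a b c d"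
  by (simp add: order_defs)

lemma dih5_increasing: "a < b \<Longrightarrow> b < c \<Longrightarrow> c < d \<Longrightarrow> d < e \<Longrightarrow> dih5 a b c d e"
  by (simp add: order_defs)

lemma crossing_iff:
  assumes "a < b" "c < d"
  shows "dih4 a c b d \<longleftrightarrow> a < c \<and> c < b \<and> b < d \<or> c < a \<and> a < d \<and> d < b"
proof
  show "dih4 a c b d \<Longrightarrow> a < c \<and> c < b \<and> b < d \<or> c < a \<and> a < d \<and> d < b"
    using assms by (auto dest!: dih4_cases)
  show "a < c \<and> c < b \<and> b < d \<or> c < a \<and> a < d \<and> d < b \<Longrightarrow> dih4 a c b d"
    by (auto simp: order_defs)
qed

lemma interval_subset:
  fixes a b n :: nat
  assumes "a < b" shows "{a..<b} \<subseteq> {1..n} \<longleftrightarrow> 1 \<le> a \<and> b \<le> Suc n"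
proof
  assume *: "{a..<b} \<subseteq> {1..n}"
  have "a \<in> {a..<b}" "b - 1 \<in> {a..<b}" using assms by auto
  with * have "a \<in> {1..n}" "b - 1 \<in> {1..n}" by blast+
  then show "1 \<le> a \<and> b \<le> Suc n" by auto
qed auto

text \<open>Half-open intervals turn the two cuts bounding an index set into the ends of its chord;
  the case a = b covers the empty set.\<close>

locale interval_family = commuting_chords "{1..Suc n}" F
  for n :: nat and F :: "nat \<Rightarrow> nat \<Rightarrow> 'a::cq_algebra" +
  fixes C :: "nat set \<Rightarrow> 'a"
  assumes C: "1 \<le> a \<Longrightarrow> a \<le> b \<Longrightarrow> b \<le> Suc n \<Longrightarrow> C {a..<b} = F a b"
begin

lemma pairC_eq:
  assumes "1 \<le> a" "a < b" "b < c" "c < d" "d \<le> Suc n"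
  shows "pairC C {a..<b} {c..<d} = Z a b c d" "pairC C {c..<d} {a..<b} = Z d c b a"
proof -
  show "pairC C {a..<b} {c..<d} = Z a b c d"
    using assms by (simp add: pairC_intervals C Z_def)
  show "pairC C {c..<d} {a..<b} = Z d c b a"
    using assms by (simp add: pairC_intervals C Z_def sym[of d b] sym[of c a] sym[of d c] sym[of b a] sym[of c b] sym[of d a])
qed

lemma triple_iff:
  assumes "1 \<le> a" "a < b" "b < c" "c < d" "d \<le> Suc n"
  shows "C ({a..<b} \<union> {b..<c}) = - qcomm (C ({b..<c} \<union> {c..<d})) (pairC C {a..<b} {c..<d})
      + C {a..<b} * C {b..<c} + C {c..<d} * C ({a..<b} \<union> {b..<c} \<union> {c..<d}) \<longleftrightarrow> quad_at F a b c d"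
    and "C ({c..<d} \<union> {b..<c}) = - qcomm (C ({b..<c} \<union> {a..<b})) (pairC C {c..<d} {a..<b})
      + C {c..<d} * C {b..<c} + C {a..<b} * C ({c..<d} \<union> {b..<c} \<union> {a..<b}) \<longleftrightarrow> quad_at F d c b a"
proof -
  have V: "{a, b, c, d} \<subseteq> {1..Suc n}" "{d, c, b, a} \<subseteq> {1..Suc n}" using assms by auto
  have un: "{a..<b} \<union> {b..<c} = {a..<c}" "{b..<c} \<union> {c..<d} = {b..<d}" "{a..<c} \<union> {c..<d} = {a..<d}"
    "{c..<d} \<union> {b..<c} = {b..<d}" "{b..<c} \<union> {a..<b} = {a..<c}" "{b..<d} \<union> {a..<b} = {a..<d}"
    using assms by auto
  show "C ({a..<b} \<union> {b..<c}) = - qcomm (C ({b..<c} \<union> {c..<d})) (pairC C {a..<b} {c..<d})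
      + C {a..<b} * C {b..<c} + C {c..<d} * C ({a..<b} \<union> {b..<c} \<union> {c..<d}) \<longleftrightarrow> quad_at F a b c d"
    unfolding quad_at_iff[OF V(1), symmetric] un pairC_eq[OF assms] using assms by (simp add: C)
  show "C ({c..<d} \<union> {b..<c}) = - qcomm (C ({b..<c} \<union> {a..<b})) (pairC C {c..<d} {a..<b})
      + C {c..<d} * C {b..<c} + C {a..<b} * C ({c..<d} \<union> {b..<c} \<union> {a..<b}) \<longleftrightarrow> quad_at F d c b a"
    unfolding quad_at_iff[OF V(2), symmetric] un pairC_eq[OF assms]
    using assms by (simp add: C sym[of d b] sym[of c a] sym[of d c] sym[of c b] sym[of b a] sym[of d a])
qed

lemma quadruple_iff:
  assumes "1 \<le> a" "a < b" "b < c" "c < d" "d < e" "e \<le> Suc n"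
  shows "pairC C {a..<b} {d..<e} = - qcomm (pairC C {a..<b} {c..<d}) (C ({c..<d} \<union> {d..<e}))
      + C {a..<b} * C {d..<e} + C {c..<d} * pairC C {a..<b} ({c..<d} \<union> {d..<e}) \<longleftrightarrow> pent_at F a b c d e"
    and "pairC C {d..<e} {a..<b} = - qcomm (pairC C {d..<e} {b..<c}) (C ({b..<c} \<union> {a..<b}))
      + C {d..<e} * C {a..<b} + C {b..<c} * pairC C {d..<e} ({b..<c} \<union> {a..<b}) \<longleftrightarrow> pent_at F e d c b a"
proof -
  have V: "{a, b, c, d, e} \<subseteq> {1..Suc n}" "{e, d, c, b, a} \<subseteq> {1..Suc n}" using assms by auto
  have dih: "dih5 a b c d e" using assms by (simp add: dih5_increasing)
  then have dih': "dih5 e d c b a" by (rule dih5_reverse)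
  have un: "{c..<d} \<union> {d..<e} = {c..<e}" "{b..<c} \<union> {a..<b} = {a..<c}"
    using assms by auto
  show "pairC C {a..<b} {d..<e} = - qcomm (pairC C {a..<b} {c..<d}) (C ({c..<d} \<union> {d..<e}))
      + C {a..<b} * C {d..<e} + C {c..<d} * pairC C {a..<b} ({c..<d} \<union> {d..<e}) \<longleftrightarrow> pent_at F a b c d e"
    unfolding pent_at_iff[OF V(1) dih, symmetric] un using assms by (simp add: C pairC_eq)
  show "pairC C {d..<e} {a..<b} = - qcomm (pairC C {d..<e} {b..<c}) (C ({b..<c} \<union> {a..<b}))
      + C {d..<e} * C {a..<b} + C {b..<c} * pairC C {d..<e} ({b..<c} \<union> {a..<b}) \<longleftrightarrow> pent_at F e d c b a"
    unfolding pent_at_iff[OF V(2) dih', symmetric] un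
    using assms by (simp add: C pairC_eq sym[of c a] sym[of e d] sym[of b a] sym[of c b])
qed

lemma chord_family_if_relations:
  assumes "aw_relations n C"
  shows "chord_family {1..Suc n} F"
proof -
  have two: "C (I1 \<union> I2) = - qcomm (C (I2 \<union> I3)) (pairC C I1 I3) + C I1 * C I2 + C I3 * C (I1 \<union> I2 \<union> I3)"
    if "monotonic_adjacent [I1, I2, I3]" "I1 \<union> I2 \<union> I3 \<subseteq> {1..n}" for I1 I2 I3
    using assms that unfolding aw_relations_def by blast
  have three: "pairC C I1 I4 = - qcomm (pairC C I1 I3) (C (I3 \<union> I4)) + C I1 * C I4 + C I3 * pairC C I1 (I3 \<union> I4)"
    if "monotonic_adjacent [I1, I2, I3, I4]" "I1 \<union> I2 \<union> I3 \<union> I4 \<subseteq> {1..n}" for I1 I2 I3 I4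
    using assms that unfolding aw_relations_def by blast
  show ?thesis
  proof (rule chord_familyI)
    fix a b c d assume *: "{a, b, c, d} \<subseteq> {1..Suc n}" "a < b" "b < c" "c < d"
    then have r: "1 \<le> a" "a < b" "b < c" "c < d" "d \<le> Suc n" by auto
    then have sub: "{a..<b} \<union> {b..<c} \<union> {c..<d} \<subseteq> {1..n}" "{c..<d} \<union> {b..<c} \<union> {a..<b} \<subseteq> {1..n}" by auto
    show "quad_at F a b c d"
      using triple_iff(1)[OF r] two[OF monotonic_adjacent3I(1)[OF *(2-4)] sub(1)] by blast
    \<comment> \<open>A decreasing triple reads the quadrilateral backwards; reflected, this is the
      relation with the other diagonal doubled.\<close>
    have q: "quad_at F d c b a"
      using triple_iff(2)[OF r] two[OF monotonic_adjacent3I(2)[OF *(2-4)] sub(2)] by blast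
    have dih: "dih4 d c b a" using dih4_increasing[OF *(2-4)] by (auto simp: dih4_def)
    have "{d, c, b, a} \<subseteq> {1..Suc n}" using *(1) by auto
    from quad_at_dihedral(3)[OF this dih q] show "quad_at F b c d a" .
  next
    fix a b c d e assume *: "{a, b, c, d, e} \<subseteq> {1..Suc n}" "a < b" "b < c" "c < d" "d < e"
    then have r: "1 \<le> a" "a < b" "b < c" "c < d" "d < e" "e \<le> Suc n" by auto
    then have sub: "{a..<b} \<union> {b..<c} \<union> {c..<d} \<union> {d..<e} \<subseteq> {1..n}" "{d..<e} \<union> {c..<d} \<union> {b..<c} \<union> {a..<b} \<subseteq> {1..n}" by auto
    show "pent_at F a b c d e"
      using quadruple_iff(1)[OF r] three[OF monotonic_adjacent4I(1)[OF *(2-5)] sub(1)] by blast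
    show "pent_at F e d c b a"
      using quadruple_iff(2)[OF r] three[OF monotonic_adjacent4I(2)[OF *(2-5)] sub(2)] by blast
  qed
qed

lemma relations_if_chord_family:
  assumes "chord_family {1..Suc n} F"
  shows "aw_relations n C"
proof -
  interpret chord_family "{1..Suc n}" F by (rule assms)
  have one: "C I * C J = C J * C I"
    if "conn I" "conn J" "I \<union> J \<subseteq> {1..n}" "I \<inter> J = {} \<or> I \<subseteq> J" for I J
  proof -
    obtain a b where I: "a < b" "I = {a..<b}" using \<open>conn I\<close> by (rule conn_intervalE)
    obtain c d where J: "c < d" "J = {c..<d}" using \<open>conn J\<close> by (rule conn_intervalE)
    have r: "1 \<le> a" "b \<le> Suc n" "1 \<le> c" "d \<le> Suc n"
      using that(3) interval_subset[OF I(1)] interval_subset[OF J(1)] I J by auto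
    have "\<not> dih4 a c b d"
    proof
      assume "dih4 a c b d"
      then consider "a < c" "c < b" "b < d" | "c < a" "a < d" "d < b"
        using crossing_iff[OF I(1) J(1)] by blast
      then show False
      proof cases
        case 1
        then have "c \<in> I" "c \<in> J" "a \<in> I" "a \<notin> J" using I J by auto
        then show False using that(4) by blast
      next
        case 2
        then have "a \<in> I" "a \<in> J" "b - 1 \<in> I" "b - 1 \<notin> J" using I J by auto
        then show False using that(4) by blast
      qed
    qed
    moreover have "{a, b, c, d} \<subseteq> {1..Suc n}" using r I J by auto
    ultimately have "commutes (F a b) (F c d)" by (intro comm)
    then show ?thesis using I J r by (simp add: C commutes_def)
  qed
  have two: "C (I1 \<union> I2) = - qcomm (C (I2 \<union> I3)) (pairC C I1 I3) + C I1 * C I2 + C I3 * C (I1 \<union> I2 \<union> I3)"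
    if m: "monotonic_adjacent [I1, I2, I3]" and sub: "I1 \<union> I2 \<union> I3 \<subseteq> {1..n}" for I1 I2 I3
    using m
  proof (cases rule: monotonic_adjacent3E)
    case (1 a b c d)
    then have r: "1 \<le> a" "d \<le> Suc n" using sub interval_subset[of a b n] interval_subset[of c d n] by auto
    have "quad_at F a b c d" using 1 r by (intro quad dih4_increasing) auto
    then show ?thesis unfolding 1 triple_iff(1)[OF r(1) 1(1-3) r(2)] .
  next
    case (2 a b c d)
    then have r: "1 \<le> a" "d \<le> Suc n" using sub interval_subset[of a b n] interval_subset[of c d n] by auto
    have "dih4 d c b a" using dih4_increasing[OF 2(1-3)] by (auto simp: dih4_def)
    then have "quad_at F d c b a" using 2(1-3) r by (intro quad) auto
    then show ?thesis unfolding 2 triple_iff(2)[OF r(1) 2(1-3) r(2)] .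
  qed
  have three: "pairC C I1 I4 = - qcomm (pairC C I1 I3) (C (I3 \<union> I4)) + C I1 * C I4 + C I3 * pairC C I1 (I3 \<union> I4)"
    if m: "monotonic_adjacent [I1, I2, I3, I4]" and sub: "I1 \<union> I2 \<union> I3 \<union> I4 \<subseteq> {1..n}" for I1 I2 I3 I4
    using m
  proof (cases rule: monotonic_adjacent4E)
    case (1 a b c d e)
    then have r: "1 \<le> a" "e \<le> Suc n" using sub interval_subset[of a b n] interval_subset[of d e n] by auto
    have "pent_at F a b c d e" using 1(1-4) r by (intro pent dih5_increasing) auto
    then show ?thesis unfolding 1 quadruple_iff(1)[OF r(1) 1(1-4) r(2)] .
  next
    case (2 a b c d e)
    then have r: "1 \<le> a" "e \<le> Suc n" using sub interval_subset[of a b n] interval_subset[of d e n] by auto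
    have "dih5 e d c b a" using dih5_increasing[OF 2(1-4)] by (rule dih5_reverse)
    then have "pent_at F e d c b a" using 2(1-4) r by (intro pent) auto
    then show ?thesis unfolding 2 quadruple_iff(2)[OF r(1) 2(1-4) r(2)] .
  qed
  have "C {} = 1" using C[of 1 1] by simp
  then show ?thesis unfolding aw_relations_def using one two three by blast
qed

end

definition chord :: "nat \<Rightarrow> nat \<Rightarrow> 'n::finite aw" where
  "chord x y = awC {min x y..<max x y}"

lemma awC_chords_commute:
  assumes V: "{x, y, z, w} \<subseteq> {1..Suc CARD('n::finite)}" and n: "\<not> dih4 x z y w"
  shows "awC {min x y..<max x y} * awC {min z w..<max z w}
    = (awC {min z w..<max z w} * awC {min x y..<max x y} :: 'n aw)"
proof (cases "x = y \<or> z = w")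
  case True
  then show ?thesis by (auto simp: awC_empty)
next
  case False
  define a b c d where "a = min x y" and "b = max x y" and "c = min z w" and "d = max z w"
  note abcd = this
  have lt: "a < b" "c < d" using False unfolding abcd by auto
  have "x = a \<and> y = b \<or> x = b \<and> y = a" "z = c \<and> w = d \<or> z = d \<and> w = c"
    unfolding abcd by (auto simp: min_def max_def)
  then have "\<not> dih4 a c b d"
    using n dih4_swap(1) dih4_reflect by blast
  then have cases: "b \<le> c \<or> d \<le> a \<or> c \<le> a \<and> b \<le> d \<or> a \<le> c \<and> d \<le> b"
    using crossing_iff[OF lt] by linarith
  have comm: "awC I * awC J = (awC J * awC I :: 'n aw)"
    if "conn I \<and> conn J \<and> I \<union> J \<subseteq> {1..CARD('n)} \<and> (I \<inter> J = {} \<or> I \<subseteq> J)" for I J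
    using aw_relations_awC that unfolding aw_relations_def by blast
  have cn: "conn {a..<b}" "conn {c..<d}" using lt by (simp_all add: conn_interval)
  have "1 \<le> a \<and> b \<le> Suc CARD('n)" "1 \<le> c \<and> d \<le> Suc CARD('n)" using V unfolding abcd by auto
  then have sub: "{a..<b} \<union> {c..<d} \<subseteq> {1..CARD('n)}" "{c..<d} \<union> {a..<b} \<subseteq> {1..CARD('n)}"
    using interval_subset[OF lt(1)] interval_subset[OF lt(2)] by blast+
  have "{a..<b} \<inter> {c..<d} = {} \<or> {a..<b} \<subseteq> {c..<d} \<or> {c..<d} \<subseteq> {a..<b}"
    using cases lt by (auto simp: ivl_disj_int)
  then have "awC {a..<b} * awC {c..<d} = (awC {c..<d} * awC {a..<b} :: 'n aw)"
    using comm[of "{a..<b}" "{c..<d}"] comm[of "{c..<d}" "{a..<b}"] cn sub by metis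
  then show ?thesis unfolding abcd .
qed

interpretation chord: interval_family "CARD('n::finite)" "chord :: nat \<Rightarrow> nat \<Rightarrow> 'n aw" awC
proof
  show "chord x y = (chord y x :: 'n aw)" for x y by (simp add: chord_def min.commute max.commute)
  show "chord x x = (1 :: 'n aw)" for x by (simp add: chord_def awC_empty)
  show "awC {a..<b} = (chord a b :: 'n aw)" if "a \<le> b" for a b using that by (simp add: chord_def)
  show "commutes (chord x y) (chord z w :: 'n aw)"
    if V: "{x, y, z, w} \<subseteq> {1..Suc CARD('n)}" and n: "\<not> dih4 x z y w" for x y z w
    using awC_chords_commute[OF V n] unfolding commutes_def chord_def .
qed

lemma neighbours_dih4: "cyc3 v s w \<Longrightarrow> cyc3 p v w \<Longrightarrow> dih4 p v s w"
  unfolding order_defs by (elim disjE conjE; simp)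

context vertex_move
begin

text \<open>The Askey--Wilson relation of p, v, s, w with \<open>F p s\<close> doubled, solved for
  \<open>F v w\<close>. Compared with \<open>h\<close>, the q-commutator is reversed and the two
  sides at \<open>v\<close> are exchanged.\<close>

lemma h_inverse:
  assumes "w \<in> V" "w \<noteq> v"
  shows "- qcomm (h w) (F p s) + F v s * F s w + F p v * F w p = F v w"
proof (cases "w = p \<or> w = s")
  case True
  have "commutes (F v s) (F p s)" "commutes (F p v) (F p s)"
    using edge_central vertices by auto
  then show ?thesis
    using True h_neighbour by (auto simp: qcomm_commutes sym[of s p] sym[of v p])
next
  case False
  then have "cyc3 v s w" "cyc3 p v w" using assms succ pred by auto
  then have "dih4 p v s w" by (rule neighbours_dih4)
  moreover have V: "{p, v, s, w} \<subseteq> V" using assms vertices by auto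
  ultimately have q: "qcomm (F p s) (qcomm (F v w) (F p s))
      = F v w + (F p v * F s w + F v s * F w p) * F p s - F v s * F s w - F p v * F w p"
    using quads(2) by blast
  have "commutes (F s w) (F p s)" "commutes (F w p) (F p s)" "commutes (F v s) (F p s)" "commutes (F p v) (F p s)"
    using V edge_central vertices by (auto intro!: comm)
  then show ?thesis
    unfolding h_def by (simp add: qcomm_linear qcomm_flip q qcomm_mult_left qcomm_commutes distrib_right mult.assoc)
qed

end

locale two_moves = chord_family +
  fixes v p s u p' s' :: nat and f g :: "'a \<Rightarrow> 'a"
  assumes move_v: "vertex_move V F v p s" and move_u: "vertex_move V F u p' s'"
    and hom_f: "alg_hom f" and hom_g: "alg_hom g"
    and f: "x \<in> V \<Longrightarrow> y \<in> V \<Longrightarrow> f (F x y) = vertex_move.G F v p s x y"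
    and g: "x \<in> V \<Longrightarrow> y \<in> V \<Longrightarrow> g (F x y) = vertex_move.G F u p' s' x y"
    and ne: "u \<noteq> v"
begin

sublocale v: vertex_move V F v p s by (rule move_v)
sublocale u: vertex_move V F u p' s' by (rule move_u)

lemmas hom_simps = alg_homD[OF hom_f] alg_homD[OF hom_g]

lemma f_simps:
  "x \<in> V \<Longrightarrow> y \<in> V \<Longrightarrow> x \<noteq> v \<Longrightarrow> y \<noteq> v \<Longrightarrow> f (F x y) = F x y"
  "y \<in> V \<Longrightarrow> y \<noteq> v \<Longrightarrow> f (F v y) = v.h y" "x \<in> V \<Longrightarrow> x \<noteq> v \<Longrightarrow> f (F x v) = v.h x"
  using f v.vertices by (simp_all add: v.G_def)

lemma g_simps:
  "x \<in> V \<Longrightarrow> y \<in> V \<Longrightarrow> x \<noteq> u \<Longrightarrow> y \<noteq> u \<Longrightarrow> g (F x y) = F x y"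
  "y \<in> V \<Longrightarrow> y \<noteq> u \<Longrightarrow> g (F u y) = u.h y" "x \<in> V \<Longrightarrow> x \<noteq> u \<Longrightarrow> g (F x u) = u.h x"
  using g u.vertices by (simp_all add: u.G_def)

lemma pairs_cases:
  assumes "x \<in> V" "y \<in> V"
    and fixed: "\<And>x y. x \<in> V \<Longrightarrow> y \<in> V \<Longrightarrow> x \<notin> {u, v} \<Longrightarrow> y \<notin> {u, v} \<Longrightarrow> P (F x y)"
    and v: "\<And>w. w \<in> V \<Longrightarrow> w \<notin> {u, v} \<Longrightarrow> P (F v w)" and u: "\<And>w. w \<in> V \<Longrightarrow> w \<notin> {u, v} \<Longrightarrow> P (F u w)"
    and uv: "P (F v u)" and one: "P 1"
  shows "P (F x y)"
proof -
  consider "x = y" | "x \<notin> {u, v}" "y \<notin> {u, v}" | "x = v" "y \<notin> {u, v}" | "x = u" "y \<notin> {u, v}"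
    | "y = v" "x \<notin> {u, v}" | "y = u" "x \<notin> {u, v}" | "x = v" "y = u" | "x = u" "y = v" by blast
  then show ?thesis
    using assms sym[of x v] sym[of x u] sym[of u v] by cases auto
qed

text \<open>Only the chord vu is affected by both moves. Its images are nested q-commutators with ps
  and p's' plus side terms, and ps commutes with p's'.\<close>

lemma moves_commute:
  assumes far: "u \<noteq> p" "u \<noteq> s" "v \<noteq> p'" "v \<noteq> s'" and xy: "x \<in> V" "y \<in> V"
  shows "f (g (F x y)) = g (f (F x y))"
  using xy
proof (rule pairs_cases)
  note vs = v.vertices u.vertices
  note simps = f_simps g_simps hom_simps v.h_def u.h_def vs far far[symmetric] ne ne[symmetric]
  show "f (g (F x y)) = g (f (F x y))" if "x \<in> V" "y \<in> V" "x \<notin> {u, v}" "y \<notin> {u, v}" for x y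
    using that by (simp add: simps)
  show "f (g (F v w)) = g (f (F v w))" if "w \<in> V" "w \<notin> {u, v}" for w
    using that by (simp add: simps)
  show "f (g (F u w)) = g (f (F u w))" if "w \<in> V" "w \<notin> {u, v}" for w
    using that by (simp add: simps)
  have X: "commutes (F p s) (F p' s')"
    using far vs by (intro v.inner_commutes) auto
  have E: "commutes (F p v) (F p' s')" "commutes (F v s) (F p' s')" "commutes (F p' u) (F p s)" "commutes (F u s') (F p s)"
    "F p v * F p' u = F p' u * F p v" "F v s * F p' u = F p' u * F v s"
    "F p v * F u s' = F u s' * F p v" "F v s * F u s' = F u s' * F v s"
    "F p v * (F p' u * z) = F p' u * (F p v * z)" "F v s * (F p' u * z) = F p' u * (F v s * z)"
    "F p v * (F u s' * z) = F u s' * (F p v * z)" "F v s * (F u s' * z) = F u s' * (F v s * z)" for z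
    using vs by (auto intro!: v.edge_central u.edge_central commutesD commutesD2)
  show "f (g (F v u)) = g (f (F v u))"
    using qcomm_left_swap[OF X, of "F v u"]
    by (simp add: simps qcomm_linear qcomm_mult_right E distrib_left right_diff_distrib
        sym[of u v] sym[of u s] sym[of s' v] sym[of s' s] sym[of s' p] sym[of p' p] sym[of p' s])
  show "f (g 1) = g (f 1)" by (simp add: hom_simps)
qed

end

text \<open>The vertices p, v, u, t are consecutive, so each moved vertex is a neighbour of the
  other.\<close>

locale adjacent_moves = two_moves V F v p u u v t f g
  for V :: "nat set" and F :: "nat \<Rightarrow> nat \<Rightarrow> 'a::cq_algebra" and v p u t :: nat and f g :: "'a \<Rightarrow> 'a"
begin

text \<open>Since \<open>g\<close> fixes vw, the claim for this chord is that \<open>f\<close> fixes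
  \<open>g (v.h w)\<close>. The pentagon relation identifies \<open>g (v.h w)\<close> with a two-set
  element on t, u, p, w, which does not involve \<open>v\<close>. The chord uw is treated
  symmetrically.\<close>

lemma braid:
  assumes adj: "p \<noteq> u" "t \<noteq> v" and xy: "x \<in> V" "y \<in> V"
  shows "f (g (f (F x y))) = g (f (g (F x y)))"
  using xy
proof (rule pairs_cases)
  note vs = v.vertices u.vertices
  note ne' = adj adj[symmetric] ne ne[symmetric]
  note simps = f_simps g_simps hom_simps vs ne'
  note vh = v.h_neighbour and uh = u.h_neighbour
  show "f (g (f (F x y))) = g (f (g (F x y)))" if "x \<in> V" "y \<in> V" "x \<notin> {u, v}" "y \<notin> {u, v}" for x y
    using that by (simp add: simps)
  show "f (g (f (F v u))) = g (f (g (F v u)))"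
    by (simp add: simps vh uh sym[of t u])
  have gh: "g (v.h w) = - qcomm (u.h p) (F v w) + F p v * u.h w + F u t * F w p"
    if "w \<in> V" "w \<notin> {u, v}" for w
    using that uh unfolding v.h_def by (simp add: simps)
  have fh: "f (u.h w) = - qcomm (v.h t) (F u w) + F p v * F t w + F u t * v.h w"
    if "w \<in> V" "w \<notin> {u, v}" for w
    using that vh unfolding u.h_def by (simp add: simps)
  have central: "commutes (F p v) (F x y)" "commutes (F u t) (F x y)" "commutes (F v u) (F x y)" if "x \<in> V" "y \<in> V" for x y
    using v.edge_central[OF that] u.edge_central[OF that] by blast+
  have dih5: "dih5 t u v p w" if "w \<in> V" "w \<notin> {u, v}" "w \<noteq> p" "w \<noteq> t" for w
  proof -
    have "cyc3 p v w" "cyc3 v u w" "cyc3 u t w"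
      using that v.pred v.succ u.succ by auto
    then have "cyc5 w p v u t" unfolding cyc5_def cyc3_def by blast
    then show ?thesis by (simp add: dih5_def)
  qed
  show "f (g (f (F v w))) = g (f (g (F v w)))" if w: "w \<in> V" "w \<notin> {u, v}" for w
  proof -
    have fixed: "f (g (v.h w)) = g (v.h w)"
    proof (cases "w = p")
      case True
      then show ?thesis by (simp add: vh uh simps)
    next
      case False
      note wp = this
      show ?thesis
      proof (cases "w = t")
        case True
        \<comment> \<open>For w = t there is no pentagon; the inversion formula at \<open>u\<close>
          takes its place.\<close>
        have "g (v.h w) = F u p"
          using u.h_inverse[of p] vs adj(1) commutesD[OF central(1)[of v u]]
          unfolding gh[OF w] unfolding True uh
          by (simp add: sym[of p t] algebra_simps)
        then show ?thesis using vs adj by (simp add: simps)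
      next
        case False
        then have dih: "dih5 t u v p w" using dih5[OF w wp] by blast
        have V: "{t, u, v, p, w} \<subseteq> V" using vs w by auto
        \<comment> \<open>In its two-set form the pentagon relation has the right side of
          \<open>gh\<close>.\<close>
        have "Z t u p w = - qcomm (Z t u v p) (F v w) + F t u * F p w + F v p * Z t u v w"
          by (rule iffD2[OF pent_at_iff[OF V dih] pent[OF V dih]])
        moreover have "Z t u v w = u.h w" "Z t u v p = u.h p"
          unfolding Z_def u.h_def
          by (simp_all add: sym[of t v] sym[of t u] sym[of u v] sym[of w v] sym[of p v])
        ultimately have "g (v.h w) = Z t u p w"
          unfolding gh[OF w] by (simp add: sym[of t u] sym[of v p] sym[of w p])
        moreover have "f (Z t u p w) = Z t u p w"
          using w vs unfolding Z_def by (simp add: simps)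
        ultimately show ?thesis by simp
      qed
    qed
    then show ?thesis using w by (simp add: simps)
  qed
  show "f (g (f (F u w))) = g (f (g (F u w)))" if w: "w \<in> V" "w \<notin> {u, v}" for w
  proof -
    have fixed: "g (f (u.h w)) = f (u.h w)"
    proof (cases "w = t")
      case True
      then show ?thesis by (simp add: vh uh simps)
    next
      case False
      note ws = this
      show ?thesis
      proof (cases "w = p")
        case True
        have "f (u.h w) = F v t"
          using v.h_inverse[of t] vs adj(2) commutesD[OF central(2)[of v u]]
          unfolding fh[OF w] unfolding True vh sym[of u p]
          by (simp add: algebra_simps)
        then show ?thesis using vs adj by (simp add: simps)
      next
        case False
        then have "dih5 t u v p w" using dih5[OF w] ws by blast
        then have dih: "dih5 p v u t w" by (rule dih5_rotate[OF dih5_reverse])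
        have V: "{p, v, u, t, w} \<subseteq> V" using vs w by auto
        have "Z p v t w = - qcomm (Z p v u t) (F u w) + F p v * F t w + F u t * Z p v u w"
          by (rule iffD2[OF pent_at_iff[OF V dih] pent[OF V dih]])
        moreover have "Z p v u w = v.h w" "Z p v u t = v.h t"
          unfolding Z_def v.h_def by (simp_all add: sym[of w p] sym[of t p])
        ultimately have "f (u.h w) = Z p v t w"
          unfolding fh[OF w] by simp
        moreover have "g (Z p v t w) = Z p v t w"
          using w vs adj unfolding Z_def by (simp add: simps)
        ultimately show ?thesis by simp
      qed
    qed
    then show ?thesis using w by (simp add: simps)
  qed
  show "f (g (f 1)) = g (f (g 1))" by (simp add: hom_simps)
qed

end

section \<open>The opposite algebra and homomorphisms defined by chord families\<close>

typedef 'a op = "UNIV :: 'a set" morphisms unop op ..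

setup_lifting type_definition_op

instantiation op :: (cq_algebra) cq_algebra
begin
lift_definition zero_op :: "'a op" is 0 .
lift_definition one_op :: "'a op" is 1 .
lift_definition plus_op :: "'a op \<Rightarrow> 'a op \<Rightarrow> 'a op" is "(+)" .
lift_definition minus_op :: "'a op \<Rightarrow> 'a op \<Rightarrow> 'a op" is "(-)" .
lift_definition uminus_op :: "'a op \<Rightarrow> 'a op" is uminus .
lift_definition times_op :: "'a op \<Rightarrow> 'a op \<Rightarrow> 'a op" is "\<lambda>x y. y * x" .
lift_definition scale_cq_op :: "cq \<Rightarrow> 'a op \<Rightarrow> 'a op" is scale_cq .
instance
  by (standard; transfer)
    (simp_all add: algebra_simps scale_cq_add_left scale_cq_add_right scale_cq_scale_cq scale_cq_one
      mult_scale_cq_left mult_scale_cq_right)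
end

lemma op_simps:
  "op (x + y) = op x + op y" "op (x - y) = op x - op y" "op (- x) = - op x" "op 1 = 1"
  "op (x * y) = op y * op x" "op (c *\<^sub>q x) = c *\<^sub>q op x" "op (qcomm x y) = qcomm (op y) (op x)"
proof -
  show *: "op (x + y) = op x + op y" "op (x - y) = op x - op y" "op (- x) = - op x" "op 1 = 1"
    "op (x * y) = op y * op x" "op (c *\<^sub>q x) = c *\<^sub>q op x" for x y c
    by (simp_all add: plus_op.abs_eq minus_op.abs_eq uminus_op.abs_eq one_op.abs_eq times_op.abs_eq scale_cq_op.abs_eq)
  show "op (qcomm x y) = qcomm (op y) (op x)"
    by (simp add: qcomm_eq *)
qed

lemma alg_antihom_iff: "alg_antihom f \<longleftrightarrow> alg_hom (\<lambda>x. op (f x))"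
  unfolding alg_antihom_def alg_hom_def op_simps(1,4,5,6)[symmetric]
  by (simp add: op_inject)

text \<open>The opposite product reverses q-commutators. The double q-commutator of a quadrilateral
  is unaffected by \<open>qcomm_flip\<close>, and the reversed pentagon relation is the reflected
  one.\<close>

lemma (in chord_family) chord_family_op: "chord_family V (\<lambda>x y. op (F x y))"
proof -
  interpret op: commuting_chords V "\<lambda>x y. op (F x y)"
  proof
    show "op (F x y) = op (F y x)" "op (F x x) = 1" for x y
      by (simp_all add: sym[of x y] op_simps(4))
    show "commutes (op (F x y)) (op (F z w))" if "{x, y, z, w} \<subseteq> V" "\<not> dih4 x z y w" for x y z w
      using comm[OF that] by (simp add: commutes_def op_simps(5)[symmetric])
  qed
  show ?thesis
  proof
    fix a b c d assume V: "{a, b, c, d} \<subseteq> V" and dih: "dih4 a b c d"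
    have "commutes (F a b) (F b d)" "commutes (F c d) (F b d)" "commutes (F b c) (F b d)" "commutes (F d a) (F b d)"
      "commutes (F a b) (F b c)" "commutes (F c d) (F d a)"
      using V by (auto intro!: comm)
    note cs = this
    have "op (qcomm (F b d) (qcomm (F a c) (F b d)))
        = op (F a c + (F a b * F c d + F b c * F d a) * F b d - F a b * F b c - F c d * F d a)"
      using quads(1)[OF V dih] by simp
    also have "F a c + (F a b * F c d + F b c * F d a) * F b d - F a b * F b c - F c d * F d a
       = F a c + F b d * (F c d * F a b + F d a * F b c) - F b c * F a b - F d a * F c d"
      unfolding commute_disjoint[OF V dih]
      using cs by (simp add: commutesD[OF cs(5)] commutesD[OF cs(6)] commutesD2[OF cs(1)] commutesD2[OF cs(3)]
          commutesD[OF cs(2)] commutesD[OF cs(4)] distrib_right distrib_left mult.assoc)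
    finally show "quad_at (\<lambda>x y. op (F x y)) a b c d"
      unfolding quad_at_def by (simp add: op_simps qcomm_flip)
  next
    fix a b c d e assume V: "{a, b, c, d, e} \<subseteq> V" and dih: "dih5 a b c d e"
    interpret P: pentagon "F a b" "F b c" "F c d" "F d e" "F e a" "F a c" "F b d" "F c e" "F d a" "F e b"
      using dih V by (rule pentagon)
    have "op (qcomm (F c e) (qcomm (F b d) (F a c))) = op (- qcomm (F e b) (F d a) + F b d * F e a + qcomm (F c e) (F d a) * F b c
       + qcomm (F e b) (F a c) * F c d - F e a * F c d * F b c)"
      using pent_reversed[OF dih V] qcomm_assoc[OF P.diagonals(1)[THEN commutes_sym], of "F b d"]
      by (simp add: P.norm qcomm_mult_commute)
    then show "pent_at (\<lambda>x y. op (F x y)) a b c d e"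
      unfolding pent_at_def by (simp add: op_simps)
  qed
qed

lemma family_hom:
  fixes F :: "nat \<Rightarrow> nat \<Rightarrow> 'b::cq_algebra"
  assumes "chord_family {1..Suc CARD('n::finite)} F"
  obtains f :: "'n::finite aw \<Rightarrow> 'b" where "alg_hom f"
    "\<And>x y. x \<in> {1..Suc CARD('n::finite)} \<Longrightarrow> y \<in> {1..Suc CARD('n::finite)} \<Longrightarrow> f (chord x y) = F x y"
proof -
  interpret chord_family "{1..Suc CARD('n::finite)}" F by (rule assms)
  \<comment> \<open>The chord of \<open>{j..k}\<close> ends at the cut after \<open>k\<close>, hence
    the successor of the maximum.\<close>
  define gen where "gen a = F (Min (Rep_conn a)) (Suc (Max (Rep_conn a)))" for a :: "'n conn"
  note hom = free_eval_hom[of gen]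
  have val: "free_eval gen (freeC {a..<b}) = F a b" if "1 \<le> a" "a \<le> b" "b \<le> Suc CARD('n)" for a b
  proof (cases "a = b")
    case True
    then show ?thesis by (simp add: freeC_def alg_homD[OF hom])
  next
    case False
    then have ab: "a < b" using that by simp
    then have "conn {a..<b} \<and> {a..<b} \<subseteq> {1..CARD('n)}"
      using conn_interval interval_subset that by simp
    then have "Rep_conn (Abs_conn {a..<b} :: 'n conn) = {a..<b}"
      by (intro Abs_conn_inverse) simp
    moreover have "Min {a..<b} = a" "Suc (Max {a..<b}) = b"
    proof -
      show "Min {a..<b} = a" using ab by (intro Min_eqI) auto
      have "Max {a..<b} = b - 1" using ab by (intro Max_eqI) auto
      then show "Suc (Max {a..<b}) = b" using ab by simp
    qed
    ultimately show ?thesis using ab by (simp add: freeC_def free_eval_fgen gen_def)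
  qed
  interpret interval_family "CARD('n)" F "\<lambda>I. free_eval gen (freeC I)"
    by unfold_locales (rule val)
  obtain f :: "'n aw \<Rightarrow> 'b" where f: "alg_hom f" "\<And>I. f (awC I) = free_eval gen (freeC I)"
    using aw_lift[OF hom relations_if_chord_family[OF assms]] by blast
  show ?thesis
  proof (rule that[OF f(1)])
    fix x y assume "x \<in> {1..Suc CARD('n::finite)}" "y \<in> {1..Suc CARD('n::finite)}"
    then show "f (chord x y) = F x y"
      unfolding chord_def f(2) using val sym[of x y] by (cases "x \<le> y") (auto simp: min_def max_def)
  qed
qed

subsection \<open>The braid group action\<close>

interpretation chord: chord_family "{1..Suc CARD('n::finite)}" "chord :: nat \<Rightarrow> nat \<Rightarrow> 'n aw"
  by (rule chord.chord_family_if_relations[OF aw_relations_awC])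

lemma awC_eq_chord: "j \<le> k \<Longrightarrow> awC {j..k} = chord j (Suc k)"
  by (simp add: chord_def atLeastLessThanSuc_atLeastAtMost)

lemma alg_hom_chord_eqI:
  fixes f g :: "'n::finite aw \<Rightarrow> 'b::cq_algebra"
  assumes "alg_hom f" "alg_hom g"
    and "\<And>x y. x \<in> {1..Suc CARD('n)} \<Longrightarrow> y \<in> {1..Suc CARD('n)} \<Longrightarrow> f (chord x y) = g (chord x y)"
  shows "f = g"
  using assms by (intro alg_hom_aw_eqI) (simp_all add: awC_eq_chord)

text \<open>Anti-homomorphisms are homomorphisms into the opposite algebra:
  \<open>chord_family_op\<close> gives existence, agreement on generators gives uniqueness, and
  involutivity gives bijectivity.\<close>

lemma aw_up_properties:
  "alg_antihom (aw_up :: 'n::finite aw \<Rightarrow> 'n aw)"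
  "x \<in> {1..Suc CARD('n)} \<Longrightarrow> y \<in> {1..Suc CARD('n)} \<Longrightarrow> aw_up (chord x y) = (chord x y :: 'n aw)"
  "aw_up (aw_up z) = (z :: 'n aw)"
proof -
  obtain f :: "'n aw \<Rightarrow> 'n aw op" where f: "alg_hom f"
    "\<And>x y. x \<in> {1..Suc CARD('n)} \<Longrightarrow> y \<in> {1..Suc CARD('n)} \<Longrightarrow> f (chord x y) = op (chord x y)"
    using family_hom[OF chord.chord_family_op] by blast
  define up where "up = unop \<circ> f"
  have op_up: "(\<lambda>x. op (up x)) = f" by (simp add: up_def unop_inverse)
  have anti: "alg_antihom up" unfolding alg_antihom_iff op_up by (rule f)
  have gens: "up (chord x y) = chord x y" if "x \<in> {1..Suc CARD('n)}" "y \<in> {1..Suc CARD('n)}" for x y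
    using that by (simp add: up_def f(2) op_inverse)
  have "alg_hom (up \<circ> up)" using anti by (simp add: alg_hom_def alg_antihom_def)
  then have "up \<circ> up = id" using alg_hom_id by (rule alg_hom_chord_eqI) (simp add: gens)
  then have invol: "up (up z) = z" for z by (simp add: fun_eq_iff)
  have "bij up" by (rule involuntory_imp_bij) (rule invol)
  have "aw_up = up"
    unfolding aw_up_def
  proof (rule the_equality)
    have "up (awC I) = awC I" if "conn I" "I \<subseteq> {1..CARD('n)}" for I
    proof -
      obtain a b where ab: "a < b" "I = {a..<b}" using \<open>conn I\<close> by (rule conn_intervalE)
      then have "1 \<le> a" "b \<le> Suc CARD('n)" using that(2) interval_subset[OF ab(1)] by auto
      then show ?thesis using gens[of a b] ab by (simp add: chord_def)
    qed
    then show "alg_antiautomorphism up \<and> (\<forall>I. conn I \<and> I \<subseteq> {1..CARD('n)} \<longrightarrow> up (awC I) = awC I)"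
      using anti \<open>bij up\<close> by (simp add: alg_antiautomorphism_def)
    fix g :: "'n aw \<Rightarrow> 'n aw"
    assume g: "alg_antiautomorphism g \<and> (\<forall>I. conn I \<and> I \<subseteq> {1..CARD('n)} \<longrightarrow> g (awC I) = awC I)"
    then have "alg_hom (\<lambda>x. op (g x))" by (simp add: alg_antiautomorphism_def alg_antihom_iff)
    then have "(\<lambda>x. op (g x)) = f"
    proof (rule alg_hom_aw_eqI[OF _ f(1)])
      fix j k assume jk: "1 \<le> j" "j \<le> k" "k \<le> CARD('n)"
      then have "conn {j..k} \<and> {j..k} \<subseteq> {1..CARD('n)}" by (auto simp: conn_def)
      then have "g (awC {j..k}) = awC {j..k}" using g by blast
      then show "op (g (awC {j..k})) = f (awC {j..k})" using jk f(2) by (simp add: awC_eq_chord)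
    qed
    then show "g = up" by (auto simp: up_def op_inverse)
  qed
  then show "alg_antihom (aw_up :: 'n aw \<Rightarrow> 'n aw)"
    "x \<in> {1..Suc CARD('n)} \<Longrightarrow> y \<in> {1..Suc CARD('n)} \<Longrightarrow> aw_up (chord x y) = (chord x y :: 'n aw)"
    "aw_up (aw_up z) = (z :: 'n aw)"
    using anti gens invol by simp_all
qed

lemma alg_antihomD:
  assumes "alg_antihom f"
  shows "f 1 = 1" "f (x + y) = f x + f y" "f (x * y) = f y * f x" "f (- x) = - f x" "f (qcomm x y) = qcomm (f y) (f x)"
  using alg_homD[OF assms[unfolded alg_antihom_iff]] assms
  by (simp_all add: alg_antihom_def op_simps[symmetric] op_inject)

lemmas aw_up_antihom = aw_up_properties(1)
lemmas aw_up_chord = aw_up_properties(2)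
lemmas aw_up_involution [simp] = aw_up_properties(3)

text \<open>The generator with index \<open>a\<close> moves the vertex \<open>a + 1\<close>; its neighbours are \<open>a + 2\<close> and \<open>a\<close>,
  where the vertex \<open>0\<close> is represented by \<open>CARD('n) + 1\<close>.\<close>

definition pred_vertex :: "nat \<Rightarrow> nat \<Rightarrow> nat" where
  "pred_vertex n a = (if a = 0 then Suc n else a)"

lemma vertex_move_chord:
  assumes "a < CARD('n::finite)"
  shows "vertex_move {1..Suc CARD('n)} (chord :: nat \<Rightarrow> nat \<Rightarrow> 'n aw) (Suc a) (pred_vertex CARD('n) a) (Suc (Suc a))"
proof
  fix y assume "y \<in> {1..Suc CARD('n)}" "y \<noteq> Suc a" "y \<noteq> Suc (Suc a)"
  then show "cyc3 (Suc a) (Suc (Suc a)) y" by (auto simp: cyc3_def)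
next
  fix y assume "y \<in> {1..Suc CARD('n)}" "y \<noteq> Suc a" "y \<noteq> pred_vertex CARD('n) a"
  then show "cyc3 (pred_vertex CARD('n) a) (Suc a) y" using assms by (auto simp: cyc3_def pred_vertex_def split: if_splits)
qed (use assms in \<open>auto simp: pred_vertex_def\<close>)

abbreviation moved :: "nat \<Rightarrow> nat \<Rightarrow> nat \<Rightarrow> 'n::finite aw" where
  "moved a \<equiv> vertex_move.G chord (Suc a) (pred_vertex CARD('n) a) (Suc (Suc a))"

text \<open>The moved vertex 1 has the neighbours n + 1 and 2. The cases k = n and k = 1 are
  separate because \<open>{k+1..n}\<close> is then empty or adjacent to \<open>{1}\<close>, so that
  \<open>pairC\<close> is a single generator.\<close>

lemma r_gen_eq_moved_0:
  assumes jk: "1 \<le> j" "j \<le> k" "k \<le> CARD('n::finite)"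
  shows "r_gen 0 j k = (vertex_move.G chord (Suc 0) (Suc CARD('n)) (Suc (Suc 0)) j (Suc k) :: 'n aw)"
proof -
  note csym = chord.sym[where 'n = 'n]
  interpret m: vertex_move "{1..Suc CARD('n)}" "chord :: nat \<Rightarrow> nat \<Rightarrow> 'n aw" "Suc 0" "Suc CARD('n)" "Suc (Suc 0)"
    using vertex_move_chord[of 0, where 'n = 'n] jk by (simp add: pred_vertex_def)
  show ?thesis
  proof (cases "j = 1")
    case False
    then show ?thesis using jk by (simp add: r_gen_def m.G_simps awC_eq_chord)
  next
    case j1: True
    have G: "m.G j (Suc k) = m.h (Suc k)"
      using j1 jk by (simp add: m.G_simps)
    have r: "r_gen 0 j k = (pairC awC {k+1..CARD('n)} {1} :: 'n aw)"
      using j1 by (simp add: r_gen_def)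
    consider "k = CARD('n)" | "k = 1" "k < CARD('n)" | "2 \<le> k" "k < CARD('n)" using jk j1 by linarith
    then show ?thesis
    proof cases
      case 1
      have "awC {Suc 0} = (chord (Suc 0) (Suc (Suc 0)) :: 'n aw)" using awC_eq_chord[of 1 1] by simp
      then show ?thesis
        unfolding r G using 1 m.h_neighbour(1) by (simp add: pairC_def)
    next
      case 2
      have "adjacent {2..CARD('n)} {1}"
        using adjacent_intervals(2)[of 1 2 "Suc CARD('n)"] 2 by (simp add: atLeastLessThanSuc_atLeastAtMost numeral_2_eq_2)
      moreover have "{2..CARD('n)} \<union> {1} = {1..CARD('n)}" using 2 by auto
      ultimately have "r_gen 0 j k = (awC {1..CARD('n)} :: 'n aw)"
        unfolding r using 2 by (simp add: pairC_def numeral_2_eq_2)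
      also have "\<dots> = m.h (Suc k)"
        using 2 m.h_neighbour(2) csym[of "Suc 0" "Suc CARD('n)"] by (simp add: awC_eq_chord)
      finally show ?thesis unfolding G .
    next
      case 3
      have "pairC awC {k+1..CARD('n)} {1} = (chord.Z (Suc CARD('n)) (Suc k) (Suc (Suc 0)) (Suc 0) :: 'n aw)"
        using chord.pairC_eq(2)[of 1 2 "Suc k" "Suc CARD('n)", where 'n = 'n] 3
        by (simp add: atLeastLessThanSuc_atLeastAtMost numeral_2_eq_2)
      also have "\<dots> = m.h (Suc k)"
      proof -
        \<comment> \<open>The side factors occur in the opposite order in \<open>Z\<close> and in
          \<open>h\<close>; sides are central.\<close>
        have "commutes (chord (Suc 0) (Suc (Suc 0))) (chord (Suc CARD('n)) (Suc k) :: 'n aw)"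
          "commutes (chord (Suc CARD('n)) (Suc 0)) (chord (Suc (Suc 0)) (Suc k) :: 'n aw)"
          using m.edge_central[of "Suc CARD('n)" "Suc k"] m.edge_central[of "Suc (Suc 0)" "Suc k"] 3
          by simp_all
        then show ?thesis
          unfolding m.h_def chord.Z_def
          using csym[of "Suc k" "Suc 0"] csym[of "Suc k" "Suc (Suc 0)"] csym[of "Suc (Suc 0)" "Suc 0"]
            csym[of "Suc k" "Suc CARD('n)"]
          by (simp add: commutes_def)
      qed
      finally show ?thesis unfolding r G .
    qed
  qed
qed

lemma r_gen_eq_moved_pos:
  assumes a: "1 \<le> a" "a < CARD('n::finite)" and jk: "1 \<le> j" "j \<le> k" "k \<le> CARD('n)"
  shows "r_gen a j k = (vertex_move.G chord (Suc a) a (Suc (Suc a)) j (Suc k) :: 'n aw)"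
proof -
  note csym = chord.sym[where 'n = 'n]
  interpret m: vertex_move "{1..Suc CARD('n)}" "chord :: nat \<Rightarrow> nat \<Rightarrow> 'n aw" "Suc a" a "Suc (Suc a)"
    using vertex_move_chord[of a, where 'n = 'n] a by (simp add: pred_vertex_def)
  consider "j = a + 1" | "k = a" "j \<noteq> a + 1" | "j \<noteq> a + 1" "k \<noteq> a" by blast
  then show ?thesis
  proof cases
    case 1
    have G: "m.G j (Suc k) = m.h (Suc k)"
      using 1 jk by (simp add: m.G_simps)
    have r: "r_gen a j k = (pairC awC {a} {a+2..k} :: 'n aw)"
      using a 1 by (simp add: r_gen_def)
    show ?thesis
    proof (cases "k = a + 1")
      case True
      have "awC {a} = (chord a (Suc a) :: 'n aw)" using awC_eq_chord[of a a] by simp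
      then show ?thesis
        unfolding r G using True m.h_neighbour(2) by (simp add: pairC_def)
    next
      case False
      then have "pairC awC {a} {a+2..k} = (chord.Z a (Suc a) (Suc (Suc a)) (Suc k) :: 'n aw)"
        using chord.pairC_eq(1)[of a "Suc a" "Suc (Suc a)" "Suc k", where 'n = 'n] 1 a jk
        by (simp add: atLeastLessThanSuc_atLeastAtMost)
      then show ?thesis
        unfolding r G m.h_def chord.Z_def using csym[of "Suc k" a] by simp
    qed
  next
    case 2
    have G: "m.G j (Suc k) = m.h j"
      using 2 jk by (simp add: m.G_simps)
    have r: "r_gen a j k = (pairC awC {a+1} {j..a-1} :: 'n aw)"
      using a 2 by (simp add: r_gen_def)
    show ?thesis
    proof (cases "j = a")
      case True
      have "awC {Suc a} = (chord (Suc a) (Suc (Suc a)) :: 'n aw)" using awC_eq_chord[of "Suc a" "Suc a"] by simp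
      then show ?thesis
        unfolding r G using True m.h_neighbour(1) a by (simp add: pairC_def)
    next
      case False
      then have ja: "j < a" using 2 jk by simp
      have "{j..a-1} = {j..<a}" using ja by auto
      then have "pairC awC {a+1} {j..a-1} = (chord.Z (Suc (Suc a)) (Suc a) a j :: 'n aw)"
        using chord.pairC_eq(2)[of j a "Suc a" "Suc (Suc a)", where 'n = 'n] ja jk a 2
        by (simp add: atLeastLessThanSuc_atLeastAtMost)
      then show ?thesis
        unfolding r G m.h_def chord.Z_def
        using csym[of "Suc (Suc a)" a] csym[of "Suc (Suc a)" "Suc a"] csym[of "Suc a" a] csym[of j a]
        by simp
    qed
  next
    case 3
    then show ?thesis using a jk by (simp add: r_gen_def m.G_simps awC_eq_chord)
  qed
qed

lemma r_gen_eq_moved: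
  assumes "a < CARD('n::finite)" "1 \<le> j" "j \<le> k" "k \<le> CARD('n)"
  shows "r_gen a j k = (moved a j (Suc k) :: 'n aw)"
  using r_gen_eq_moved_0[OF assms(2-4)] r_gen_eq_moved_pos[OF _ assms] by (cases "a = 0") (simp_all add: pred_vertex_def)

lemma r_hom_exists:
  assumes a: "a < CARD('n::finite)"
  obtains f :: "'n::finite aw \<Rightarrow> 'n aw" where "alg_hom f"
    "\<And>x y. x \<in> {1..Suc CARD('n)} \<Longrightarrow> y \<in> {1..Suc CARD('n)} \<Longrightarrow> f (chord x y) = moved a x y"
proof -
  interpret m: vertex_move "{1..Suc CARD('n)}" "chord :: nat \<Rightarrow> nat \<Rightarrow> 'n aw" "Suc a" "pred_vertex CARD('n) a" "Suc (Suc a)"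
    using a by (rule vertex_move_chord)
  show ?thesis using family_hom[OF m.G.chord_family_axioms] that by blast
qed

lemma gens_ext_unique:
  fixes \<phi> :: "nat \<Rightarrow> nat \<Rightarrow> 'n::finite aw"
  assumes f: "extends_gens \<phi> f"
  shows "well_defined_ext \<phi>" "gens_ext \<phi> = f"
proof -
  have unique: "g = f" if "extends_gens \<phi> g" for g
    using that f unfolding extends_gens_def by (intro alg_hom_aw_eqI) auto
  show "well_defined_ext \<phi>" unfolding well_defined_ext_def using f unique by blast
  show "gens_ext \<phi> = f" unfolding gens_ext_def using f unique by (rule the_equality)
qed

lemma r_map_properties:
  assumes a: "a < CARD('n::finite)"
  shows "well_defined_ext (r_gen a :: nat \<Rightarrow> nat \<Rightarrow> 'n aw)"
    and "alg_hom (r_map a :: 'n aw \<Rightarrow> 'n aw)"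
    and "x \<in> {1..Suc CARD('n)} \<Longrightarrow> y \<in> {1..Suc CARD('n)} \<Longrightarrow> r_map a (chord x y) = (moved a x y :: 'n aw)"
proof -
  obtain f :: "'n aw \<Rightarrow> 'n aw" where f: "alg_hom f"
    "\<And>x y. x \<in> {1..Suc CARD('n)} \<Longrightarrow> y \<in> {1..Suc CARD('n)} \<Longrightarrow> f (chord x y) = moved a x y"
    using r_hom_exists[OF a] by blast
  have "extends_gens (r_gen a) f"
    unfolding extends_gens_def using f by (simp add: awC_eq_chord r_gen_eq_moved[OF a])
  from gens_ext_unique[OF this] f
  show "well_defined_ext (r_gen a :: nat \<Rightarrow> nat \<Rightarrow> 'n aw)" "alg_hom (r_map a :: 'n aw \<Rightarrow> 'n aw)"
    "x \<in> {1..Suc CARD('n)} \<Longrightarrow> y \<in> {1..Suc CARD('n)} \<Longrightarrow> r_map a (chord x y) = (moved a x y :: 'n aw)"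
    unfolding r_map_def by simp_all
qed

lemma rbar_map_properties:
  assumes a: "a < CARD('n::finite)"
  shows "well_defined_ext (rbar_gen a :: nat \<Rightarrow> nat \<Rightarrow> 'n aw)"
    and "rbar_map a = (aw_up \<circ> r_map a \<circ> aw_up :: 'n aw \<Rightarrow> 'n aw)"
    and "alg_hom (rbar_map a :: 'n aw \<Rightarrow> 'n aw)"
proof -
  let ?f = "aw_up \<circ> r_map a \<circ> aw_up :: 'n aw \<Rightarrow> 'n aw"
  have hom: "alg_hom ?f"
    using r_map_properties(2)[OF a] aw_up_antihom[where 'n = 'n] by (simp add: alg_hom_def alg_antihom_def)
  moreover have "?f (awC {j..k}) = rbar_gen a j k" if "1 \<le> j" "j \<le> k" "k \<le> CARD('n)" for j k
    using that by (simp add: awC_eq_chord aw_up_chord r_map_properties(3)[OF a] rbar_gen_def r_gen_eq_moved[OF a])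
  ultimately have "extends_gens (rbar_gen a) ?f" by (simp add: extends_gens_def)
  from gens_ext_unique[OF this] hom
  show "well_defined_ext (rbar_gen a :: nat \<Rightarrow> nat \<Rightarrow> 'n aw)"
    "rbar_map a = ?f" "alg_hom (rbar_map a :: 'n aw \<Rightarrow> 'n aw)"
    by (simp_all add: rbar_map_def)
qed

text \<open>One composition is \<open>h_inverse\<close>; conjugation with the involution
  \<open>aw_up\<close> turns it into the other.\<close>

lemma r_rbar:
  assumes a: "a < CARD('n::finite)"
  shows "r_map a \<circ> rbar_map a = (id :: 'n aw \<Rightarrow> 'n aw)" "rbar_map a \<circ> r_map a = (id :: 'n aw \<Rightarrow> 'n aw)"
proof -
  note csym = chord.sym[where 'n = 'n]
  interpret m: vertex_move "{1..Suc CARD('n)}" "chord :: nat \<Rightarrow> nat \<Rightarrow> 'n aw" "Suc a" "pred_vertex CARD('n) a" "Suc (Suc a)"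
    using a by (rule vertex_move_chord)
  note r = r_map_properties[OF a] and rbar = rbar_map_properties[OF a]
  note up = aw_up_antihom[where 'n = 'n, unfolded alg_antihom_def]
  show 1: "r_map a \<circ> rbar_map a = (id :: 'n aw \<Rightarrow> 'n aw)"
  proof (rule alg_hom_chord_eqI)
    show "alg_hom (r_map a \<circ> rbar_map a :: 'n aw \<Rightarrow> 'n aw)" by (rule alg_hom_comp[OF r(2) rbar(3)])
    show "alg_hom (id :: 'n aw \<Rightarrow> 'n aw)" by (rule alg_hom_id)
    fix x y assume xy: "x \<in> {1..Suc CARD('n)}" "y \<in> {1..Suc CARD('n)}"
    have at_v: "r_map a (rbar_map a (chord (Suc a) w)) = (chord (Suc a) w :: 'n aw)"
      if w: "w \<in> {1..Suc CARD('n)}" "w \<noteq> Suc a" for w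
    proof -
      note V = m.vertices
      have "rbar_map a (chord (Suc a) w) = (aw_up (m.h w) :: 'n aw)"
        unfolding rbar(2) using w V by (simp add: aw_up_chord r(3) m.G_simps)
      also have "\<dots> = - qcomm (chord (Suc a) w) (chord (pred_vertex CARD('n) a) (Suc (Suc a)))
          + chord (Suc (Suc a)) w * chord (pred_vertex CARD('n) a) (Suc a) + chord w (pred_vertex CARD('n) a) * chord (Suc a) (Suc (Suc a))"
        unfolding m.h_def alg_antihomD[OF aw_up_antihom] using w V by (simp add: aw_up_chord)
      \<comment> \<open>Applying \<open>r_map a\<close> also exchanges the two sides at the moved
        vertex, as \<open>h_inverse\<close> requires.\<close>
      finally have "r_map a (rbar_map a (chord (Suc a) w)) = - qcomm (m.h w) (chord (pred_vertex CARD('n) a) (Suc (Suc a)))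
          + chord (Suc (Suc a)) w * chord (Suc a) (Suc (Suc a)) + chord w (pred_vertex CARD('n) a) * chord (pred_vertex CARD('n) a) (Suc a)"
        using w V m.h_neighbour by (simp add: alg_homD[OF r(2)] r(3) m.G_simps m.G_def)
      also have "\<dots> = chord (Suc a) w"
        using m.h_inverse[OF w] m.edge_central[of "Suc (Suc a)" w] m.edge_central[of w "pred_vertex CARD('n) a"] w V
        by (simp add: commutes_def)
      finally show ?thesis .
    qed
    show "(r_map a \<circ> rbar_map a) (chord x y) = (id (chord x y) :: 'n aw)"
    proof (cases "x = y \<or> x = Suc a \<or> y = Suc a")
      case True
      have at_v': "r_map a (rbar_map a (chord (Suc a) w)) = (chord (Suc a) w :: 'n aw)"
        if "w \<in> {1..Suc CARD('n)}" for w
        using at_v[OF that] by (cases "w = Suc a") (simp_all add: alg_homD(1)[OF r(2)] alg_homD(1)[OF rbar(3)])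
      show ?thesis
        using True at_v'[OF xy(1)] at_v'[OF xy(2)] csym[of x "Suc a"] alg_homD(1)[OF r(2)] alg_homD(1)[OF rbar(3)]
        by auto
    next
      case False
      then show ?thesis
        using xy by (simp add: rbar(2) aw_up_chord r(3) m.G_simps)
    qed
  qed
  have "aw_up \<circ> (r_map a \<circ> rbar_map a) \<circ> aw_up = (id :: 'n aw \<Rightarrow> 'n aw)"
    unfolding 1 by (simp add: fun_eq_iff)
  then show "rbar_map a \<circ> r_map a = (id :: 'n aw \<Rightarrow> 'n aw)"
    unfolding rbar(2) by (simp add: fun_eq_iff)
qed

lemma two_moves_chord:
  assumes "a < CARD('n::finite)" "b < CARD('n)" "a \<noteq> b"
  shows "two_moves {1..Suc CARD('n)} (chord :: nat \<Rightarrow> nat \<Rightarrow> 'n aw) (Suc a) (pred_vertex CARD('n) a) (Suc (Suc a))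
    (Suc b) (pred_vertex CARD('n) b) (Suc (Suc b)) (r_map a) (r_map b)"
  using assms
  by (intro two_moves.intro chord.chord_family_axioms two_moves_axioms.intro vertex_move_chord r_map_properties) auto

lemma r_map_braid:
  assumes "a + 1 < CARD('n::finite)"
  shows "r_map a \<circ> r_map (a + 1) \<circ> r_map a = (r_map (a + 1) \<circ> r_map a \<circ> r_map (a + 1) :: 'n aw \<Rightarrow> 'n aw)"
proof -
  have ab: "a < CARD('n)" "a + 1 < CARD('n)" "a \<noteq> a + 1" using assms by auto
  have "two_moves {1..Suc CARD('n)} (chord :: nat \<Rightarrow> nat \<Rightarrow> 'n aw) (Suc a) (pred_vertex CARD('n) a) (Suc (Suc a))
    (Suc (Suc a)) (Suc a) (Suc (Suc (Suc a))) (r_map a) (r_map (a + 1))"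
    using two_moves_chord[OF ab] by (simp add: pred_vertex_def)
  then interpret adjacent_moves "{1..Suc CARD('n)}" "chord :: nat \<Rightarrow> nat \<Rightarrow> 'n aw" "Suc a" "pred_vertex CARD('n) a"
      "Suc (Suc a)" "Suc (Suc (Suc a))" "r_map a" "r_map (a + 1)"
    by (rule adjacent_moves.intro)
  show ?thesis
  proof (rule alg_hom_chord_eqI)
    fix x y assume xy: "x \<in> {1..Suc CARD('n)}" "y \<in> {1..Suc CARD('n)}"
    have ne: "pred_vertex CARD('n) a \<noteq> Suc (Suc a)" "Suc (Suc (Suc a)) \<noteq> Suc a"
      using ab by (auto simp: pred_vertex_def)
    show "(r_map a \<circ> r_map (a + 1) \<circ> r_map a) (chord x y)
        = ((r_map (a + 1) \<circ> r_map a \<circ> r_map (a + 1)) (chord x y) :: 'n aw)"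
      using braid[OF ne xy] by (simp only: o_def)
  qed (intro alg_hom_comp hom_f hom_g)+
qed

lemma r_map_commute:
  assumes "a < CARD('n::finite)" "b < CARD('n)" "\<bar>int a - int b\<bar> > 1"
  shows "r_map a \<circ> r_map b = (r_map b \<circ> r_map a :: 'n aw \<Rightarrow> 'n aw)"
proof -
  have "a \<noteq> b" using assms by auto
  then interpret two_moves "{1..Suc CARD('n)}" "chord :: nat \<Rightarrow> nat \<Rightarrow> 'n aw" "Suc a" "pred_vertex CARD('n) a" "Suc (Suc a)"
      "Suc b" "pred_vertex CARD('n) b" "Suc (Suc b)" "r_map a" "r_map b"
    using assms by (intro two_moves_chord)
  show ?thesis
  proof (rule alg_hom_chord_eqI)
    fix x y assume xy: "x \<in> {1..Suc CARD('n)}" "y \<in> {1..Suc CARD('n)}"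
    \<comment> \<open>For index 0 the predecessor wraps around to n + 1, which is never a moved
      vertex.\<close>
    have ne: "Suc b \<noteq> pred_vertex CARD('n) a" "Suc b \<noteq> Suc (Suc a)" "Suc a \<noteq> pred_vertex CARD('n) b" "Suc a \<noteq> Suc (Suc b)"
      using assms by (auto simp: pred_vertex_def)
    show "(r_map a \<circ> r_map b) (chord x y) = ((r_map b \<circ> r_map a) (chord x y) :: 'n aw)"
      using moves_commute[OF ne xy] by (simp only: o_def)
  qed (intro alg_hom_comp hom_f hom_g)+
qed

theorem theorem3p8:
  fixes n :: nat
  assumes "n = CARD('n::finite)"
  shows "(\<forall>a<n. well_defined_ext (r_gen a :: nat \<Rightarrow> nat \<Rightarrow> 'n aw) \<and>
                alg_automorphism (r_map a :: 'n aw \<Rightarrow> 'n aw)) \<and>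
         (\<forall>a<n. well_defined_ext (rbar_gen a :: nat \<Rightarrow> nat \<Rightarrow> 'n aw) \<and>
                alg_automorphism (rbar_map a :: 'n aw \<Rightarrow> 'n aw)) \<and>
         (\<forall>a<n. r_map a \<circ> rbar_map a = (id :: 'n aw \<Rightarrow> 'n aw) \<and>
                rbar_map a \<circ> r_map a = (id :: 'n aw \<Rightarrow> 'n aw)) \<and>
         (\<forall>a. a + 1 < n \<longrightarrow>
            r_map a \<circ> r_map (a + 1) \<circ> r_map a = (r_map (a + 1) \<circ> r_map a \<circ> r_map (a + 1) :: 'n aw \<Rightarrow> 'n aw)) \<and>
         (\<forall>a<n. \<forall>b<n. \<bar>int a - int b\<bar> > 1 \<longrightarrow>
            r_map a \<circ> r_map b = (r_map b \<circ> r_map a :: 'n aw \<Rightarrow> 'n aw))"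
proof -
  have bij: "bij (r_map a :: 'n aw \<Rightarrow> 'n aw)" "bij (rbar_map a :: 'n aw \<Rightarrow> 'n aw)" if "a < n" for a
    using r_rbar[of a, where 'n = 'n] that assms by (auto intro: o_bij)
  then show ?thesis
    using r_map_properties(1,2)[where 'n = 'n] rbar_map_properties(1,3)[where 'n = 'n] r_rbar[where 'n = 'n]
      r_map_braid[where 'n = 'n] r_map_commute[where 'n = 'n]
    unfolding assms alg_automorphism_def by simp
qed

end
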